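(* Let $p,q\in\mathbb{F}[t]$ be monic polynomials of degree $2$, both irreducible over $\mathbb{F}$, with the same splitting field $\mathbb{L}$ in $\overline{\mathbb{F}}$, and set $\delta:=\operatorname{tr}p-\operatorname{tr}q$. Consider the following matrices: (1) $C\Bigl(\bigl(t^2-\delta t+N_{\mathbb{L}/\mathbb{F}}(x-y)\bigr)^n\Bigr)$, with $n\ge1$ an integer, $x\in\operatorname{Root}(p)$ and $y\in\operatorname{Root}(q)$ such that $x-y\notin\mathbb{F}$; (2) $C\bigl((t-(x-y))^n\bigr)\oplus C\bigl((t-(x-y))^n\bigr)$, with $n\ge1$ an odd integer, $x\in\operatorname{Root}(p)$ and $y\in\operatorname{Root}(q)$ such that $x-y\in\mathbb{F}$; (3) $C\bigl((t-(x-y))^n\bigr)$, with $n\ge1$ an even integer, $x\in\operatorname{Root}(p)$ and $y\in\operatorname{Root}(q)$ such that $x-y\in\mathbb{F}$. Then, for every endomorphism $v$ represented by one of these matrices, $S(v)$ is an indecomposable $(p,q)$-exceptional symplectic $(p,q)$-difference; and every indecomposable symplectic $(p,q)$-difference $(b,u)$ in which $u$ is $(p,q)$-exceptional is isometric to $S(v)$ for some $v$ represented by one of these matrices.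
   Context: $\mathbb{F}$ is an arbitrary field (characteristic $2$ allowed), with a fixed algebraic closure $\overline{\mathbb{F}}$; all vector spaces are finite-dimensional over $\mathbb{F}$. For a monic polynomial $r\in\mathbb{F}[t]$ of degree $n>0$, $\operatorname{tr}r$ is the opposite of the coefficient of $r$ on $t^{n-1}$, and $\operatorname{Root}(r)$ is the set of roots of $r$ in $\overline{\mathbb{F}}$; $\operatorname{Root}(p)-\operatorname{Root}(q):=\{x-y : x\in\operatorname{Root}(p),\,y\in\operatorname{Root}(q)\}$. $C(s)$ denotes the companion matrix of the monic polynomial $s$. $N_{\mathbb{L}/\mathbb{F}}(z)=z\,\sigma(z)$, where $\sigma$ is the non-identity automorphism of $\mathbb{L}$ over $\mathbb{F}$ if $\mathbb{L}$ is separable over $\mathbb{F}$, and $\sigma=\operatorname{id}_{\mathbb{L}}$ otherwise. An endomorphism is $(p,q)$-exceptional if all its eigenvalues in $\overline{\mathbb{F}}$ belong to $\operatorname{Root}(p)-\operatorname{Root}(q)$. A symplectic form is a non-degenerate alternating bilinear form. Given a symplectic form $b$ on $V$, an endomorphism $u$ of $V$ is $b$-alternating if $b(x,u(x))=0$ for all $x\in V$. A symplectic pair $(b,u)$ consists of a symplectic form $b$ on a vector space and a $b$-alternating endomorphism $u$ of it; it is trivial if the space is $\{0\}$, and it is called $(p,q)$-exceptional if $u$ is. It is a symplectic $(p,q)$-difference if there are $b$-alternating endomorphisms $u_1,u_2$ with $u=u_1-u_2$, $p(u_1)=0$ and $q(u_2)=0$. Two symplectic pairs $(b,u)$ on $V$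 and $(b',u')$ on $V'$ are isometric if there is a linear isomorphism $\varphi:V\to V'$ with $b'(\varphi(x),\varphi(y))=b(x,y)$ and $u'\circ\varphi=\varphi\circ u$. Their orthogonal direct sum is $(b\bot b',u\oplus u')$ on $V\times V'$. A symplectic $(p,q)$-difference is indecomposable if it is non-trivial and not isometric to the orthogonal direct sum of two non-trivial symplectic $(p,q)$-differences. For an endomorphism $v$ of $V$ with transpose $v^t:\varphi\mapsto\varphi\circ v$ on the dual space $V^\star$, put $h(v):=v\oplus v^t$ on $V\times V^\star$ and $S_V((x,\varphi),(y,\psi)):=\varphi(y)-\psi(x)$. The symplectic extension of $v$ is the symplectic pair $S(v):=(S_V,h(v))$. *)

theory Defs
  imports
    "HOL-Algebra.Algebraic_Closure_Type"
    "HOL-Algebra.Generated_Fields"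
    "HOL-Library.Function_Algebras"
    "HOL-Library.Product_Plus"
    "Jordan_Normal_Form.Char_Poly"
begin

section \<open>Finite-dimensional vector spaces\<close>

text \<open>
  A vector space is given by its set of vectors, a subspace of some ambient vector space structure
  on the type \<^typ>\<open>'v\<close>. Taking the full type is allowed; proper subspaces are needed for dual spaces
  and for quantifying over spaces of arbitrary dimension. Maps between such spaces are only
  relevant on the set of vectors.
\<close>

record ('a, 'v) vspace =
  vectors :: "'v set"
  scale :: "'a \<Rightarrow> 'v \<Rightarrow> 'v"

definition fd_space :: "('a::field, 'v::ab_group_add, 'm) vspace_scheme \<Rightarrow> bool" where
  "fd_space V \<longleftrightarrow>
     vector_space (scale V) \<and> module.subspace (scale V) (vectors V) \<and>
     (\<exists>B. finite B \<and> module.span (scale V) B = vectors V)"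

definition linear_map ::
    "('a, 'v::ab_group_add, 'm) vspace_scheme \<Rightarrow> ('a, 'w::ab_group_add, 'n) vspace_scheme \<Rightarrow>
     ('v \<Rightarrow> 'w) \<Rightarrow> bool" where
  "linear_map V W f \<longleftrightarrow>
     (\<forall>x\<in>vectors V. f x \<in> vectors W) \<and>
     (\<forall>x\<in>vectors V. \<forall>y\<in>vectors V. f (x + y) = f x + f y) \<and>
     (\<forall>c. \<forall>x\<in>vectors V. f (scale V c x) = scale W c (f x))"

definition linear_iso ::
    "('a, 'v::ab_group_add, 'm) vspace_scheme \<Rightarrow> ('a, 'w::ab_group_add, 'n) vspace_scheme \<Rightarrow>
     ('v \<Rightarrow> 'w) \<Rightarrow> bool" where
  "linear_iso V W f \<longleftrightarrow> linear_map V W f \<and> bij_betw f (vectors V) (vectors W)"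

lemma fd_space_iso_sequences:
  fixes V :: "('a::field, 'v::ab_group_add, 'm) vspace_scheme"
  assumes "fd_space V"
  shows "\<exists>(W :: ('a, nat \<Rightarrow> 'a) vspace) f. fd_space W \<and> linear_iso V W f"
proof -
  interpret vs: vector_space "scale V" using assms by (simp add: fd_space_def)
  obtain A where A: "finite A" "vs.span A = vectors V" using assms by (auto simp: fd_space_def)
  obtain B where B: "B \<subseteq> A" "vs.independent B" "A \<subseteq> vs.span B"
    by (rule vs.maximal_independent_subset)
  have "finite B" using A(1) B(1) finite_subset by blast
  have spanB: "vs.span B = vectors V"
    using A(2) B(1,3) by (metis subset_antisym vs.span_mono vs.span_span)
  obtain e where e: "bij_betw e {..<card B} B"
    using \<open>finite B\<close> ex_bij_betw_nat_finite lessThan_atLeast0 by metis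
  define n where "n = card B"
  define sc :: "'a \<Rightarrow> (nat \<Rightarrow> 'a) \<Rightarrow> nat \<Rightarrow> 'a" where "sc = (\<lambda>c f i. c * f i)"
  define U :: "(nat \<Rightarrow> 'a) set" where "U = {f. \<forall>i\<ge>n. f i = 0}"
  define u :: "nat \<Rightarrow> nat \<Rightarrow> 'a" where "u = (\<lambda>i j. if j = i then 1 else 0)"
  define f where "f = (\<lambda>x i. if i < n then vs.representation B x (e i) else 0)"
  interpret seq: vector_space sc
    by unfold_locales (auto simp: sc_def fun_eq_iff algebra_simps)
  have sub: "seq.subspace U" unfolding seq.subspace_def by (auto simp: U_def sc_def)
  have sum_apply: "(\<Sum>i\<in>I. g i) j = (\<Sum>i\<in>I. g i j)" for g :: "nat \<Rightarrow> nat \<Rightarrow> 'a" and I j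
    by (induction I rule: infinite_finite_induct) auto
  have "seq.span (u ` {..<n}) = U"
  proof
    show "seq.span (u ` {..<n}) \<subseteq> U"
      by (rule seq.span_minimal[OF _ sub]) (auto simp: U_def u_def)
    show "U \<subseteq> seq.span (u ` {..<n})"
    proof
      fix g assume "g \<in> U"
      have "g = (\<Sum>i<n. sc (g i) (u i))"
      proof
        fix j show "g j = (\<Sum>i<n. sc (g i) (u i)) j"
          using \<open>g \<in> U\<close> by (simp add: sum_apply sc_def u_def U_def if_distrib[of "(*) _"] cong: if_cong)
      qed
      also have "\<dots> \<in> seq.span (u ` {..<n})"
        by (intro seq.span_sum seq.span_scale seq.span_base) auto
      finally show "g \<in> seq.span (u ` {..<n})" .
    qed
  qed
  then have "fd_space \<lparr>vectors = U, scale = sc\<rparr>"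
    using sub seq.vector_space_axioms by (auto simp: fd_space_def)
  moreover have "linear_map V \<lparr>vectors = U, scale = sc\<rparr> f"
    unfolding linear_map_def
    by (auto simp: f_def U_def sc_def fun_eq_iff spanB B(2)
        vs.representation_add[OF B(2)] vs.representation_scale[OF B(2)])
  moreover have "bij_betw f (vectors V) U"
  proof (rule bij_betwI[where g = "\<lambda>g. \<Sum>i<n. scale V (g i) (e i)"])
    show "f \<in> vectors V \<rightarrow> U" by (auto simp: f_def U_def)
    have eB: "e i \<in> B" if "i < n" for i
      using e that by (auto simp: n_def dest: bij_betwE)
    show "(\<lambda>g. \<Sum>i<n. scale V (g i) (e i)) \<in> U \<rightarrow> vectors V"
      unfolding spanB[symmetric]
      by (intro Pi_I vs.span_sum vs.span_scale vs.span_base eB) auto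
    show "(\<Sum>i<n. scale V (f x i) (e i)) = x" if "x \<in> vectors V" for x
    proof -
      have "(\<Sum>i<n. scale V (f x i) (e i)) = (\<Sum>i<n. scale V (vs.representation B x (e i)) (e i))"
        by (simp add: f_def)
      also have "\<dots> = (\<Sum>b\<in>B. scale V (vs.representation B x b) b)"
        using sum.reindex_bij_betw[OF e, of "\<lambda>b. scale V (vs.representation B x b) b"]
        by (simp add: n_def)
      also have "\<dots> = x"
        using that spanB \<open>finite B\<close> by (intro vs.sum_representation_eq[OF B(2)]) auto
      finally show ?thesis .
    qed
    show "f (\<Sum>i<n. scale V (g i) (e i)) = g" if "g \<in> U" for g
    proof
      fix j
      have "vs.representation B (\<Sum>i<n. scale V (g i) (e i)) (e j) = g j" if "j < n"
      proof -
        have "vs.representation B (\<Sum>i<n. scale V (g i) (e i)) (e j) =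
              (\<Sum>i<n. vs.representation B (scale V (g i) (e i)) (e j))"
          by (subst vs.representation_sum[OF B(2)])
             (auto intro: vs.span_scale vs.span_base eB)
        also have "\<dots> = (\<Sum>i<n. g i * (if e i = e j then 1 else 0))"
          by (intro sum.cong refl)
             (auto simp: vs.representation_scale[OF B(2)] vs.representation_basis[OF B(2)]
               eB vs.span_base)
        also have "\<dots> = (\<Sum>i<n. if i = j then g i else 0)"
          using e \<open>j < n\<close> by (intro sum.cong refl) (auto simp: n_def bij_betw_def inj_on_def)
        also have "\<dots> = g j" using \<open>j < n\<close> by simp
        finally show ?thesis .
      qed
      then show "f (\<Sum>i<n. scale V (g i) (e i)) j = g j"
        using \<open>g \<in> U\<close> by (auto simp: f_def U_def)
    qed
  qed
  ultimately show ?thesis unfolding linear_iso_def by (metis select_convs(1))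
qed

definition ground :: "('a::field, 'a) vspace" where
  "ground = \<lparr>vectors = UNIV, scale = (*)\<rparr>"

text \<open>Linear forms on a proper subspace are normalised to vanish outside it, so that each linear
  form is represented by exactly one function.\<close>

definition dual :: "('a::field, 'v::ab_group_add, 'm) vspace_scheme \<Rightarrow> ('a, 'v \<Rightarrow> 'a) vspace" where
  "dual V = \<lparr>vectors = {\<phi>. linear_map V ground \<phi> \<and> (\<forall>x. x \<notin> vectors V \<longrightarrow> \<phi> x = 0)},
             scale = (\<lambda>c \<phi> x. c * \<phi> x)\<rparr>"

definition transpose_map ::
    "('a::field, 'v::ab_group_add, 'm) vspace_scheme \<Rightarrow> ('v \<Rightarrow> 'v) \<Rightarrow> ('v \<Rightarrow> 'a) \<Rightarrow> ('v \<Rightarrow> 'a)" where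
  "transpose_map V v \<phi> = (\<lambda>x. if x \<in> vectors V then \<phi> (v x) else 0)"

definition annihilates ::
    "'a::field poly \<Rightarrow> ('a, 'v::ab_group_add, 'm) vspace_scheme \<Rightarrow> ('v \<Rightarrow> 'v) \<Rightarrow> bool" where
  "annihilates r V u \<longleftrightarrow>
     (\<forall>x\<in>vectors V. (\<Sum>i\<le>Polynomial.degree r. scale V (Polynomial.coeff r i) ((u ^^ i) x)) = 0)"

definition ordered_basis ::
    "('a::field, 'v::ab_group_add, 'm) vspace_scheme \<Rightarrow> nat \<Rightarrow> (nat \<Rightarrow> 'v) \<Rightarrow> bool" where
  "ordered_basis V n e \<longleftrightarrow>
     inj_on e {..<n} \<and> \<not> module.dependent (scale V) (e ` {..<n}) \<and>
     module.span (scale V) (e ` {..<n}) = vectors V"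

definition represented_by ::
    "('a::field, 'v::ab_group_add, 'm) vspace_scheme \<Rightarrow> ('v \<Rightarrow> 'v) \<Rightarrow> 'a mat \<Rightarrow> bool" where
  "represented_by V v M \<longleftrightarrow>
     (\<exists>n e. M \<in> carrier_mat n n \<and> ordered_basis V n e \<and>
       (\<forall>j<n. v (e j) = (\<Sum>i<n. scale V (M $$ (i, j)) (e i))))"

definition closure_eigenvalues ::
    "('a::field, 'v::ab_group_add, 'm) vspace_scheme \<Rightarrow> ('v \<Rightarrow> 'v) \<Rightarrow> 'a alg_closure set" where
  "closure_eigenvalues V u = {l. \<exists>M. represented_by V u M \<and> eigenvalue (map_mat to_ac M) l}"


section \<open>Symplectic pairs\<close>

record ('a, 'v) form_space = "('a, 'v) vspace" +
  form :: "'v \<Rightarrow> 'v \<Rightarrow> 'a"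
  endo :: "'v \<Rightarrow> 'v"

definition symplectic_form ::
    "('a::field, 'v::ab_group_add, 'm) vspace_scheme \<Rightarrow> ('v \<Rightarrow> 'v \<Rightarrow> 'a) \<Rightarrow> bool" where
  "symplectic_form V b \<longleftrightarrow>
     (\<forall>x\<in>vectors V. linear_map V ground (\<lambda>y. b x y)) \<and>
     (\<forall>y\<in>vectors V. linear_map V ground (\<lambda>x. b x y)) \<and>
     (\<forall>x\<in>vectors V. b x x = 0) \<and>
     (\<forall>x\<in>vectors V. (\<forall>y\<in>vectors V. b x y = 0) \<longrightarrow> x = 0)"

definition alternating_endo ::
    "('a::field, 'v::ab_group_add, 'm) vspace_scheme \<Rightarrow> ('v \<Rightarrow> 'v \<Rightarrow> 'a) \<Rightarrow> ('v \<Rightarrow> 'v) \<Rightarrow> bool" where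
  "alternating_endo V b u \<longleftrightarrow> linear_map V V u \<and> (\<forall>x\<in>vectors V. b x (u x) = 0)"

definition symplectic_pair :: "('a::field, 'v::ab_group_add) form_space \<Rightarrow> bool" where
  "symplectic_pair P \<longleftrightarrow>
     fd_space P \<and> symplectic_form P (form P) \<and> alternating_endo P (form P) (endo P)"

definition symplectic_difference ::
    "'a::field poly \<Rightarrow> 'a poly \<Rightarrow> ('a, 'v::ab_group_add) form_space \<Rightarrow> bool" where
  "symplectic_difference p q P \<longleftrightarrow>
     symplectic_pair P \<and>
     (\<exists>u1 u2. alternating_endo P (form P) u1 \<and> alternating_endo P (form P) u2 \<and>
        (\<forall>x\<in>vectors P. endo P x = u1 x - u2 x) \<and>
        annihilates p P u1 \<and> annihilates q P u2)"

definition trivial_pair :: "('a, 'v::ab_group_add) form_space \<Rightarrow> bool" where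
  "trivial_pair P \<longleftrightarrow> vectors P = {0}"

definition isometric ::
    "('a::field, 'v::ab_group_add) form_space \<Rightarrow> ('a, 'w::ab_group_add) form_space \<Rightarrow> bool" where
  "isometric P Q \<longleftrightarrow>
     (\<exists>f. linear_iso P Q f \<and>
        (\<forall>x\<in>vectors P. \<forall>y\<in>vectors P. form Q (f x) (f y) = form P x y) \<and>
        (\<forall>x\<in>vectors P. endo Q (f x) = f (endo P x)))"

definition orth_sum ::
    "('a::field, 'v::ab_group_add) form_space \<Rightarrow> ('a, 'w::ab_group_add) form_space \<Rightarrow>
     ('a, 'v \<times> 'w) form_space" where
  "orth_sum P Q =
     \<lparr>vectors = vectors P \<times> vectors Q,
      scale = (\<lambda>c. map_prod (scale P c) (scale Q c)),
      form = (\<lambda>(x, x') (y, y'). form P x y + form Q x' y'),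
      endo = map_prod (endo P) (endo Q)\<rparr>"

text \<open>
  HOL cannot quantify over types inside a formula, so the summands range over the spaces carried by
  \<^typ>\<open>nat \<Rightarrow> 'a\<close>. Up to isomorphism these are all finite-dimensional spaces, see
  \<open>fd_space_iso_sequences\<close>.
\<close>

definition indecomposable_difference ::
    "'a::field poly \<Rightarrow> 'a poly \<Rightarrow> ('a, 'v::ab_group_add) form_space \<Rightarrow> bool" where
  "indecomposable_difference p q P \<longleftrightarrow>
     symplectic_difference p q P \<and> \<not> trivial_pair P \<and>
     \<not> (\<exists>(P1 :: ('a, nat \<Rightarrow> 'a) form_space) (P2 :: ('a, nat \<Rightarrow> 'a) form_space).
          symplectic_difference p q P1 \<and> \<not> trivial_pair P1 \<and>
          symplectic_difference p q P2 \<and> \<not> trivial_pair P2 \<and>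
          isometric P (orth_sum P1 P2))"

definition symplectic_extension ::
    "('a::field, 'v::ab_group_add) vspace \<Rightarrow> ('v \<Rightarrow> 'v) \<Rightarrow> ('a, 'v \<times> ('v \<Rightarrow> 'a)) form_space" where
  "symplectic_extension V v =
     \<lparr>vectors = vectors V \<times> vectors (dual V),
      scale = (\<lambda>c. map_prod (scale V c) (scale (dual V) c)),
      form = (\<lambda>(x, \<phi>) (y, \<psi>). \<phi> y - \<psi> x),
      endo = map_prod v (transpose_map V v)\<rparr>"


section \<open>Roots, splitting fields and norms\<close>

definition poly_trace :: "'a::field poly \<Rightarrow> 'a" where
  "poly_trace r = - Polynomial.coeff r (Polynomial.degree r - 1)"

definition Root :: "'a::field poly \<Rightarrow> 'a alg_closure set" where
  "Root r = {x. poly (map_poly to_ac r) x = 0}"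

definition pq_exceptional ::
    "'a::field poly \<Rightarrow> 'a poly \<Rightarrow> ('a, 'v::ab_group_add) form_space \<Rightarrow> bool" where
  "pq_exceptional p q P \<longleftrightarrow>
     closure_eigenvalues P (endo P) \<subseteq> {x - y |x y. x \<in> Root p \<and> y \<in> Root q}"

abbreviation closure_ring :: "'a::field alg_closure ring" where
  "closure_ring \<equiv> ring_of_type_algebra"

definition splitting_field :: "'a::field poly \<Rightarrow> 'a alg_closure set" where
  "splitting_field r = generate_field closure_ring (range to_ac \<union> Root r)"

definition separable_over_base :: "'a::field alg_closure set \<Rightarrow> bool" where
  "separable_over_base L \<longleftrightarrow>
     (\<forall>x\<in>L. \<exists>r :: 'a poly. Factorial_Ring.irreducible r \<and> x \<in> Root r \<and> rsquarefree (map_poly to_ac r))"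

definition automorphisms :: "'a::field alg_closure set \<Rightarrow> ('a alg_closure \<Rightarrow> 'a alg_closure) set" where
  "automorphisms L =
     {\<sigma> \<in> ring_iso (closure_ring\<lparr>carrier := L\<rparr>) (closure_ring\<lparr>carrier := L\<rparr>).
        \<forall>c. \<sigma> (to_ac c) = to_ac c}"

text \<open>The next two definitions are meant for a quadratic extension \<open>L\<close> of the base field. In the
  separable case the chosen function is then determined on \<open>L\<close>, though not outside it.\<close>

definition quadratic_conj :: "'a::field alg_closure set \<Rightarrow> 'a alg_closure \<Rightarrow> 'a alg_closure" where
  "quadratic_conj L =
     (if separable_over_base L then SOME \<sigma>. \<sigma> \<in> automorphisms L \<and> (\<exists>z\<in>L. \<sigma> z \<noteq> z) else id)"

definition quadratic_norm :: "'a::field alg_closure set \<Rightarrow> 'a alg_closure \<Rightarrow> 'a alg_closure" where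
  "quadratic_norm L z = z * quadratic_conj L z"


section \<open>The model matrices\<close>

definition companion_mat :: "'a::field poly \<Rightarrow> 'a mat" where
  "companion_mat s = (let n = Polynomial.degree s in
     mat n n (\<lambda>(i, j). if j = n - 1 then - Polynomial.coeff s i else if i = j + 1 then 1 else 0))"

text \<open>The base field is embedded into its closure by \<^const>\<open>to_ac\<close>: below, \<open>c\<close> is the norm of
  \<open>x - y\<close>, and \<open>d\<close> is \<open>x - y\<close> itself, seen as elements of the base field.\<close>

definition model_matrices :: "'a::field poly \<Rightarrow> 'a poly \<Rightarrow> 'a alg_closure set \<Rightarrow> 'a mat set" where
  "model_matrices p q L =
     {companion_mat ([:c, - (poly_trace p - poly_trace q), 1:] ^ n) |c n x y.
        n \<ge> 1 \<and> x \<in> Root p \<and> y \<in> Root q \<and> x - y \<notin> range to_ac \<and> to_ac c = quadratic_norm L (x - y)} \<union>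
     {diag_block_mat [companion_mat ([:- d, 1:] ^ n), companion_mat ([:- d, 1:] ^ n)] |d n x y.
        odd n \<and> x \<in> Root p \<and> y \<in> Root q \<and> to_ac d = x - y} \<union>
     {companion_mat ([:- d, 1:] ^ n) |d n x y.
        n \<ge> 1 \<and> even n \<and> x \<in> Root p \<and> y \<in> Root q \<and> to_ac d = x - y}"

end

theory Submission
  imports Defs
begin

hide_const (open) Coset.order

text \<open>
  If a power \<open>\<pi>\<^sup>n\<close> of an irreducible polynomial is the exact power of \<open>\<pi>\<close> in the minimal polynomial of \<open>u\<close>,
  then a vector of order \<open>\<pi>\<^sup>n\<close> and a suitable partner generate a non-degenerate stable subspace, an
  orthogonal summand isometric to \<open>S(C(\<pi>\<^sup>n))\<close>. So every symplectic pair is an orthogonal sum of such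
  cells, and it remains to decide which sums of cells are differences.

  For \<open>\<pi> = t\<^sup>2 - \<delta> t + c\<close>, and for \<open>\<pi> = t - d\<close> with \<open>n\<close> even, where \<open>\<pi>\<^sup>n\<close> is a power of
  \<open>t\<^sup>2 - \<delta> t + d\<^sup>2\<close>, an explicit \<open>u\<^sub>1\<close> commuting with \<open>u\<^sup>2 - \<delta> u\<close> exists on a single cell. For \<open>\<pi> = t - d\<close>
  with \<open>n\<close> odd it exists on two equal cells, and one cell is not enough: \<open>u\<^sub>1\<close> commutes with \<open>(u - d)\<^sup>2\<close>
  and acts as an alternating root of the irreducible quadratic \<open>p\<close> on the image of each
  \<open>(u - d)\<^sup>2\<^sup>k\<close>, which carries an induced symplectic form, so that these images have dimension divisible
  by 4. The same divisibility shows that odd cells occur in equal pairs, and that a pair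
  of odd cells does not decompose further.
\<close>

section \<open>Polynomials acting on a symplectic space\<close>

text \<open>Let p = t^2 - \<kappa> t + \<alpha> and q = t^2 - \<mu> t + \<beta>, and write w for
  u_1. Given p(w) = 0, the condition q(w - u) = 0 is the relation w u + u w = (\<kappa> - \<mu>) w +
  u^2 + \<mu> u + (\<beta> - \<alpha>), from which w commutes with u^2 - \<delta> u. The common
  splitting field enters twice: the norm of x - y lies in F and makes x - y a root of t^2 - \<delta>
  t + c; and if x - y = d lies in F, then q(t) = p(t + d), so that T = u - d satisfies w T + T w =
  \<kappa> T + T^2. Moving w past one T therefore replaces it by \<kappa> - w up to a multiple of T;
  only even powers of T commute with w, hence the role of parity. Two obstacles shape the proof. A
  cell need not be stable under u_1, so restricting u_1 does not show that its complement is a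
  difference; the divisibility of ranks by 4 does pass to complements, and together with
  exceptionality it suffices to build a new u_1. And in characteristic 2 a selfadjoint map need not
  be alternating, so diagonal values b(x, w x) are always treated separately.\<close>

definition act :: "('a::field \<Rightarrow> 'v::ab_group_add \<Rightarrow> 'v) \<Rightarrow> ('v \<Rightarrow> 'v) \<Rightarrow> 'a poly \<Rightarrow> 'v \<Rightarrow> 'v" where
  "act sc u f z = (\<Sum>i\<le>Polynomial.degree f. sc (Polynomial.coeff f i) ((u ^^ i) z))"

section \<open>Dimension counts for finitely spanned subspaces\<close>

locale scalar_space = vector_space sc
  for sc :: "'a::field \<Rightarrow> 'v::ab_group_add \<Rightarrow> 'v" (infixr "*s" 75)
begin

text \<open>Inclusion in a finite span instead of equality, so that the property passes to every
  subset.\<close>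

definition finitely_spanned :: "'v set \<Rightarrow> bool" where
  "finitely_spanned V \<longleftrightarrow> (\<exists>B. finite B \<and> V \<subseteq> span B)"

lemma finitely_spanned_subset: "finitely_spanned V \<Longrightarrow> W \<subseteq> V \<Longrightarrow> finitely_spanned W"
  unfolding finitely_spanned_def by blast

lemma finitely_spanned_basis:
  assumes "finitely_spanned V" "subspace V"
  obtains B where "finite B" "independent B" "span B = V" "card B = dim V"
proof -
  obtain B where B: "B \<subseteq> V" "independent B" "V \<subseteq> span B" "card B = dim V"
    using basis_exists by blast
  obtain F where F: "finite F" "V \<subseteq> span F" using assms by (auto simp: finitely_spanned_def)
  have "finite B" using independent_span_bound[OF F(1) B(2)] B(1) F(2) by blast
  moreover have "span B = V" using B assms(2) by (simp add: span_subspace)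
  ultimately show ?thesis using that B by blast
qed

text \<open>Independence is assumed for the indexed family. Two equal vectors would satisfy the
  relation with coefficients 1 and -1, so injectivity of \<open>E\<close> comes as part of the
  conclusion.\<close>

lemma dim_family:
  assumes "finite I" "\<And>c. (\<Sum>i\<in>I. sc (c i) (E i)) = 0 \<Longrightarrow> \<forall>i\<in>I. c i = 0"
  shows "dim {\<Sum>i\<in>I. sc (c i) (E i) |c. True} = card I"
    and "inj_on E I" and "independent (E ` I)"
proof -
  show inj: "inj_on E I"
  proof
    fix i j assume ij: "i \<in> I" "j \<in> I" "E i = E j"
    show "i = j"
    proof (rule ccontr)
      assume "i \<noteq> j"
      define c where "c = (\<lambda>k. if k = i then 1 else if k = j then -1 else (0::'a))"
      have "(\<Sum>k\<in>I. sc (c k) (E k)) = (\<Sum>k\<in>{i,j}. sc (c k) (E k))"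
        using assms(1) ij by (intro sum.mono_neutral_right) (auto simp: c_def)
      also have "\<dots> = 0" using \<open>i \<noteq> j\<close> ij by (simp add: c_def)
      finally have "\<forall>i\<in>I. c i = 0" by (rule assms(2))
      then have "c i = 0" using ij(1) by blast
      then show False by (simp add: c_def)
    qed
  qed
  have fin: "finite (E ` I)" using assms(1) by simp
  show ind: "independent (E ` I)"
  proof (rule independent_if_scalars_zero[OF fin])
    fix f x assume f: "(\<Sum>x\<in>E ` I. sc (f x) x) = 0" and x: "x \<in> E ` I"
    have "(\<Sum>i\<in>I. sc (f (E i)) (E i)) = 0" using f by (simp add: sum.reindex[OF inj])
    then show "f x = 0" using assms(2)[of "\<lambda>i. f (E i)"] x by auto
  qed
  have "{\<Sum>i\<in>I. sc (c i) (E i) |c. True} = span (E ` I)"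
  proof
    show "{\<Sum>i\<in>I. sc (c i) (E i) |c. True} \<subseteq> span (E ` I)"
      by (auto intro: span_sum span_scale span_base)
    show "span (E ` I) \<subseteq> {\<Sum>i\<in>I. sc (c i) (E i) |c. True}"
    proof
      fix x assume "x \<in> span (E ` I)"
      then obtain r where "x = (\<Sum>v\<in>E ` I. sc (r v) v)" by (auto simp: span_finite[OF fin])
      then have "x = (\<Sum>i\<in>I. sc (r (E i)) (E i))" by (simp add: sum.reindex[OF inj])
      then show "x \<in> {\<Sum>i\<in>I. sc (c i) (E i) |c. True}"
        by (auto intro!: exI[of _ "\<lambda>i. r (E i)"])
    qed
  qed
  then show "dim {\<Sum>i\<in>I. sc (c i) (E i) |c. True} = card I"
    using ind inj by (simp add: dim_eq_card_independent card_image)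
qed

lemma dim_direct_sum:
  assumes "finitely_spanned V" "subspace V" "finitely_spanned W" "subspace W" "V \<inter> W = {0}"
  shows "dim {x + y |x y. x \<in> V \<and> y \<in> W} = dim V + dim W"
proof -
  obtain B where B: "finite B" "independent B" "span B = V" "card B = dim V"
    using finitely_spanned_basis assms by blast
  obtain C where C: "finite C" "independent C" "span C = W" "card C = dim W"
    using finitely_spanned_basis assms by blast
  have disj: "B \<inter> C = {}"
  proof (rule ccontr)
    assume "B \<inter> C \<noteq> {}"
    then obtain x where x: "x \<in> B" "x \<in> C" by blast
    then have "x = 0" using assms(5) B(3) C(3) span_base by blast
    then show False using B(2) x dependent_zero by blast
  qed
  have "independent (B \<union> C)"
  proof (rule independent_if_scalars_zero)
    show "finite (B \<union> C)" using B C by simp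
    fix f x assume f: "(\<Sum>x\<in>B \<union> C. sc (f x) x) = 0" and x: "x \<in> B \<union> C"
    define y where "y = (\<Sum>x\<in>B. sc (f x) x)"
    define z where "z = (\<Sum>x\<in>C. sc (f x) x)"
    have "y + z = 0" using f B(1) C(1) disj by (simp add: sum.union_disjoint y_def z_def)
    then have "y = - z" by (simp add: add_eq_0_iff)
    have "y \<in> V" unfolding y_def B(3)[symmetric] by (intro span_sum span_scale span_base)
    moreover have "z \<in> W" unfolding z_def C(3)[symmetric] by (intro span_sum span_scale span_base)
    ultimately have "y \<in> V \<inter> W" using \<open>y = - z\<close> subspace_neg[OF assms(4)] by simp
    then have "y = 0" "z = 0" using \<open>y = - z\<close> assms(5) by auto
    then show "f x = 0"
      using x independentD[OF B(2) B(1) order_refl, of f x] independentD[OF C(2) C(1) order_refl, of f x]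
      by (auto simp: y_def z_def)
  qed
  moreover have "span (B \<union> C) = {x + y |x y. x \<in> V \<and> y \<in> W}"
    by (simp add: span_Un B C)
  ultimately show ?thesis
    using B C disj by (metis card_Un_disjoint dim_span_eq_card_independent)
qed

lemma dim_eq_0_iff: "finitely_spanned V \<Longrightarrow> subspace V \<Longrightarrow> dim V = 0 \<longleftrightarrow> V = {0}"
proof
  assume V: "finitely_spanned V" "subspace V" "dim V = 0"
  obtain B where "finite B" "span B = V" "card B = dim V" using finitely_spanned_basis V by metis
  then show "V = {0}" using V by auto
qed (metis card.empty dim_span dim_eq_card_independent independent_empty span_empty)

lemma dim_subspace_le:
  assumes "finitely_spanned V" "subspace V" "W \<subseteq> V"
  shows "dim W \<le> dim V"
proof -
  obtain B where "finite B" "span B = V" "card B = dim V" using finitely_spanned_basis assms by metis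
  then show ?thesis using assms(3) dim_le_card by metis
qed

end


section \<open>Polynomials in an endomorphism that is linear on \<open>V\<close>\<close>

locale endo_space = scalar_space sc
  for sc :: "'a::field \<Rightarrow> 'v::ab_group_add \<Rightarrow> 'v" (infixr "*s" 75) +
  fixes V :: "'v set" and u :: "'v \<Rightarrow> 'v"
  assumes subspace_V: "subspace V"
    and u_in [simp]: "z \<in> V \<Longrightarrow> u z \<in> V"
    and u_add: "\<lbrakk>x \<in> V; y \<in> V\<rbrakk> \<Longrightarrow> u (x + y) = u x + u y"
    and u_scale: "x \<in> V \<Longrightarrow> u (c *s x) = c *s u x"
begin

abbreviation ac :: "'a poly \<Rightarrow> 'v \<Rightarrow> 'v" (infixr "\<diamondop>" 75)
  where "f \<diamondop> z \<equiv> act (*s) u f z"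

lemma V_0 [simp]: "0 \<in> V" and V_add [simp]: "x \<in> V \<Longrightarrow> y \<in> V \<Longrightarrow> x + y \<in> V"
  and V_scale [simp]: "x \<in> V \<Longrightarrow> c *s x \<in> V" and V_neg [simp]: "x \<in> V \<Longrightarrow> - x \<in> V"
  and V_diff [simp]: "x \<in> V \<Longrightarrow> y \<in> V \<Longrightarrow> x - y \<in> V"
  using subspace_V by (auto intro: subspace_0 subspace_add subspace_scale subspace_neg subspace_diff)

lemma V_sum [simp]: "(\<And>i. i \<in> I \<Longrightarrow> g i \<in> V) \<Longrightarrow> sum g I \<in> V"
  using subspace_V by (rule subspace_sum)

lemma V_sum_less [simp]: "(\<And>i. i < n \<Longrightarrow> g i \<in> V) \<Longrightarrow> (\<Sum>i<n. g i) \<in> V" for n :: nat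
  by (rule V_sum) simp

lemma u_0 [simp]: "u 0 = 0"
  using u_scale[of 0 0] by simp

lemma u_neg: "x \<in> V \<Longrightarrow> u (- x) = - u x"
  using u_scale[of x "-1"] by simp

lemma u_diff: "\<lbrakk>x \<in> V; y \<in> V\<rbrakk> \<Longrightarrow> u (x - y) = u x - u y"
  using u_add[of x "- y"] u_neg[of y] by simp

lemma u_sum: "(\<And>i. i \<in> I \<Longrightarrow> g i \<in> V) \<Longrightarrow> u (sum g I) = (\<Sum>i\<in>I. u (g i))"
  by (induction I rule: infinite_finite_induct) (auto simp: u_add)

lemma funpow_in [simp]: "z \<in> V \<Longrightarrow> (u ^^ i) z \<in> V"
  by (induction i) auto

lemma act_in [simp]: "z \<in> V \<Longrightarrow> f \<diamondop> z \<in> V"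
  unfolding act_def by auto

lemma act_less:
  assumes "Polynomial.degree f < n"
  shows "f \<diamondop> z = (\<Sum>i<n. Polynomial.coeff f i *s (u ^^ i) z)"
  unfolding act_def using assms by (intro sum.mono_neutral_left) (auto simp: coeff_eq_0)

lemma act_0 [simp]: "0 \<diamondop> z = 0"
  by (simp add: act_def)

lemma act_pCons: "z \<in> V \<Longrightarrow> pCons c f \<diamondop> z = c *s z + u (f \<diamondop> z)"
  by (simp add: sum.atMost_Suc_shift act_def
      u_sum u_scale del: sum.atMost_Suc)

lemma act_1 [simp]: "1 \<diamondop> z = z"
  by (simp add: act_def)

lemma act_const [simp]: "[:c:] \<diamondop> z = c *s z"
  by (simp add: act_def)

lemma act_X: "z \<in> V \<Longrightarrow> [:0, 1:] \<diamondop> z = u z"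
  by (simp add: act_pCons)

lemma act_lin: "z \<in> V \<Longrightarrow> [:c, 1:] \<diamondop> z = c *s z + u z"
  by (simp add: act_pCons)

lemma act_quad: "z \<in> V \<Longrightarrow> [:c, d, 1:] \<diamondop> z = c *s z + d *s u z + u (u z)"
  by (simp add: act_pCons u_add u_scale algebra_simps)

lemma act_monom: "Polynomial.monom c i \<diamondop> z = c *s (u ^^ i) z"
proof -
  have "Polynomial.monom c i \<diamondop> z = (\<Sum>j<Suc i. Polynomial.coeff (Polynomial.monom c i) j *s (u ^^ j) z)"
    by (rule act_less) (meson degree_monom_le le_imp_less_Suc)
  also have "\<dots> = (\<Sum>j<Suc i. if j = i then c *s (u ^^ j) z else 0)"
    by (intro sum.cong) (auto simp: coeff_monom)
  finally show ?thesis by simp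
qed

lemma act_add: "z \<in> V \<Longrightarrow> (f + g) \<diamondop> z = f \<diamondop> z + g \<diamondop> z"
  by (induction f g rule: poly_induct2) (auto simp: act_pCons u_add scale_left_distrib)

lemma act_smult: "smult c f \<diamondop> z = c *s (f \<diamondop> z)"
  by (cases "c = 0") (auto simp: act_def scale_sum_right)

lemma act_neg: "(- f) \<diamondop> z = - (f \<diamondop> z)"
  using act_smult[of "-1" f z] by simp

lemma act_diff: "z \<in> V \<Longrightarrow> (f - g) \<diamondop> z = f \<diamondop> z - g \<diamondop> z"
  using act_add[of z f "- g"] by (simp add: act_neg)

lemma act_mult: "z \<in> V \<Longrightarrow> (f * g) \<diamondop> z = f \<diamondop> (g \<diamondop> z)"
  by (induction f) (auto simp: act_pCons act_add act_smult mult_pCons_left)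

lemma act_commute: "z \<in> V \<Longrightarrow> f \<diamondop> (g \<diamondop> z) = g \<diamondop> (f \<diamondop> z)"
  by (metis act_mult mult.commute)

lemma act_vadd: "x \<in> V \<Longrightarrow> y \<in> V \<Longrightarrow> f \<diamondop> (x + y) = f \<diamondop> x + f \<diamondop> y"
  by (induction f) (auto simp: act_pCons u_add scale_right_distrib)

lemma act_vscale: "x \<in> V \<Longrightarrow> f \<diamondop> (c *s x) = c *s (f \<diamondop> x)"
  by (induction f) (auto simp: act_pCons u_scale scale_right_distrib mult.commute)

lemma act_vzero [simp]: "f \<diamondop> 0 = 0"
  using act_vscale[of 0 f 0] by simp

lemma act_vneg: "x \<in> V \<Longrightarrow> f \<diamondop> (- x) = - (f \<diamondop> x)"
  using act_vscale[of x f "-1"] by simp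

lemma act_vdiff: "x \<in> V \<Longrightarrow> y \<in> V \<Longrightarrow> f \<diamondop> (x - y) = f \<diamondop> x - f \<diamondop> y"
  using act_vadd[of x "- y"] act_vneg[of y] by simp

lemma act_vsum: "(\<And>i. i \<in> I \<Longrightarrow> g i \<in> V) \<Longrightarrow> f \<diamondop> (sum g I) = (\<Sum>i\<in>I. f \<diamondop> g i)"
  by (induction I rule: infinite_finite_induct) (auto simp: act_vadd)

lemma act_vsum_less: "(\<And>i. i < n \<Longrightarrow> g i \<in> V) \<Longrightarrow> f \<diamondop> (\<Sum>i<n. g i) = (\<Sum>i<n. f \<diamondop> g i)" for n :: nat
  by (rule act_vsum) simp

lemma act_u: "z \<in> V \<Longrightarrow> f \<diamondop> (u z) = u (f \<diamondop> z)"
  by (metis act_X act_commute act_in)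

lemma act_sum: "z \<in> V \<Longrightarrow> (sum f I) \<diamondop> z = (\<Sum>i\<in>I. f i \<diamondop> z)"
  by (induction I rule: infinite_finite_induct) (auto simp: act_add)

lemma act_dvd_0:
  assumes "z \<in> V" "s \<diamondop> z = 0" "s dvd f"
  shows "f \<diamondop> z = 0"
  using assms by (metis act_mult act_vzero dvd_def mult.commute)

lemma act_mod:
  assumes "z \<in> V" "s \<diamondop> z = 0"
  shows "f \<diamondop> z = (f mod s) \<diamondop> z"
proof -
  have "f \<diamondop> z = (f div s * s + f mod s) \<diamondop> z" by simp
  also have "\<dots> = (f div s * s) \<diamondop> z + (f mod s) \<diamondop> z" using assms by (intro act_add)
  finally show ?thesis using act_dvd_0[OF assms] by simp
qed

lemma act_in_stable:
  assumes "subspace W" "\<And>z. z \<in> W \<Longrightarrow> u z \<in> W" "z \<in> W"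
  shows "f \<diamondop> z \<in> W"
proof -
  have "(u ^^ i) z \<in> W" for i by (induction i) (auto simp: assms)
  then show ?thesis unfolding act_def using assms(1) by (intro subspace_sum subspace_scale)
qed

lemma subspace_act_image: "subspace W \<Longrightarrow> W \<subseteq> V \<Longrightarrow> subspace ((\<lambda>z. f \<diamondop> z) ` W)"
  unfolding subspace_def
proof (intro conjI ballI allI; elim conjE)
  assume W: "W \<subseteq> V" "0 \<in> W" "\<forall>x\<in>W. \<forall>y\<in>W. x + y \<in> W" "\<forall>c. \<forall>x\<in>W. c *s x \<in> W"
  show "0 \<in> (\<lambda>z. f \<diamondop> z) ` W" using W(2) by (metis act_vzero imageI)
  show "x + y \<in> (\<lambda>z. f \<diamondop> z) ` W" if "x \<in> (\<lambda>z. f \<diamondop> z) ` W" "y \<in> (\<lambda>z. f \<diamondop> z) ` W" for x y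
    using that W by (auto simp: subset_iff simp flip: act_vadd)
  show "c *s x \<in> (\<lambda>z. f \<diamondop> z) ` W" if "x \<in> (\<lambda>z. f \<diamondop> z) ` W" for c x
    using that W by (auto simp: subset_iff simp flip: act_vscale)
qed

end


section \<open>Symplectic pairs and selfadjointness\<close>

locale sympl = endo_space sc V u
  for sc :: "'a::field \<Rightarrow> 'v::ab_group_add \<Rightarrow> 'v" (infixr "*s" 75) and V u +
  fixes b :: "'v \<Rightarrow> 'v \<Rightarrow> 'a"
  assumes fin_V: "finitely_spanned V"
    and b_add_right: "\<lbrakk>x \<in> V; y \<in> V; z \<in> V\<rbrakk> \<Longrightarrow> b x (y + z) = b x y + b x z"
    and b_scale_right: "\<lbrakk>x \<in> V; y \<in> V\<rbrakk> \<Longrightarrow> b x (c *s y) = c * b x y"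
    and b_add_left: "\<lbrakk>x \<in> V; y \<in> V; z \<in> V\<rbrakk> \<Longrightarrow> b (x + y) z = b x z + b y z"
    and b_scale_left: "\<lbrakk>x \<in> V; y \<in> V\<rbrakk> \<Longrightarrow> b (c *s x) y = c * b x y"
    and b_self [simp]: "x \<in> V \<Longrightarrow> b x x = 0"
    and nondeg: "\<lbrakk>x \<in> V; \<And>y. y \<in> V \<Longrightarrow> b x y = 0\<rbrakk> \<Longrightarrow> x = 0"
    and b_u_self [simp]: "x \<in> V \<Longrightarrow> b x (u x) = 0"
begin

lemma b_0_right [simp]: "x \<in> V \<Longrightarrow> b x 0 = 0" and b_0_left [simp]: "x \<in> V \<Longrightarrow> b 0 x = 0"
  using b_scale_right[of x x 0] b_scale_left[of x x 0] by auto

lemma b_neg_right: "\<lbrakk>x \<in> V; y \<in> V\<rbrakk> \<Longrightarrow> b x (- y) = - b x y"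
  and b_neg_left: "\<lbrakk>x \<in> V; y \<in> V\<rbrakk> \<Longrightarrow> b (- x) y = - b x y"
  using b_scale_right[of x y "-1"] b_scale_left[of x y "-1"] by auto

lemma b_diff_right: "\<lbrakk>x \<in> V; y \<in> V; z \<in> V\<rbrakk> \<Longrightarrow> b x (y - z) = b x y - b x z"
  and b_diff_left: "\<lbrakk>x \<in> V; y \<in> V; z \<in> V\<rbrakk> \<Longrightarrow> b (x - y) z = b x z - b y z"
  using b_add_right[of x y "- z"] b_add_left[of x "- y" z] by (auto simp: b_neg_right b_neg_left)

lemma b_sum_right: "x \<in> V \<Longrightarrow> (\<And>i. i \<in> I \<Longrightarrow> g i \<in> V) \<Longrightarrow> b x (sum g I) = (\<Sum>i\<in>I. b x (g i))"
  by (induction I rule: infinite_finite_induct) (auto simp: b_add_right)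

lemma b_sum_left: "x \<in> V \<Longrightarrow> (\<And>i. i \<in> I \<Longrightarrow> g i \<in> V) \<Longrightarrow> b (sum g I) x = (\<Sum>i\<in>I. b (g i) x)"
  by (induction I rule: infinite_finite_induct) (auto simp: b_add_left)

lemma b_sum_right_less: "x \<in> V \<Longrightarrow> (\<And>i. i < n \<Longrightarrow> g i \<in> V) \<Longrightarrow> b x (\<Sum>i<n. g i) = (\<Sum>i<n. b x (g i))"
  and b_sum_left_less: "x \<in> V \<Longrightarrow> (\<And>i. i < n \<Longrightarrow> g i \<in> V) \<Longrightarrow> b (\<Sum>i<n. g i) x = (\<Sum>i<n. b (g i) x)"
  for n :: nat
  by (rule b_sum_right b_sum_left; simp)+

lemmas b_lin = b_add_right b_add_left b_scale_right b_scale_left b_neg_right b_neg_left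
  b_diff_right b_diff_left

lemma b_swap:
  assumes "x \<in> V" "y \<in> V"
  shows "b x y = - b y x"
proof -
  have "b (x + y) (x + y) = b x (x + y) + b y (x + y)" using assms by (intro b_add_left) auto
  then have "b x y + b y x = 0" using assms by (simp add: b_add_right)
  then show ?thesis by (simp add: add_eq_0_iff)
qed

text \<open>Polarisation of b(x + y, w(x + y)) = 0. The converse fails in characteristic 2, so the
  constructions below have to establish the alternating property itself.\<close>

lemma selfadjoint_if_alternating:
  assumes "\<And>x. x \<in> V \<Longrightarrow> w x \<in> V" "\<And>x y. x \<in> V \<Longrightarrow> y \<in> V \<Longrightarrow> w (x + y) = w x + w y"
    "\<And>x. x \<in> V \<Longrightarrow> b x (w x) = 0" "x \<in> V" "y \<in> V"
  shows "b (w x) y = b x (w y)"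
proof -
  have "b (x + y) (w (x + y)) = 0" using assms(3)[of "x + y"] assms(4,5) by simp
  then have "b x (w y) + b y (w x) = 0"
    using assms by (simp add: b_add_left b_add_right add.commute)
  then show ?thesis using b_swap[of "w x" y] assms by (simp add: add_eq_0_iff)
qed

lemma b_u: "\<lbrakk>x \<in> V; y \<in> V\<rbrakk> \<Longrightarrow> b (u x) y = b x (u y)"
  by (rule selfadjoint_if_alternating) (auto simp: u_add)

lemma b_act: "\<lbrakk>x \<in> V; y \<in> V\<rbrakk> \<Longrightarrow> b (f \<diamondop> x) y = b x (f \<diamondop> y)"
proof (induction f arbitrary: y)
  case (pCons c f)
  then show ?case by (simp add: act_pCons b_lin b_u act_u)
qed simp

text \<open>Moving half of the powers across the form turns b(x, u^i x) into b(y, y) or b(y, u y)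
  with y = u^k x, and both vanish. Selfadjointness alone would only show that twice the value is
  zero.\<close>

lemma b_act_self [simp]:
  assumes "x \<in> V"
  shows "b x (f \<diamondop> x) = 0"
proof -
  have pow: "b ((u ^^ j) x) ((u ^^ i) x) = b x ((u ^^ (j + i)) x)" for i j
  proof (induction j arbitrary: i)
    case (Suc j)
    then show ?case using Suc[of "Suc i"] assms by (simp add: b_u)
  qed simp
  have "b x ((u ^^ i) x) = 0" for i
  proof (cases "even i")
    case True
    then obtain k where "i = k + k" by (metis evenE mult_2)
    then show ?thesis using pow[of k k] assms by simp
  next
    case False
    then obtain k where "i = k + Suc k" by (metis oddE mult_2 add_Suc_right Suc_eq_plus1)
    then show ?thesis using pow[of k "Suc k"] assms by simp
  qed
  then show ?thesis unfolding act_def using assms by (simp add: b_sum_right b_scale_right)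
qed

abbreviation pair :: "'v set \<Rightarrow> ('a, 'v) form_space" where
  "pair W \<equiv> \<lparr>vectors = W, scale = (*s), form = b, endo = u\<rparr>"

definition perp :: "'v set \<Rightarrow> 'v set" where
  "perp W = {r \<in> V. \<forall>w\<in>W. b r w = 0}"

lemma subspace_perp: "W \<subseteq> V \<Longrightarrow> subspace (perp W)"
  unfolding subspace_def perp_def by (auto simp: b_lin subset_iff)

lemma perp_stable: "W \<subseteq> V \<Longrightarrow> (\<And>w. w \<in> W \<Longrightarrow> u w \<in> W) \<Longrightarrow> r \<in> perp W \<Longrightarrow> u r \<in> perp W"
  unfolding perp_def by (auto simp: b_u subset_iff)

lemma sympl_restrict:
  assumes "subspace W" "W \<subseteq> V" "\<And>w. w \<in> W \<Longrightarrow> u w \<in> W"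
    "\<And>x. x \<in> W \<Longrightarrow> (\<And>y. y \<in> W \<Longrightarrow> b x y = 0) \<Longrightarrow> x = 0"
  shows "sympl (*s) W u b"
  by (unfold_locales)
    (use assms finitely_spanned_subset[OF fin_V] in \<open>auto simp: subset_iff u_add u_scale b_lin\<close>)

end

text \<open>The passage from the records of the statement to the locale in which the algebra is
  done.\<close>

lemma symplectic_pair_iff:
  "symplectic_pair P \<longleftrightarrow> sympl (scale P) (vectors P) (endo P) (form P)"
proof
  assume P: "symplectic_pair P"
  interpret vector_space "scale P" using P by (simp add: symplectic_pair_def fd_space_def)
  show "sympl (scale P) (vectors P) (endo P) (form P)"
    by unfold_locales
      (use P in \<open>auto simp: symplectic_pair_def fd_space_def symplectic_form_def alternating_endo_def
         linear_map_def ground_def scalar_space.finitely_spanned_def scalar_space_def\<close>)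
next
  assume "sympl (scale P) (vectors P) (endo P) (form P)"
  then interpret sympl "scale P" "vectors P" "endo P" "form P" .
  have "\<exists>B. finite B \<and> span B = vectors P"
    using finitely_spanned_basis[OF fin_V subspace_V] by metis
  then show "symplectic_pair P"
    unfolding symplectic_pair_def fd_space_def symplectic_form_def alternating_endo_def
      linear_map_def ground_def
    using subspace_V vector_space_axioms nondeg
    by (auto simp: b_lin u_add u_scale)
qed

section \<open>Frames\<close>

text \<open>A linear form on F[t]/(s). For monic \<open>s\<close>, multiplying in this algebra and
  then applying the form gives its standard non-degenerate symmetric bilinear form.\<close>

definition top_coeff :: "'a::field poly \<Rightarrow> 'a poly \<Rightarrow> 'a" where
  "top_coeff s h = Polynomial.coeff (h mod s) (Polynomial.degree s - 1)"

text \<open>Gram matrix of hyperbolic planes on the index pairs 2 q and 2 q + 1. The signs are those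
  of (x, \<phi>), (y, \<psi>) \<mapsto> \<phi> y - \<psi> x in the symplectic extension, where even
  indices will stand for vectors and odd ones for linear forms.\<close>

definition std_gram :: "nat \<Rightarrow> nat \<Rightarrow> 'a::field" where
  "std_gram i l = (if even i \<and> l = Suc i then -1 else if odd i \<and> i = Suc l then 1 else 0)"

definition partner :: "nat \<Rightarrow> nat" where
  "partner i = (if even i then Suc i else i - 1)"

lemma partner_partner [simp]: "partner (partner i) = i"
  by (auto simp: partner_def)

lemma partner_less [simp]: "partner i < 2 * k \<longleftrightarrow> i < 2 * k"
  by (auto simp: partner_def elim!: evenE oddE)

lemma std_gram_eq_0: "l \<noteq> partner i \<Longrightarrow> std_gram i l = 0"
  by (auto simp: std_gram_def partner_def)

lemma std_gram_partner: "std_gram i (partner i) = (if even i then -1 else 1)"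
  by (auto simp: std_gram_def partner_def)

lemma std_gram_swap: "std_gram i l = - std_gram l i"
  by (auto simp: std_gram_def)

lemma std_gram_partner_nz [simp]: "std_gram i (partner i) \<noteq> 0"
  by (simp add: std_gram_partner)

lemma std_gram_partner_nz' [simp]: "std_gram (partner i) i \<noteq> 0"
  using std_gram_swap[of i "partner i"] std_gram_partner_nz[of i] by (metis neg_equal_0_iff_equal)

lemma top_coeff_add: "top_coeff s (f + g) = top_coeff s f + top_coeff s g"
  by (simp add: top_coeff_def poly_mod_add_left)

lemma top_coeff_smult: "top_coeff s (smult c f) = c * top_coeff s f"
  by (simp add: top_coeff_def mod_smult_left)

lemma top_coeff_dvd: "s dvd f \<Longrightarrow> top_coeff s f = 0"
  by (simp add: top_coeff_def)

lemma top_coeff_small: "Polynomial.degree f < Polynomial.degree s - 1 \<Longrightarrow> top_coeff s f = 0"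
  by (cases "Polynomial.degree f < Polynomial.degree s") (auto simp: top_coeff_def mod_poly_less coeff_eq_0)

text \<open>A nonzero remainder of degree e is multiplied by t^(deg s - 1 - e): its leading
  coefficient moves to the place that \<open>top_coeff\<close> reads, and no further reduction
  modulo \<open>s\<close> takes place.\<close>

lemma top_coeff_nondegenerate:
  assumes "\<And>g. top_coeff s (h * g) = 0" "Polynomial.degree s > 0"
  shows "s dvd h"
proof (rule ccontr)
  assume "\<not> s dvd h"
  define r where "r = h mod s"
  have "r \<noteq> 0" using \<open>\<not> s dvd h\<close> by (simp add: r_def dvd_eq_mod_eq_0)
  have "Polynomial.degree r < Polynomial.degree s"
    unfolding r_def using assms(2) by (metis degree_0 degree_mod_less' less_not_refl \<open>r \<noteq> 0\<close> r_def)
  define g :: "'a poly" where "g = Polynomial.monom 1 (Polynomial.degree s - 1 - Polynomial.degree r)"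
  have g: "g \<noteq> 0" by (simp add: g_def)
  have deg: "Polynomial.degree (r * g) = Polynomial.degree s - 1"
    using \<open>r \<noteq> 0\<close> g \<open>Polynomial.degree r < _\<close> by (simp add: degree_mult_eq g_def degree_monom_eq)
  have "(h * g) mod s = (r * g) mod s" by (simp add: r_def mod_mult_left_eq)
  also have "\<dots> = r * g" using deg assms(2) by (intro mod_poly_less) auto
  finally have "top_coeff s (h * g) = Polynomial.lead_coeff (r * g)" by (simp add: top_coeff_def deg)
  moreover have "Polynomial.lead_coeff (r * g) \<noteq> 0" using \<open>r \<noteq> 0\<close> g by simp
  ultimately show False using assms(1) by simp
qed

text \<open>A triangular system. Adding e t^(n - 1 - k) to \<open>g\<close> changes the value at
  \<open>k\<close> by e and leaves the values at j < k alone, since there the added product has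
  degree below n - 1.\<close>

lemma top_coeff_surj:
  assumes "Polynomial.lead_coeff s = 1"
  shows "\<exists>g. \<forall>j<Polynomial.degree s. top_coeff s (g * Polynomial.monom 1 j) = c j"
proof -
  let ?n = "Polynomial.degree s"
  have "k \<le> ?n \<Longrightarrow> \<exists>g. \<forall>j<k. top_coeff s (g * Polynomial.monom 1 j) = c j" for k
  proof (induction k)
    case (Suc k)
    then obtain g where g: "\<forall>j<k. top_coeff s (g * Polynomial.monom 1 j) = c j" by auto
    define e where "e = c k - top_coeff s (g * Polynomial.monom 1 k)"
    define g' where "g' = g + smult e (Polynomial.monom 1 (?n - 1 - k))"
    have eq: "top_coeff s (g' * Polynomial.monom 1 j) =
        top_coeff s (g * Polynomial.monom 1 j) + e * top_coeff s (Polynomial.monom 1 (?n - 1 - k + j))" for j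
      by (simp add: g'_def distrib_right top_coeff_add top_coeff_smult mult_monom)
    have "top_coeff s (g' * Polynomial.monom 1 j) = c j" if "j < Suc k" for j
    proof (cases "j < k")
      case True
      then have "top_coeff s (Polynomial.monom 1 (?n - 1 - k + j)) = 0"
        using Suc.prems by (intro top_coeff_small) (simp add: degree_monom_eq)
      then show ?thesis using True g by (simp add: eq)
    next
      case False
      then have "j = k" using that by simp
      have "Polynomial.monom (1::'a) (?n - 1) mod s = Polynomial.monom 1 (?n - 1)"
        using Suc.prems by (intro mod_poly_less) (simp add: degree_monom_eq)
      then have "top_coeff s (Polynomial.monom 1 (?n - 1 - k + j)) = 1"
        using Suc.prems \<open>j = k\<close> by (simp add: top_coeff_def)
      then show ?thesis using \<open>j = k\<close> by (simp add: eq e_def)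
    qed
    then show ?case by blast
  qed simp
  then show ?thesis by blast
qed


section \<open>Submodules over F[t] generated by finitely many vectors\<close>

context endo_space
begin

definition gen :: "nat \<Rightarrow> (nat \<Rightarrow> 'v) \<Rightarrow> 'v set" where
  "gen r z = {\<Sum>i<r. h i \<diamondop> z i |h. True}"

lemma genI [intro]: "(\<Sum>i<r. h i \<diamondop> z i) \<in> gen r z"
  unfolding gen_def by blast

lemma genE [elim]:
  assumes "x \<in> gen r z"
  obtains h where "x = (\<Sum>i<r. h i \<diamondop> z i)"
  using assms unfolding gen_def by blast

lemma gen_in: "(\<And>i. i < r \<Longrightarrow> z i \<in> V) \<Longrightarrow> gen r z \<subseteq> V"
  unfolding gen_def by auto

lemma subspace_gen:
  assumes "\<And>i. i < r \<Longrightarrow> z i \<in> V"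
  shows "subspace (gen r z)"
proof (rule subspaceI)
  have "0 = (\<Sum>i<r. 0 \<diamondop> z i)" by simp
  then show "0 \<in> gen r z" using genI[of "\<lambda>_. 0"] by simp
  show "x + y \<in> gen r z" if xy: "x \<in> gen r z" "y \<in> gen r z" for x y
  proof -
    obtain h where "x = (\<Sum>i<r. h i \<diamondop> z i)" using xy(1) by (auto simp: gen_def)
    moreover obtain h' where "y = (\<Sum>i<r. h' i \<diamondop> z i)" using xy(2) by (auto simp: gen_def)
    ultimately have "x + y = (\<Sum>i<r. (h i + h' i) \<diamondop> z i)" using assms by (simp add: act_add sum.distrib)
    then show ?thesis using genI by metis
  qed
  show "c *s x \<in> gen r z" if x: "x \<in> gen r z" for c x
  proof -
    obtain h where "x = (\<Sum>i<r. h i \<diamondop> z i)" using x by (auto simp: gen_def)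
    then have "c *s x = (\<Sum>i<r. (smult c (h i)) \<diamondop> z i)" by (simp add: act_smult scale_sum_right)
    then show ?thesis using genI by metis
  qed
qed

lemma act_gen:
  assumes "\<And>i. i < r \<Longrightarrow> z i \<in> V" "x \<in> gen r z"
  shows "f \<diamondop> x \<in> gen r z"
proof -
  obtain h where "x = (\<Sum>i<r. h i \<diamondop> z i)" using assms(2) by (auto simp: gen_def)
  then have "f \<diamondop> x = (\<Sum>i<r. (f * h i) \<diamondop> z i)" using assms(1) by (simp add: act_vsum_less act_mult)
  then show ?thesis using genI by metis
qed

lemma u_gen: "(\<And>i. i < r \<Longrightarrow> z i \<in> V) \<Longrightarrow> x \<in> gen r z \<Longrightarrow> u x \<in> gen r z"
  using act_gen[of r z x "[:0, 1:]"] gen_in[of r z] by (auto simp: act_X subset_iff)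

lemma act_base_gen:
  assumes "i < r" shows "f \<diamondop> z i \<in> gen r z"
proof -
  have "f \<diamondop> z i = (\<Sum>j<r. if j = i then f \<diamondop> z j else 0)" using assms by simp
  also have "\<dots> = (\<Sum>j<r. (if j = i then f else 0) \<diamondop> z j)" by (intro sum.cong) auto
  finally show ?thesis using genI by metis
qed

lemma gen_subset_subspace:
  assumes "subspace W" "\<And>x. x \<in> W \<Longrightarrow> u x \<in> W" "\<And>i. i < r \<Longrightarrow> z i \<in> W"
  shows "gen r z \<subseteq> W"
  using assms by (auto elim!: genE intro!: subspace_sum[OF assms(1)] act_in_stable)

text \<open>The module is free of rank \<open>r\<close> over F[t]/(m), so the vectors
  \<open>(u ^^ j) (z i)\<close> with j < deg m form a basis.\<close>

lemma dim_gen: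
  assumes z: "\<And>i. i < r \<Longrightarrow> z i \<in> V" "\<And>i. i < r \<Longrightarrow> m \<diamondop> z i = 0" and "m \<noteq> 0"
    and free: "\<And>h. (\<Sum>i<r. h i \<diamondop> z i) = 0 \<Longrightarrow> \<forall>i<r. m dvd h i"
  shows "dim (gen r z) = r * Polynomial.degree m"
proof -
  let ?n = "Polynomial.degree m"
  define E where "E = (\<lambda>(i, j). (u ^^ j) (z i))"
  let ?I = "{..<r} \<times> {..<?n}"
  define P where "P = (\<lambda>(c :: nat \<times> nat \<Rightarrow> 'a) i. \<Sum>j<?n. Polynomial.monom (c (i, j)) j :: 'a poly)"
  have eq: "(\<Sum>k\<in>?I. c k *s E k) = (\<Sum>i<r. P c i \<diamondop> z i)" for c
  proof -
    have "(\<Sum>k\<in>?I. c k *s E k) = (\<Sum>i<r. \<Sum>j<?n. c (i, j) *s (u ^^ j) (z i))"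
      by (simp add: E_def sum.cartesian_product split_def)
    also have "\<dots> = (\<Sum>i<r. P c i \<diamondop> z i)"
      by (intro sum.cong) (auto simp: P_def act_sum act_monom z)
    finally show ?thesis .
  qed
  have coeff_P: "Polynomial.coeff (P c i) j = (if j < ?n then c (i, j) else 0)" for c i j
    by (simp add: P_def coeff_sum coeff_monom)
  have ind: "\<forall>k\<in>?I. c k = 0" if "(\<Sum>k\<in>?I. c k *s E k) = 0" for c
  proof
    fix k assume k: "k \<in> ?I"
    obtain i j where ij: "k = (i, j)" "i < r" "j < ?n" using k by auto
    have "m dvd P c i" using that eq free ij by auto
    moreover have "Polynomial.degree (P c i) < ?n"
      using ij(3) by (intro degree_lessI) (auto simp: coeff_P)
    ultimately have "P c i = 0" using dvd_imp_degree_le by (metis not_less)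
    then show "c k = 0" using coeff_P[of c i j] ij by simp
  qed
  have "gen r z = {\<Sum>k\<in>?I. c k *s E k |c. True}"
  proof
    show "{\<Sum>k\<in>?I. c k *s E k |c. True} \<subseteq> gen r z" unfolding eq by auto
    show "gen r z \<subseteq> {\<Sum>k\<in>?I. c k *s E k |c. True}"
    proof
      fix x assume "x \<in> gen r z"
      then obtain h where h: "x = (\<Sum>i<r. h i \<diamondop> z i)" by (auto simp: gen_def)
      define c where "c = (\<lambda>(i, j). Polynomial.coeff (h i mod m) j)"
      have "P c i = h i mod m" for i
        using degree_mod_less[OF \<open>m \<noteq> 0\<close>, of "h i"]
        by (intro poly_eqI) (auto simp: coeff_P c_def coeff_eq_0 not_less)
      then have "x = (\<Sum>i<r. P c i \<diamondop> z i)" unfolding h by (intro sum.cong) (auto intro: act_mod z)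
      then show "x \<in> {\<Sum>k\<in>?I. c k *s E k |c. True}" unfolding eq by (intro CollectI exI[of _ c]) simp
    qed
  qed
  then show ?thesis using dim_family(1)[of ?I E] ind by simp
qed

end


section \<open>Frames and the orthogonal splitting they induce\<close>

context sympl
begin

text \<open>The vectors of a frame generate an isometric copy of the symplectic extension of \<open>k\<close> blocks \<open>C(s)\<close>:
  the \<open>z\<^sub>i\<close> with even index generate a Lagrangian subspace, paired with the one generated by their
  partners through \<open>(f, g) \<mapsto> top_coeff s (f g)\<close>.\<close>

definition frame :: "'a poly \<Rightarrow> nat \<Rightarrow> (nat \<Rightarrow> 'v) \<Rightarrow> bool" where
  "frame s k z \<longleftrightarrow> Polynomial.lead_coeff s = 1 \<and> Polynomial.degree s > 0 \<and>
     (\<forall>i<2*k. z i \<in> V \<and> s \<diamondop> z i = 0) \<and>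
     (\<forall>i<2*k. \<forall>l<2*k. \<forall>h. b (z i) (h \<diamondop> z l) = std_gram i l * top_coeff s h)"

text \<open>As \<open>s\<close> kills the vectors, \<open>h\<close> may be replaced by its remainder
  modulo \<open>s\<close>. So only the powers t^j with j < deg s matter, and
  \<open>top_coeff\<close> is 1 on the last of them and 0 on the others.\<close>

lemma frameI:
  assumes "Polynomial.lead_coeff s = 1" "Polynomial.degree s > 0"
    and z: "\<And>i. i < 2*k \<Longrightarrow> z i \<in> V" "\<And>i. i < 2*k \<Longrightarrow> s \<diamondop> z i = 0"
    and gram: "\<And>i l j. \<lbrakk>i < 2*k; l < 2*k; j < Polynomial.degree s\<rbrakk> \<Longrightarrow>
      b (z i) ((u ^^ j) (z l)) = std_gram i l * (if j = Polynomial.degree s - 1 then 1 else 0)"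
  shows "frame s k z"
  unfolding frame_def
proof (intro conjI allI impI assms)
  fix i l h assume il: "i < 2*k" "l < 2*k"
  let ?n = "Polynomial.degree s" and ?h = "h mod s"
  have "s \<noteq> 0" using assms(1) by auto
  have "Polynomial.degree ?h < ?n"
    using degree_mod_less[OF \<open>s \<noteq> 0\<close>, of h] assms(2) by auto
  then have "h \<diamondop> z l = (\<Sum>j<?n. Polynomial.coeff ?h j *s (u ^^ j) (z l))"
    using act_mod[of "z l" s h] z il act_less by simp
  then have "b (z i) (h \<diamondop> z l) = (\<Sum>j<?n. Polynomial.coeff ?h j * b (z i) ((u ^^ j) (z l)))"
    using z il by (simp add: b_sum_right_less b_scale_right)
  also have "\<dots> = (\<Sum>j<?n. if j = ?n - 1 then Polynomial.coeff ?h j * std_gram i l else 0)"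
    using gram il by (intro sum.cong) auto
  also have "\<dots> = std_gram i l * top_coeff s h"
    using assms(2) by (simp add: top_coeff_def mult.commute)
  finally show "b (z i) (h \<diamondop> z l) = std_gram i l * top_coeff s h" .
qed

context
  fixes s k z
  assumes fr: "frame s k z"
begin

lemma frame_s: "Polynomial.lead_coeff s = 1" "Polynomial.degree s > 0" "s \<noteq> 0"
  using fr by (auto simp: frame_def)

lemma frame_in: "i < 2*k \<Longrightarrow> z i \<in> V" and frame_ann: "i < 2*k \<Longrightarrow> s \<diamondop> z i = 0"
  and frame_gram: "\<lbrakk>i < 2*k; l < 2*k\<rbrakk> \<Longrightarrow> b (z i) (h \<diamondop> z l) = std_gram i l * top_coeff s h"
  using fr by (auto simp: frame_def)

lemma frame_gen_ann: "x \<in> gen (2*k) z \<Longrightarrow> s dvd f \<Longrightarrow> f \<diamondop> x = 0"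
proof -
  assume "x \<in> gen (2*k) z" "s dvd f"
  then obtain h where "x = (\<Sum>i<2*k. h i \<diamondop> z i)" by (auto simp: gen_def)
  moreover have "f \<diamondop> h i \<diamondop> z i = 0" if "i < 2*k" for i
    using that act_commute[of "z i" f "h i"] act_dvd_0[OF _ _ \<open>s dvd f\<close>, of "z i"] frame_in frame_ann
    by simp
  ultimately show ?thesis by (simp add: act_vsum_less frame_in)
qed

text \<open>\<open>std_gram\<close> couples an index only with its partner, so pairing with the
  vector at \<open>l\<close> isolates one coefficient polynomial. This is the tool for independence,
  projection and isometries.\<close>

lemma frame_pair:
  assumes "l < 2*k"
  shows "b (\<Sum>i<2*k. h i \<diamondop> z i) (g \<diamondop> z l) = std_gram (partner l) l * top_coeff s (h (partner l) * g)"
proof -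
  have "b (\<Sum>i<2*k. h i \<diamondop> z i) (g \<diamondop> z l) = (\<Sum>i<2*k. b (h i \<diamondop> z i) (g \<diamondop> z l))"
    using assms by (simp add: b_sum_left_less frame_in)
  also have "\<dots> = (\<Sum>i<2*k. std_gram i l * top_coeff s (h i * g))"
    using assms by (intro sum.cong) (auto simp: b_act frame_in frame_gram simp flip: act_mult)
  also have "\<dots> = (\<Sum>i\<in>{partner l}. std_gram i l * top_coeff s (h i * g))"
    using assms by (intro sum.mono_neutral_right) (auto intro!: std_gram_eq_0)
  finally show ?thesis by simp
qed

lemma frame_independent:
  assumes "(\<Sum>i<2*k. h i \<diamondop> z i) = 0" "i < 2*k"
  shows "s dvd h i"
proof (rule top_coeff_nondegenerate[OF _ frame_s(2)])
  fix g
  have "0 = b (\<Sum>i<2*k. h i \<diamondop> z i) (g \<diamondop> z (partner i))" using assms by (simp add: frame_in)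
  then show "top_coeff s (h i * g) = 0" using frame_pair[of "partner i" h g] assms by simp
qed

lemma frame_gen_subset: "gen (2*k) z \<subseteq> V" and subspace_frame_gen: "subspace (gen (2*k) z)"
  and u_frame_gen: "x \<in> gen (2*k) z \<Longrightarrow> u x \<in> gen (2*k) z"
  using gen_in subspace_gen u_gen frame_in by auto

text \<open>Orthogonal projection by means of polynomials: \<open>top_coeff_surj\<close> supplies
  the coefficients \<open>g i\<close> for which w and x have equal pairings with all
  \<open>(u ^^ j) (z l)\<close>, j < deg s. Higher powers reduce modulo \<open>s\<close>.\<close>

lemma frame_decomposition:
  assumes "x \<in> V"
  obtains w r where "w \<in> gen (2*k) z" "r \<in> perp (gen (2*k) z)" "x = w + r"
proof -
  have "\<exists>g. \<forall>j<Polynomial.degree s. std_gram i (partner i) * top_coeff s (g * Polynomial.monom 1 j) =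
      b x (Polynomial.monom 1 j \<diamondop> z (partner i))" for i
  proof -
    obtain g where "\<forall>j<Polynomial.degree s. top_coeff s (g * Polynomial.monom 1 j) =
        b x (Polynomial.monom 1 j \<diamondop> z (partner i)) / std_gram i (partner i)"
      using top_coeff_surj[OF frame_s(1),
          of "\<lambda>j. b x (Polynomial.monom 1 j \<diamondop> z (partner i)) / std_gram i (partner i)"] by blast
    then show ?thesis by (intro exI[of _ g]) simp
  qed
  then obtain g where g: "\<And>i j. j < Polynomial.degree s \<Longrightarrow>
      std_gram i (partner i) * top_coeff s (g i * Polynomial.monom 1 j) =
      b x (Polynomial.monom 1 j \<diamondop> z (partner i))" by metis
  define w where "w = (\<Sum>i<2*k. g i \<diamondop> z i)"
  have w: "w \<in> gen (2*k) z" unfolding w_def by (rule genI)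
  have wV: "w \<in> V" using w frame_gen_subset by blast
  have small: "b (x - w) (Polynomial.monom 1 j \<diamondop> z l) = 0" if "l < 2*k" "j < Polynomial.degree s" for l j
  proof -
    have "b w (Polynomial.monom 1 j \<diamondop> z l) = b x (Polynomial.monom 1 j \<diamondop> z l)"
      unfolding w_def using frame_pair[OF that(1)] g[OF that(2), of "partner l"] by simp
    then show ?thesis using assms wV that by (simp add: b_diff_left frame_in)
  qed
  have zero: "b (x - w) (h \<diamondop> z l) = 0" if l: "l < 2*k" for l h
  proof -
    have "Polynomial.degree (h mod s) < Polynomial.degree s"
      using degree_mod_less[OF frame_s(3), of h] frame_s(2) by auto
    then have "h \<diamondop> z l = (\<Sum>j<Polynomial.degree s. Polynomial.coeff (h mod s) j *s (u ^^ j) (z l))"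
      using act_mod[of "z l" s h] frame_in frame_ann l act_less by simp
    also have "\<dots> = (\<Sum>j<Polynomial.degree s. Polynomial.coeff (h mod s) j *s (Polynomial.monom 1 j \<diamondop> z l))"
      by (simp add: act_monom)
    finally show ?thesis using assms wV l by (simp add: b_sum_right_less b_scale_right small frame_in)
  qed
  have "x - w \<in> perp (gen (2*k) z)"
    unfolding perp_def using assms wV zero by (auto elim!: genE simp: b_sum_right_less frame_in)
  then show ?thesis using that w by simp
qed

text \<open>Inherited from \<open>V\<close>: a vector of the generated subspace orthogonal to that
  subspace is also orthogonal to its complement, and the two together make up
  \<open>V\<close>.\<close>

lemma frame_gen_nondegenerate:
  assumes "x \<in> gen (2*k) z" "\<And>y. y \<in> gen (2*k) z \<Longrightarrow> b x y = 0"
  shows "x = 0"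
proof (rule nondeg)
  show x: "x \<in> V" using assms(1) frame_gen_subset by blast
  fix y assume "y \<in> V"
  then obtain w r where wr: "w \<in> gen (2*k) z" "r \<in> perp (gen (2*k) z)" "y = w + r"
    by (rule frame_decomposition)
  moreover have "w \<in> V" "r \<in> V" using wr frame_gen_subset by (auto simp: perp_def)
  moreover have "b x r = 0" using wr assms(1) x \<open>r \<in> V\<close> b_swap[of x r] by (simp add: perp_def)
  ultimately show "b x y = 0" using assms x by (simp add: b_add_right)
qed

lemma frame_gen_perp_trivial: "gen (2*k) z \<inter> perp (gen (2*k) z) = {0}"
proof -
  have "x = 0" if "x \<in> gen (2*k) z" "x \<in> perp (gen (2*k) z)" for x
    using frame_gen_nondegenerate[OF that(1)] that(2) by (simp add: perp_def)
  then show ?thesis using subspace_0[OF subspace_frame_gen] frame_gen_subset by (auto simp: perp_def subset_iff)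
qed

lemma frame_perp_nondegenerate:
  assumes "x \<in> perp (gen (2*k) z)" "\<And>y. y \<in> perp (gen (2*k) z) \<Longrightarrow> b x y = 0"
  shows "x = 0"
proof (rule nondeg)
  show x: "x \<in> V" using assms(1) by (simp add: perp_def)
  fix y assume "y \<in> V"
  then obtain w r where wr: "w \<in> gen (2*k) z" "r \<in> perp (gen (2*k) z)" "y = w + r"
    by (rule frame_decomposition)
  moreover have "w \<in> V" "r \<in> V" using wr frame_gen_subset by (auto simp: perp_def)
  ultimately show "b x y = 0" using assms x by (simp add: b_add_right perp_def)
qed

lemma sympl_frame_gen: "sympl (*s) (gen (2*k) z) u b"
  by (rule sympl_restrict[OF subspace_frame_gen frame_gen_subset u_frame_gen frame_gen_nondegenerate])

lemma sympl_frame_perp: "sympl (*s) (perp (gen (2*k) z)) u b"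
  using frame_gen_subset u_frame_gen frame_perp_nondegenerate
  by (intro sympl_restrict subspace_perp perp_stable) (auto simp: perp_def)

text \<open>The images of the \<open>z i\<close> under f(u) are killed by s / f and free over
  F[t]/(s / f), because \<open>s\<close> divides h f exactly if s / f divides h.\<close>

lemma dim_image_frame_gen:
  assumes "f dvd s"
  shows "dim ((\<lambda>x. f \<diamondop> x) ` gen (2*k) z) = 2*k * (Polynomial.degree s - Polynomial.degree f)"
proof -
  obtain m where m: "s = f * m" using assms by blast
  then have nz: "f \<noteq> 0" "m \<noteq> 0" using frame_s(3) by auto
  have "(\<lambda>x. f \<diamondop> x) ` gen (2*k) z = gen (2*k) (\<lambda>i. f \<diamondop> z i)"
  proof -
    have *: "f \<diamondop> (\<Sum>i<2*k. h i \<diamondop> z i) = (\<Sum>i<2*k. h i \<diamondop> f \<diamondop> z i)" for h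
      using act_commute frame_in by (simp add: act_vsum_less)
    show ?thesis unfolding gen_def by (auto simp: image_def *)
  qed
  moreover have "dim (gen (2*k) (\<lambda>i. f \<diamondop> z i)) = 2*k * Polynomial.degree m"
  proof (rule dim_gen[OF _ _ nz(2)])
    show "f \<diamondop> z i \<in> V" if "i < 2*k" for i using that frame_in by simp
    show "m \<diamondop> f \<diamondop> z i = 0" if "i < 2*k" for i
      using that frame_in frame_ann[of i] m by (simp add: mult.commute flip: act_mult)
    show "\<forall>i<2*k. m dvd h i" if "(\<Sum>i<2*k. h i \<diamondop> f \<diamondop> z i) = 0" for h
    proof (intro allI impI)
      fix i assume "i < 2*k"
      have "(\<Sum>i<2*k. (h i * f) \<diamondop> z i) = 0" using that frame_in by (simp add: act_mult)
      then have "s dvd h i * f" using frame_independent[of "\<lambda>i. h i * f" i] \<open>i < 2*k\<close> by simp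
      then show "m dvd h i" using m nz by (simp add: mult.commute)
    qed
  qed
  moreover have "Polynomial.degree m = Polynomial.degree s - Polynomial.degree f"
    using m nz by (simp add: degree_mult_eq)
  ultimately show ?thesis by simp
qed

text \<open>Both summands are stable under f(u), so the image is the direct sum of the two images.
  These ranks are the invariants compared in all later parity and counting arguments.\<close>

lemma dim_image_split:
  "dim ((\<lambda>x. f \<diamondop> x) ` V) =
   dim ((\<lambda>x. f \<diamondop> x) ` gen (2*k) z) + dim ((\<lambda>x. f \<diamondop> x) ` perp (gen (2*k) z))"
proof -
  let ?W = "gen (2*k) z" and ?R = "perp (gen (2*k) z)"
  have R: "subspace ?R" "?R \<subseteq> V" using subspace_perp frame_gen_subset by (auto simp: perp_def)
  have sub: "subspace ((\<lambda>x. f \<diamondop> x) ` ?W)" "subspace ((\<lambda>x. f \<diamondop> x) ` ?R)"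
    using subspace_act_image R subspace_frame_gen frame_gen_subset by auto
  have inW: "(\<lambda>x. f \<diamondop> x) ` ?W \<subseteq> ?W" using act_gen frame_in by auto
  have inR: "(\<lambda>x. f \<diamondop> x) ` ?R \<subseteq> ?R"
    using act_in_stable[OF R(1)] perp_stable[OF frame_gen_subset u_frame_gen] by blast
  have "(\<lambda>x. f \<diamondop> x) ` V = {x + y |x y. x \<in> (\<lambda>x. f \<diamondop> x) ` ?W \<and> y \<in> (\<lambda>x. f \<diamondop> x) ` ?R}" (is "_ = ?S")
  proof
    show "(\<lambda>x. f \<diamondop> x) ` V \<subseteq> ?S"
    proof
      fix y assume "y \<in> (\<lambda>x. f \<diamondop> x) ` V"
      then obtain x where x: "x \<in> V" "y = f \<diamondop> x" by blast
      obtain w r where wr: "w \<in> ?W" "r \<in> ?R" "x = w + r" using frame_decomposition[OF x(1)] .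
      then have "y = f \<diamondop> w + f \<diamondop> r" using x frame_gen_subset R by (auto intro: act_vadd)
      then show "y \<in> ?S" using wr by blast
    qed
    show "?S \<subseteq> (\<lambda>x. f \<diamondop> x) ` V"
      using frame_gen_subset R by (auto simp: subset_iff simp flip: act_vadd)
  qed
  moreover have "(\<lambda>x. f \<diamondop> x) ` ?W \<inter> (\<lambda>x. f \<diamondop> x) ` ?R = {0}"
    using inW inR frame_gen_perp_trivial subspace_0[OF sub(1)] subspace_0[OF sub(2)] by blast
  moreover have "finitely_spanned ((\<lambda>x. f \<diamondop> x) ` ?W)" "finitely_spanned ((\<lambda>x. f \<diamondop> x) ` ?R)"
    using inW inR frame_gen_subset R finitely_spanned_subset[OF fin_V] by (meson subset_trans)+
  ultimately show ?thesis using dim_direct_sum sub by simp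
qed

lemma dim_split: "dim V = 2*k * Polynomial.degree s + dim (perp (gen (2*k) z))"
  using dim_image_split[of 1] dim_image_frame_gen[of 1] by simp

end

lemma frame_sub_iff:
  assumes "sympl (*s) W u b" "W \<subseteq> V"
  shows "sympl.frame (*s) W u b s k z \<longleftrightarrow> frame s k z \<and> (\<forall>i<2*k. z i \<in> W)"
  unfolding sympl.frame_def[OF assms(1)] frame_def using assms(2) by auto

lemma frame_gen_full_iff:
  assumes "frame s k z"
  shows "gen (2*k) z = V \<longleftrightarrow> (\<forall>r\<in>V. (\<forall>i<2*k. \<forall>h. b r (h \<diamondop> z i) = 0) \<longrightarrow> r = 0)"
proof
  assume full: "gen (2*k) z = V"
  show "\<forall>r\<in>V. (\<forall>i<2*k. \<forall>h. b r (h \<diamondop> z i) = 0) \<longrightarrow> r = 0"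
  proof (intro ballI impI)
    fix r assume r: "r \<in> V" "\<forall>i<2*k. \<forall>h. b r (h \<diamondop> z i) = 0"
    have "b r y = 0" if "y \<in> gen (2*k) z" for y
      using that r by (auto elim!: genE simp: b_sum_right_less frame_in[OF assms])
    then show "r = 0" using full nondeg r(1) by blast
  qed
next
  assume *: "\<forall>r\<in>V. (\<forall>i<2*k. \<forall>h. b r (h \<diamondop> z i) = 0) \<longrightarrow> r = 0"
  have "r = 0" if "r \<in> perp (gen (2*k) z)" for r
    using * that act_base_gen by (auto simp: perp_def)
  then show "gen (2*k) z = V"
    using frame_decomposition[OF assms] frame_gen_subset[OF assms] by (metis add.right_neutral subsetI subset_antisym)
qed

end

section \<open>Existence of frames\<close>

text \<open>A nonzero combination of least degree divides every other combination, since the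
  remainder would be a combination of smaller degree.\<close>

lemma poly_bezout:
  fixes f g :: "'a::field poly"
  assumes "f \<noteq> 0"
  obtains a c d where "d = a * f + c * g" "d dvd f" "d dvd g" "d \<noteq> 0"
proof -
  let ?Q = "\<lambda>d. d \<noteq> 0 \<and> (\<exists>a c. d = a * f + c * g)"
  have "?Q f" using assms by (metis add.right_neutral mult_1 mult_zero_left)
  then obtain d where d: "?Q d" and min: "\<And>d'. ?Q d' \<Longrightarrow> Polynomial.degree d \<le> Polynomial.degree d'"
    using ex_has_least_nat[of ?Q f Polynomial.degree] by blast
  obtain a c where ac: "d = a * f + c * g" using d by blast
  have dvd: "d dvd h" if h: "h = a' * f + c' * g" for h a' c'
  proof (rule ccontr)
    assume "\<not> d dvd h"
    then have nz: "h mod d \<noteq> 0" by (simp add: dvd_eq_mod_eq_0)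
    have "h mod d = h - h div d * d" by (simp add: minus_div_mult_eq_mod)
    also have "\<dots> = (a' - h div d * a) * f + (c' - h div d * c) * g"
      unfolding h by (subst (2) ac) (simp add: algebra_simps)
    finally have "?Q (h mod d)" using nz by blast
    from min[OF this] show False using degree_mod_less'[of d h] d nz by simp
  qed
  have "d dvd f" "d dvd g" using dvd[of f 1 0] dvd[of g 0 1] by simp_all
  then show ?thesis using that ac d by blast
qed

text \<open>The cofactor of \<open>g\<close> is divisible by \<pi>, for otherwise primality would
  put the whole power of \<pi> into \<open>g\<close>. Cancelling one factor \<pi> gives the
  claim.\<close>

lemma dvd_irreducible_power:
  fixes \<pi> :: "'a::field poly"
  assumes \<pi>: "Factorial_Ring.irreducible \<pi>" and g: "g dvd \<pi> ^ Suc n" "\<not> \<pi> ^ Suc n dvd g"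
  shows "g dvd \<pi> ^ n"
proof -
  have prime: "prime_elem \<pi>" using \<pi> by (rule field_poly_irreducible_imp_prime)
  obtain h where h: "\<pi> ^ Suc n = g * h" using g(1) by blast
  have "\<pi> dvd h"
  proof (rule ccontr)
    assume "\<not> \<pi> dvd h"
    moreover have "\<pi> ^ Suc n dvd h * g" using h by (simp add: mult.commute)
    ultimately have "\<pi> ^ Suc n dvd g" using prime by (metis prime_power_dvd_multD zero_less_Suc)
    then show False using g(2) by simp
  qed
  then obtain h' where "h = \<pi> * h'" by blast
  then have "\<pi> * \<pi> ^ n = \<pi> * (g * h')" using h by (simp add: mult_ac)
  then have "\<pi> ^ n = g * h'" using \<pi> by (metis irreducible_def mult_cancel_left)
  then show ?thesis by simp
qed

lemma dvd_irreducible_power_unit: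
  fixes \<pi> :: "'a::field poly"
  assumes \<pi>: "Factorial_Ring.irreducible \<pi>" "\<not> \<pi> dvd g"
  shows "g dvd \<pi> ^ n \<Longrightarrow> g dvd 1"
proof (induction n)
  case (Suc n)
  then show ?case using dvd_irreducible_power[OF \<pi>(1) Suc.prems] \<pi>(2) by (metis dvd_mult_left power_Suc)
qed simp

lemma inverse_mod_irreducible_power:
  fixes \<pi> :: "'a::field poly"
  assumes "Factorial_Ring.irreducible \<pi>" "\<not> \<pi> dvd m"
  obtains m' k where "m * m' = 1 + \<pi> ^ n * k"
proof -
  have "\<pi> ^ n \<noteq> 0" using assms(1) by (metis irreducible_def power_not_zero)
  then obtain a c d where d: "d = a * \<pi> ^ n + c * m" "d dvd \<pi> ^ n" "d dvd m"
    by (metis poly_bezout)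
  have "\<not> \<pi> dvd d" using assms(2) d(3) dvd_trans by blast
  then have "d dvd 1" using dvd_irreducible_power_unit[OF assms(1) _ d(2)] by blast
  then obtain e where "1 = d * e" by (rule dvdE)
  then have "m * (c * e) = 1 + \<pi> ^ n * (- (a * e))" using d(1) by (simp add: algebra_simps)
  then show ?thesis by (rule that)
qed

lemma monic_degree_power:
  fixes p :: "'a::field poly"
  assumes "Polynomial.lead_coeff p = 1"
  shows "Polynomial.lead_coeff (p ^ n) = 1" "Polynomial.degree (p ^ n) = n * Polynomial.degree p"
proof -
  have "p \<noteq> 0" using assms by auto
  then show "Polynomial.degree (p ^ n) = n * Polynomial.degree p" by (simp add: Polynomial.degree_power_eq)
qed (use assms in \<open>simp add: lead_coeff_power\<close>)


context endo_space
begin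

lemma exists_vector_annihilator:
  assumes "finitely_spanned V" "z \<in> V"
  shows "\<exists>f. f \<noteq> 0 \<and> f \<diamondop> z = 0"
proof (rule ccontr)
  assume *: "\<not> (\<exists>f. f \<noteq> 0 \<and> f \<diamondop> z = 0)"
  let ?I = "{..<Suc (dim V)}"
  have eq: "(\<Sum>i\<in>?I. c i *s (u ^^ i) z) = (\<Sum>i\<in>?I. Polynomial.monom (c i) i) \<diamondop> z" for c
    using assms(2) by (simp only: act_sum act_monom)
  have "\<forall>i\<in>?I. c i = 0" if "(\<Sum>i\<in>?I. c i *s (u ^^ i) z) = 0" for c
  proof
    fix i assume "i \<in> ?I"
    have "(\<Sum>i\<in>?I. Polynomial.monom (c i) i) = 0" using * that unfolding eq by blast
    then have "Polynomial.coeff (\<Sum>i\<in>?I. Polynomial.monom (c i) i) i = 0" by simp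
    then show "c i = 0" using \<open>i \<in> ?I\<close> by (simp add: coeff_sum coeff_monom del: sum.lessThan_Suc)
  qed
  then have "dim {\<Sum>i\<in>?I. c i *s (u ^^ i) z |c. True} = Suc (dim V)"
    using dim_family(1)[of ?I "\<lambda>i. (u ^^ i) z"] by simp
  moreover have "dim {\<Sum>i\<in>?I. c i *s (u ^^ i) z |c. True} \<le> dim V"
  proof (rule dim_subspace_le[OF assms(1) subspace_V], clarify)
    show "(\<Sum>i\<in>?I. c i *s (u ^^ i) z) \<in> V" for c using assms(2) by (intro V_sum V_scale funpow_in)
  qed
  ultimately show False by linarith
qed

lemma subspace_act_kernel: "subspace {x \<in> V. f \<diamondop> x = 0}"
  by (rule subspaceI) (auto simp: act_vadd act_vscale)

lemma exists_annihilator: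
  assumes "finitely_spanned V"
  shows "\<exists>f. f \<noteq> 0 \<and> (\<forall>z\<in>V. f \<diamondop> z = 0)"
proof -
  obtain B where B: "finite B" "span B = V" using finitely_spanned_basis assms subspace_V by metis
  then have BV: "B \<subseteq> V" using span_superset by blast
  have "\<forall>z\<in>V. \<exists>f. f \<noteq> 0 \<and> f \<diamondop> z = 0" using exists_vector_annihilator[OF assms] by blast
  then obtain F where F: "\<And>z. z \<in> V \<Longrightarrow> F z \<noteq> 0 \<and> F z \<diamondop> z = 0" by metis
  define f where "f = (\<Prod>z\<in>B. F z)"
  have "f \<diamondop> z = 0" if "z \<in> B" for z
  proof -
    have "F z dvd f" unfolding f_def using B(1) that by (rule dvd_prodI)
    then show ?thesis using act_dvd_0[of z "F z"] F that BV by blast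
  qed
  then have "B \<subseteq> {x \<in> V. f \<diamondop> x = 0}" using BV by auto
  then have "V \<subseteq> {x \<in> V. f \<diamondop> x = 0}" using span_minimal[OF _ subspace_act_kernel] B(2) by blast
  moreover have "f \<noteq> 0" unfolding f_def using B(1) BV F by (simp add: prod_zero_iff) blast
  ultimately show ?thesis by blast
qed

lemma exists_minimal_annihilator:
  assumes "finitely_spanned V"
  obtains f where "f \<noteq> 0" "\<And>z. z \<in> V \<Longrightarrow> f \<diamondop> z = 0"
    "\<And>g. g \<noteq> 0 \<Longrightarrow> Polynomial.degree g < Polynomial.degree f \<Longrightarrow> \<exists>z\<in>V. g \<diamondop> z \<noteq> 0"
proof -
  let ?Q = "\<lambda>f. f \<noteq> 0 \<and> (\<forall>z\<in>V. f \<diamondop> z = 0)"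
  obtain f0 where "?Q f0" using exists_annihilator[OF assms] by blast
  then obtain f where "?Q f" "\<And>g. ?Q g \<Longrightarrow> Polynomial.degree f \<le> Polynomial.degree g"
    using ex_has_least_nat[of ?Q f0 Polynomial.degree] by blast
  then show ?thesis using that[of f] by (meson not_less)
qed

text \<open>The common divisor of \<pi>^(n+1) and \<open>g\<close> given by Bezout also kills
  \<open>x\<close>. If it missed the full power it would divide \<pi>^n, and then \<pi>^n would kill
  \<open>x\<close>.\<close>

lemma annihilator_prime_power:
  assumes \<pi>: "Factorial_Ring.irreducible \<pi>" and x: "x \<in> V" "\<pi> ^ Suc n \<diamondop> x = 0" "\<pi> ^ n \<diamondop> x \<noteq> 0"
    and g: "g \<diamondop> x = 0"
  shows "\<pi> ^ Suc n dvd g"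
proof -
  have "\<pi> ^ Suc n \<noteq> 0" using \<pi> by (metis irreducible_def power_not_zero)
  then obtain a c d where d: "d = a * \<pi> ^ Suc n + c * g" "d dvd \<pi> ^ Suc n" "d dvd g"
    by (metis poly_bezout)
  have "d \<diamondop> x = 0" unfolding d(1) using x g by (simp only: act_add act_mult act_vzero) simp
  then have "\<not> d dvd \<pi> ^ n" using x act_dvd_0 by blast
  then show ?thesis using dvd_irreducible_power[OF \<pi> d(2)] d(3) dvd_trans by blast
qed

end


context sympl
begin

lemma exists_dual_vector:
  fixes n :: nat
  assumes "\<And>i. i < n \<Longrightarrow> x i \<in> V" "\<And>c. (\<Sum>i<n. c i *s x i) = 0 \<Longrightarrow> \<forall>i<n. c i = 0"
  shows "\<exists>y\<in>V. \<forall>i<n. b y (x i) = t i"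
  using assms
proof (induction n arbitrary: t)
  case 0
  then show ?case by (auto intro: V_0)
next
  case (Suc n)
  have x: "x i \<in> V" if "i \<le> n" for i using Suc.prems(1) that by simp
  have ind: "\<forall>i<n. c i = 0" if "(\<Sum>i<n. c i *s x i) = 0" for c
  proof -
    have "\<forall>i<Suc n. (c(n := 0)) i = 0" using that by (intro Suc.prems(2)) simp
    then show ?thesis by (metis fun_upd_other less_Suc_eq less_irrefl)
  qed
  have IH: "\<exists>y\<in>V. \<forall>i<n. b y (x i) = t i" for t
    using Suc.IH[OF _ ind] x by simp
  obtain d where d: "\<And>k. d k \<in> V" "\<And>k i. i < n \<Longrightarrow> b (d k) (x i) = (if i = k then 1 else 0)"
    using IH[of "\<lambda>i. if i = _ then 1 else 0"] by metis
  \<comment> \<open>The family \<open>d\<close> is dual to the first n vectors. The subtraction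
    makes \<open>x'\<close> orthogonal to every \<open>d k\<close> with k < n, and independence
    keeps it nonzero.\<close>
  define x' where "x' = x n - (\<Sum>i<n. b (d i) (x n) *s x i)"
  have x'V: "x' \<in> V" unfolding x'_def using x by simp
  have "x' \<noteq> 0"
  proof
    assume "x' = 0"
    define c where "c = (\<lambda>i. if i = n then 1 else - b (d i) (x n))"
    have "(\<Sum>i<n. c i *s x i) = - (\<Sum>i<n. b (d i) (x n) *s x i)"
      unfolding sum_negf[symmetric] by (intro sum.cong) (auto simp: c_def)
    then have "(\<Sum>i<Suc n. c i *s x i) = x'" by (simp add: x'_def) (simp add: c_def)
    then show False using Suc.prems(2)[of c] \<open>x' = 0\<close> by (auto simp: c_def)
  qed
  then obtain y0 where y0: "y0 \<in> V" "b x' y0 \<noteq> 0" using nondeg x'V by blast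
  \<comment> \<open>The correction cancels the pairings of \<open>y0\<close> with the first n
    vectors, while the pairing with \<open>x n\<close> becomes b(y0, x'), which is nonzero.\<close>
  define y1 where "y1 = y0 - (\<Sum>j<n. b y0 (x j) *s d j)"
  have y1V: "y1 \<in> V" unfolding y1_def using y0 d x by simp
  have y1: "b y1 (x i) = b y0 (x i) - (\<Sum>j<n. b y0 (x j) * b (d j) (x i))" if "i \<le> n" for i
    unfolding y1_def using y0 d x that by (simp add: b_diff_left b_sum_left_less b_scale_left)
  have y1_0: "b y1 (x i) = 0" if "i < n" for i
    using y1[of i] that d by (simp add: if_distrib[of "(*) _"] cong: if_cong)
  have "b y0 x' = b y0 (x n) - (\<Sum>j<n. b (d j) (x n) * b y0 (x j))"
    unfolding x'_def using y0 d x by (simp add: b_diff_right b_sum_right_less b_scale_right)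
  then have y1_n: "b y1 (x n) \<noteq> 0"
    using y1[of n] y0 x'V b_swap[of x' y0] by (simp add: mult.commute)
  obtain y2 where y2: "y2 \<in> V" "\<forall>i<n. b y2 (x i) = t i" using IH by blast
  define y where "y = y2 + ((t n - b y2 (x n)) / b y1 (x n)) *s y1"
  have "y \<in> V" unfolding y_def using y2 y1V by simp
  moreover have "b y (x i) = t i" if "i < Suc n" for i
  proof (cases "i < n")
    case True
    then show ?thesis unfolding y_def using y2 y1V x y1_0 by (simp add: b_add_left b_scale_left)
  next
    case False
    then have "i = n" using that by simp
    then show ?thesis unfolding y_def using y2 y1V x y1_n by (simp add: b_add_left b_scale_left)
  qed
  ultimately show ?case by blast
qed

lemma funpow_zero [simp]: "(u ^^ j) 0 = 0"
  by (induction j) auto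

lemma b_funpow: "\<lbrakk>x \<in> V; y \<in> V\<rbrakk> \<Longrightarrow> b x ((u ^^ j) y) = b ((u ^^ j) x) y"
  using b_act[of x y "Polynomial.monom 1 j"] by (simp add: act_monom)

lemma b_funpow_self [simp]: "x \<in> V \<Longrightarrow> b x ((u ^^ j) x) = 0"
  using b_act_self[of x "Polynomial.monom 1 j"] by (simp add: act_monom)

text \<open>\<open>m\<close> is the part of an annihilating polynomial prime to \<pi>. The vector x
  = m(u) x0 has order exactly \<pi>^(n+1), and its partner is a vector dual to the last of the
  independent vectors u^i x. That each half is isotropic comes for free from
  \<open>b_act_self\<close>.\<close>

lemma exists_frame:
  assumes \<pi>: "Factorial_Ring.irreducible \<pi>" "Polynomial.lead_coeff \<pi> = 1" "\<not> \<pi> dvd m"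
    and ann: "\<And>z. z \<in> V \<Longrightarrow> (\<pi> ^ Suc n * m) \<diamondop> z = 0"
    and x0: "x0 \<in> V" "(\<pi> ^ n * m) \<diamondop> x0 \<noteq> 0"
  shows "\<exists>z. frame (\<pi> ^ Suc n) 1 z"
proof -
  let ?s = "\<pi> ^ Suc n"
  have "\<pi> \<noteq> 0" using \<pi>(1) by auto
  have "Polynomial.degree \<pi> > 0"
    using \<pi>(1) \<open>\<pi> \<noteq> 0\<close> by (auto simp: irreducible_def is_unit_iff_degree)
  then have s: "Polynomial.lead_coeff ?s = 1" "Polynomial.degree ?s > 0"
    using monic_degree_power[OF \<pi>(2), of "Suc n"] by simp_all
  define x where "x = m \<diamondop> x0"
  have xV: "x \<in> V" unfolding x_def using x0 by simp
  have sx: "?s \<diamondop> x = 0" unfolding x_def using ann[OF x0(1)] x0 by (simp only: act_mult)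
  have "\<pi> ^ n \<diamondop> x \<noteq> 0" unfolding x_def using x0 by (simp add: act_mult)
  note min = annihilator_prime_power[OF \<pi>(1) xV sx this]
  have "\<forall>i<Polynomial.degree ?s. c i = 0" if c: "(\<Sum>i<Polynomial.degree ?s. c i *s (u ^^ i) x) = 0" for c
  proof (intro allI impI)
    fix i assume i: "i < Polynomial.degree ?s"
    define g where "g = (\<Sum>i<Polynomial.degree ?s. Polynomial.monom (c i) i)"
    have coeff: "Polynomial.coeff g j = (if j < Polynomial.degree ?s then c j else 0)" for j
      by (simp add: g_def coeff_sum coeff_monom)
    have "g \<diamondop> x = 0" using c xV unfolding g_def by (simp only: act_sum act_monom)
    then have "?s dvd g" by (rule min)
    moreover have "Polynomial.degree g < Polynomial.degree ?s" using s(2) by (intro degree_lessI) (auto simp: coeff)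
    ultimately have "g = 0" using dvd_imp_degree_le by (metis not_less)
    then show "c i = 0" using coeff[of i] i by simp
  qed
  then obtain y0 where y0: "y0 \<in> V"
    "\<And>i. i < Polynomial.degree ?s \<Longrightarrow> b y0 ((u ^^ i) x) = (if i = Polynomial.degree ?s - 1 then 1 else 0)"
    using exists_dual_vector[of "Polynomial.degree ?s" "\<lambda>i. (u ^^ i) x"
        "\<lambda>i. if i = Polynomial.degree ?s - 1 then 1 else 0"] xV by auto
  obtain m' k where m': "m * m' = 1 + ?s * k" using inverse_mod_irreducible_power[OF \<pi>(1,3)] .
  \<comment> \<open>\<open>y0\<close> need not be killed by \<pi>^(n+1). The polynomial m m' acts as
    the projection onto the kernel of \<pi>^(n+1), which contains the module of \<open>x\<close>; by
    selfadjointness the pairings with the u^i x are unchanged.\<close>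
  define y where "y = (m * m') \<diamondop> y0"
  have yV: "y \<in> V" unfolding y_def using y0 by simp
  have "?s * (m * m') = m' * (?s * m)" by (simp only: mult_ac)
  then have "?s \<diamondop> y = m' \<diamondop> (?s * m) \<diamondop> y0"
    unfolding y_def using y0(1) act_mult by metis
  then have sy: "?s \<diamondop> y = 0" using ann[OF y0(1)] by simp
  have yx: "b y ((u ^^ i) x) = (if i = Polynomial.degree ?s - 1 then 1 else 0)"
    if "i < Polynomial.degree ?s" for i
  proof -
    have "?s \<diamondop> (u ^^ i) x = 0"
      using act_commute[OF xV, of ?s "Polynomial.monom 1 i"] sx by (simp add: act_monom)
    then have "(m * m') \<diamondop> (u ^^ i) x = (u ^^ i) x"
      unfolding m' using xV act_dvd_0[of "(u ^^ i) x" ?s "?s * k"] by (simp add: act_add del: power_Suc)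
    then show ?thesis unfolding y_def using y0 xV that by (simp add: b_act)
  qed
  have "frame ?s 1 (\<lambda>i. if i = 0 then x else y)"
  proof (rule frameI[OF s])
    fix i l j assume il: "i < 2 * (1::nat)" "l < 2 * (1::nat)" "j < Polynomial.degree ?s"
    have "b x ((u ^^ j) y) = - b y ((u ^^ j) x)"
      using b_funpow[OF xV yV, of j] b_swap[of "(u ^^ j) x" y] xV yV by simp
    then show "b (if i = 0 then x else y) ((u ^^ j) (if l = 0 then x else y)) =
        std_gram i l * (if j = Polynomial.degree ?s - 1 then 1 else 0)"
      using il xV yV yx[OF il(3)] by (auto simp: std_gram_def less_Suc_eq numeral_2_eq_2)
  qed (use xV yV sx sy in auto)
  then show ?thesis by blast
qed

end

text \<open>A frame for p itself generates a subspace of dimension 2 * deg p = 4. It splits off from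
  every nonzero space, and the complement satisfies the same hypotheses.\<close>

lemma (in scalar_space) four_dvd_dim:
  assumes p: "Factorial_Ring.irreducible p" "Polynomial.lead_coeff p = 1" "Polynomial.degree p = 2"
  shows "sympl (*s) V u b \<Longrightarrow> (\<And>z. z \<in> V \<Longrightarrow> act (*s) u p z = 0) \<Longrightarrow> 4 dvd dim V"
proof (induction "dim V" arbitrary: V rule: less_induct)
  case less
  then interpret sympl "(*s)" V u b by blast
  show ?case
  proof (cases "V = {0}")
    case True
    then show ?thesis using dim_eq_0_iff[OF fin_V subspace_V] by simp
  next
    case False
    then obtain x0 where "x0 \<in> V" "x0 \<noteq> 0" using V_0 by blast
    then obtain z where z: "frame (p ^ Suc 0) 1 z"
      using exists_frame[of p 1 0 x0] p less.prems(2) by (auto simp: irreducible_def)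
    have dim: "dim V = 4 + dim (perp (gen (2*1) z))" using dim_split[OF z] p(3) by simp
    have "4 dvd dim (perp (gen (2*1) z))"
      using less.hyps[OF _ sympl_frame_perp[OF z]] less.prems(2) dim by (auto simp: perp_def)
    then show ?thesis unfolding dim by simp
  qed
qed

section \<open>Alternating endomorphisms given on a basis\<close>

text \<open>The off-diagonal terms cancel in pairs; the diagonal must vanish by assumption, since in
  characteristic 2 this does not follow from antisymmetry.\<close>

lemma alternating_double_sum:
  fixes A :: "'i \<Rightarrow> 'i \<Rightarrow> 'a::comm_ring"
  assumes "finite I" "\<And>i. i \<in> I \<Longrightarrow> A i i = 0" "\<And>i j. i \<in> I \<Longrightarrow> j \<in> I \<Longrightarrow> A i j + A j i = 0"
  shows "(\<Sum>i\<in>I. \<Sum>j\<in>I. c i * c j * A i j) = 0"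
  using assms
proof (induction I rule: finite_induct)
  case (insert k I)
  have IH: "(\<Sum>i\<in>I. \<Sum>j\<in>I. c i * c j * A i j) = 0" using insert by simp
  have "(\<Sum>i\<in>insert k I. \<Sum>j\<in>insert k I. c i * c j * A i j) =
      c k * c k * A k k + ((\<Sum>j\<in>I. c k * c j * A k j) + (\<Sum>i\<in>I. c i * c k * A i k)) +
      (\<Sum>i\<in>I. \<Sum>j\<in>I. c i * c j * A i j)"
    using insert.hyps by (simp add: sum.distrib algebra_simps)
  also have "(\<Sum>j\<in>I. c k * c j * A k j) + (\<Sum>i\<in>I. c i * c k * A i k) =
      (\<Sum>j\<in>I. c k * c j * (A k j + A j k))"
    by (simp add: sum.distrib algebra_simps)
  also have "\<dots> = 0" using insert.prems by (intro sum.neutral) simp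
  finally show ?case using IH insert.prems by simp
qed simp


context endo_space
begin

definition linear_on_V :: "('v \<Rightarrow> 'v) \<Rightarrow> bool" where
  "linear_on_V w \<longleftrightarrow> (\<forall>x\<in>V. w x \<in> V) \<and> (\<forall>x\<in>V. \<forall>y\<in>V. w (x + y) = w x + w y) \<and>
     (\<forall>c. \<forall>x\<in>V. w (c *s x) = c *s w x)"

lemma linear_on_V_endo: "linear_on_V w \<Longrightarrow> endo_space (*s) V w"
  by unfold_locales (auto simp: linear_on_V_def subspace_V)

lemma linear_on_V_iff: "scale P = (*s) \<Longrightarrow> vectors P = V \<Longrightarrow> linear_map P P w \<longleftrightarrow> linear_on_V w"
  by (auto simp: linear_map_def linear_on_V_def)

lemma linear_on_V_u: "linear_on_V u"
  by (simp add: linear_on_V_def u_add u_scale)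

lemma linear_on_V_id: "linear_on_V (\<lambda>x. x)"
  by (simp add: linear_on_V_def)

lemma linear_on_V_comp: "linear_on_V w \<Longrightarrow> linear_on_V w' \<Longrightarrow> linear_on_V (\<lambda>x. w (w' x))"
  by (simp add: linear_on_V_def)

lemma linear_on_V_scale: "linear_on_V w \<Longrightarrow> linear_on_V (\<lambda>x. c *s w x)"
  by (simp add: linear_on_V_def scale_right_distrib mult.commute)

lemma linear_on_V_add: "linear_on_V w \<Longrightarrow> linear_on_V w' \<Longrightarrow> linear_on_V (\<lambda>x. w x + w' x)"
  by (simp add: linear_on_V_def scale_right_distrib)

lemma linear_on_V_diff: "linear_on_V w \<Longrightarrow> linear_on_V w' \<Longrightarrow> linear_on_V (\<lambda>x. w x - w' x)"
  by (simp add: linear_on_V_def scale_right_diff_distrib)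

lemmas linear_on_V_intros = linear_on_V_id linear_on_V_scale linear_on_V_add linear_on_V_diff
  linear_on_V_comp[OF linear_on_V_u]

lemma linear_on_V_agree:
  assumes "linear_on_V f" "linear_on_V g" "B \<subseteq> V" "V \<subseteq> span B" "\<And>x. x \<in> B \<Longrightarrow> f x = g x" "x \<in> V"
  shows "f x = g x"
proof -
  have "subspace {x \<in> V. f x = g x}"
  proof (rule subspaceI)
    have "f (0 *s 0) = g (0 *s 0)" using assms(1,2) V_0 unfolding linear_on_V_def by (metis scale_zero_left)
    then show "0 \<in> {x \<in> V. f x = g x}" by simp
  qed (use assms(1,2) in \<open>auto simp: linear_on_V_def\<close>)
  then have "span B \<subseteq> {x \<in> V. f x = g x}" using assms(3,5) by (intro span_minimal) auto
  then show ?thesis using assms(4,6) by blast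
qed

end


context sympl
begin

text \<open>The dual family \<open>E'\<close> reads off coordinates, so w x is the sum of the
  vectors b(E' i, x) g i. Then b(x, w x) expands into a double sum over basis vectors, and
  alternation is a condition on the diagonal and on pairs of basis vectors.\<close>

lemma exists_alternating_extension:
  assumes fin: "finite I" and E: "\<And>i. i \<in> I \<Longrightarrow> E i \<in> V" "\<And>i. i \<in> I \<Longrightarrow> E' i \<in> V"
    and dual: "\<And>i j. \<lbrakk>i \<in> I; j \<in> I\<rbrakk> \<Longrightarrow> b (E' i) (E j) = (if i = j then 1 else 0)"
    and span: "V \<subseteq> span (E ` I)" and g: "\<And>i. i \<in> I \<Longrightarrow> g i \<in> V"
    and alt: "\<And>i. i \<in> I \<Longrightarrow> b (E i) (g i) = 0"
      "\<And>i j. \<lbrakk>i \<in> I; j \<in> I\<rbrakk> \<Longrightarrow> b (E i) (g j) + b (E j) (g i) = 0"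
  obtains w where "linear_on_V w" "\<And>x. x \<in> V \<Longrightarrow> b x (w x) = 0" "\<And>i. i \<in> I \<Longrightarrow> w (E i) = g i"
proof -
  define w where "w = (\<lambda>x. \<Sum>i\<in>I. b (E' i) x *s g i)"
  define ex where "ex = (\<lambda>x. \<Sum>i\<in>I. b (E' i) x *s E i)"
  have lin: "linear_on_V w" "linear_on_V ex"
    unfolding linear_on_V_def w_def ex_def using E g
    by (auto simp: b_add_right b_scale_right scale_left_distrib sum.distrib scale_sum_right)
  have delta: "(\<Sum>i\<in>I. b (E' i) (E j) *s h i) = h j" if "j \<in> I" for j and h :: "_ \<Rightarrow> 'v"
  proof -
    have "(\<Sum>i\<in>I. b (E' i) (E j) *s h i) = (\<Sum>i\<in>I. if i = j then h i else 0)"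
      using dual that by (intro sum.cong) auto
    then show ?thesis using fin that by simp
  qed
  have ex: "ex x = x" if "x \<in> V" for x
    using linear_on_V_agree[OF lin(2) linear_on_V_id _ span _ that] E delta by (auto simp: ex_def)
  have "b x (w x) = 0" if x: "x \<in> V" for x
  proof -
    have "b x (w x) = b (ex x) (w x)" using ex[OF x] by simp
    also have "\<dots> = (\<Sum>i\<in>I. \<Sum>j\<in>I. b (E' i) x * b (E' j) x * b (E i) (g j))"
      unfolding w_def ex_def using E g x
      by (simp add: b_sum_left b_sum_right b_scale_left b_scale_right sum_distrib_left mult_ac)
        (subst sum.swap, simp add: mult.left_commute)
    also have "\<dots> = 0" using alternating_double_sum[OF fin, of "\<lambda>i j. b (E i) (g j)"] alt by simp
    finally show ?thesis .
  qed
  moreover have "w (E i) = g i" if "i \<in> I" for i unfolding w_def by (rule delta[OF that])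
  ultimately show ?thesis using that lin(1) by blast
qed

lemma alternating_endo_iff:
  "scale P = (*s) \<Longrightarrow> vectors P = V \<Longrightarrow>
   alternating_endo P b w \<longleftrightarrow> linear_on_V w \<and> (\<forall>x\<in>V. b x (w x) = 0)"
  by (simp add: alternating_endo_def linear_on_V_iff)

lemma symplectic_pair_V: "symplectic_pair (pair V)"
  unfolding symplectic_pair_iff by (simp add: sympl_axioms)

lemma annihilates_quad_iff:
  assumes "linear_on_V w"
  shows "annihilates [:\<alpha>, - \<kappa>, 1:] (pair V) w \<longleftrightarrow> (\<forall>x\<in>V. w (w x) = \<kappa> *s w x - \<alpha> *s x)"
proof -
  interpret w: endo_space "(*s)" V w using assms by (rule linear_on_V_endo)
  have "(w (w x) = \<kappa> *s w x - \<alpha> *s x) = (act (*s) w [:\<alpha>, - \<kappa>, 1:] x = 0)" if "x \<in> V" for x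
    unfolding w.act_quad[OF that] by (simp add: algebra_simps eq_neg_iff_add_eq_0)
  then show ?thesis unfolding annihilates_def act_def by simp
qed

text \<open>Given \<open>p(w) = 0\<close>, the condition \<open>q(w - u) = 0\<close> becomes linear in \<open>w\<close>, so that it can be
  checked on a basis.\<close>

lemma differenceI:
  assumes w: "linear_on_V w" "\<And>x. x \<in> V \<Longrightarrow> b x (w x) = 0"
    and p: "\<And>x. x \<in> V \<Longrightarrow> w (w x) = \<kappa> *s w x - \<alpha> *s x"
    and q: "\<And>x. x \<in> V \<Longrightarrow>
      w (u x) + u (w x) = (\<kappa> - \<mu>) *s w x + (u (u x) + (\<mu> *s u x + (\<beta> - \<alpha>) *s x))"
  shows "symplectic_difference [:\<alpha>, - \<kappa>, 1:] [:\<beta>, - \<mu>, 1:] (pair V)"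
proof -
  define w2 where "w2 = (\<lambda>x. w x - u x)"
  have w2: "linear_on_V w2" unfolding w2_def by (intro linear_on_V_diff w linear_on_V_u)
  have "w2 (w2 x) = \<mu> *s w2 x - \<beta> *s x" if x: "x \<in> V" for x
  proof -
    have wx: "w x \<in> V" using w x by (auto simp: linear_on_V_def)
    have "w (w x - u x) = w (w x) - w (u x)"
    proof -
      interpret w: endo_space "(*s)" V w using w(1) by (rule linear_on_V_endo)
      show ?thesis using x by (intro w.u_diff) auto
    qed
    then have "w2 (w2 x) = w (w x) - (w (u x) + u (w x)) + u (u x)"
      unfolding w2_def using x wx by (simp add: u_diff)
    then show ?thesis unfolding p[OF x] q[OF x] w2_def by (simp add: algebra_simps)
  qed
  moreover have "b x (w2 x) = 0" if "x \<in> V" for x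
    unfolding w2_def using w that by (simp add: b_diff_right linear_on_V_def)
  ultimately show ?thesis
    unfolding symplectic_difference_def
    using symplectic_pair_V w w2 p
    by (intro conjI exI[of _ w] exI[of _ w2])
      (auto simp: alternating_endo_iff annihilates_quad_iff w2_def)
qed

text \<open>The reverse of \<open>differenceI\<close>: expanding q(w - u) = 0 and substituting p(w)
  = 0 leaves the relation that is linear in \<open>w\<close>.\<close>

lemma differenceD:
  assumes "symplectic_difference [:\<alpha>, - \<kappa>, 1:] [:\<beta>, - \<mu>, 1:] (pair V)"
  obtains w where "linear_on_V w" "\<And>x. x \<in> V \<Longrightarrow> b x (w x) = 0"
    "\<And>x. x \<in> V \<Longrightarrow> w (w x) = \<kappa> *s w x - \<alpha> *s x"
    "\<And>x. x \<in> V \<Longrightarrow>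
      w (u x) + u (w x) = (\<kappa> - \<mu>) *s w x + (u (u x) + (\<mu> *s u x + (\<beta> - \<alpha>) *s x))"
proof -
  obtain w w2 where
    w: "linear_on_V w" "\<And>x. x \<in> V \<Longrightarrow> b x (w x) = 0"
      "\<And>x. x \<in> V \<Longrightarrow> w (w x) = \<kappa> *s w x - \<alpha> *s x" and
    w2: "linear_on_V w2" "\<And>x. x \<in> V \<Longrightarrow> w2 (w2 x) = \<mu> *s w2 x - \<beta> *s x" and
    u: "\<And>x. x \<in> V \<Longrightarrow> u x = w x - w2 x"
    using assms unfolding symplectic_difference_def
    by (auto simp: alternating_endo_iff annihilates_quad_iff)
  interpret w: endo_space "(*s)" V w using w(1) by (rule linear_on_V_endo)
  have "w (u x) + u (w x) = (\<kappa> - \<mu>) *s w x + (u (u x) + (\<mu> *s u x + (\<beta> - \<alpha>) *s x))" if x: "x \<in> V" for x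
  proof -
    have e: "w2 y = w y - u y" if "y \<in> V" for y using u[OF that] by (simp add: algebra_simps)
    have "w2 (w2 x) = w (w x - u x) - u (w x - u x)" using x by (simp add: e)
    also have "\<dots> = w (w x) - (w (u x) + u (w x)) + u (u x)" using x by (simp add: u_diff w.u_diff)
    finally have "w (u x) + u (w x) = w (w x) + u (u x) - w2 (w2 x)" by (simp add: algebra_simps)
    then show ?thesis unfolding w(3)[OF x] w2(2)[OF x] unfolding e[OF x] by (simp add: algebra_simps)
  qed
  then show ?thesis using that w by blast
qed

end


text \<open>Common setting of both constructions: \<open>V\<close> is free of rank 4 over
  F[T]/(T^m), with two hyperbolic pairs of generators. \<open>T\<close> is t^2 - \<delta> t + c in
  one case and t - d in the other.\<close>

locale nilpotent_basis = sympl sc V u b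
  for sc :: "'a::field \<Rightarrow> 'v::ab_group_add \<Rightarrow> 'v" (infixr "*s" 75) and V u b +
  fixes T :: "'a poly" and m :: nat and e :: "nat \<Rightarrow> 'v"
  assumes m: "m > 0" and e_in: "j < 4 \<Longrightarrow> e j \<in> V" and T_nil: "j < 4 \<Longrightarrow> T ^ m \<diamondop> e j = 0"
    and gram_less: "\<lbrakk>i < 4; j < 4; k < m\<rbrakk> \<Longrightarrow>
      b (e i) (T ^ k \<diamondop> e j) = std_gram i j * (if k = m - 1 then 1 else 0)"
    and spanning: "V \<subseteq> span ((\<lambda>(k, j). T ^ k \<diamondop> e j) ` ({..<m} \<times> {..<4}))"
begin

lemma e_in_simps [simp]: "e 0 \<in> V" "e (Suc 0) \<in> V" "e 2 \<in> V" "e 3 \<in> V"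
  using e_in[of 0] e_in[of 1] e_in[of 2] e_in[of 3] by auto

lemma T_zero: "j < 4 \<Longrightarrow> m \<le> k \<Longrightarrow> T ^ k \<diamondop> e j = 0"
  using act_dvd_0[of "e j" "T ^ m" "T ^ k"] T_nil e_in by (simp add: le_imp_power_dvd)

lemma gram:
  assumes "i < 4" "j < 4"
  shows "b (T ^ k \<diamondop> e i) (T ^ l \<diamondop> e j) = std_gram i j * (if Suc (k + l) = m then 1 else 0)"
proof -
  have "b (T ^ k \<diamondop> e i) (T ^ l \<diamondop> e j) = b (e i) (T ^ (k + l) \<diamondop> e j)"
    using assms e_in by (simp add: b_act power_add act_mult)
  then show ?thesis
    using gram_less[of i j "k + l"] T_zero[of j "k + l"] assms e_in by (cases "k + l < m") auto
qed

lemma agree_on_V: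
  assumes "linear_on_V f" "linear_on_V g" "\<And>k j. j < 4 \<Longrightarrow> f (T ^ k \<diamondop> e j) = g (T ^ k \<diamondop> e j)" "x \<in> V"
  shows "f x = g x"
  by (rule linear_on_V_agree[OF assms(1,2) _ spanning _ assms(4)]) (use assms(3) e_in in auto)

text \<open>Up to sign, the vector dual to \<open>T ^ k\<close> on \<open>e j\<close> is
  \<open>T ^ (m - 1 - k)\<close> on the partner of \<open>e j\<close>. The values
  \<open>g k j\<close> are prescribed for all k and vanish from k = m on, so that later computations
  need no case distinction at the end of a chain.\<close>

lemma exists_extension:
  assumes g: "\<And>k j. j < 4 \<Longrightarrow> g k j \<in> V" "\<And>k j. j < 4 \<Longrightarrow> m \<le> k \<Longrightarrow> g k j = 0"
    and alt: "\<And>k j. j < 4 \<Longrightarrow> b (T ^ k \<diamondop> e j) (g k j) = 0"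
      "\<And>k j k' j'. j < 4 \<Longrightarrow> j' < 4 \<Longrightarrow> b (T ^ k \<diamondop> e j) (g k' j') + b (T ^ k' \<diamondop> e j') (g k j) = 0"
  obtains w where "linear_on_V w" "\<And>x. x \<in> V \<Longrightarrow> b x (w x) = 0"
    "\<And>k j. j < 4 \<Longrightarrow> w (T ^ k \<diamondop> e j) = g k j"
proof -
  let ?I = "{..<m} \<times> {..<4::nat}"
  let ?E = "\<lambda>(k, j). T ^ k \<diamondop> e j"
  let ?E' = "\<lambda>(k, j). std_gram (partner j) j *s T ^ (m - 1 - k) \<diamondop> e (partner j)"
  have partner4: "partner j < 4 \<longleftrightarrow> j < 4" for j using partner_less[of j 2] by simp
  have dual: "b (?E' x) (?E y) = (if x = y then 1 else 0)" if xy: "x \<in> ?I" "y \<in> ?I" for x y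
  proof -
    obtain k j l i where x: "x = (k, j)" "k < m" "j < 4" and y: "y = (l, i)" "l < m" "i < 4"
      using xy by auto
    have "b (?E' x) (?E y) =
        std_gram (partner j) j * (std_gram (partner j) i * (if Suc (m - 1 - k + l) = m then 1 else 0))"
      using x y e_in partner4 by (simp add: b_scale_left gram)
    moreover have "std_gram (partner j) j * std_gram (partner j) i = (if i = j then 1 else (0::'a))"
      using std_gram_eq_0[of i "partner j", where 'a = 'a] std_gram_partner[of "partner j", where 'a = 'a]
      by auto
    moreover have "Suc (m - 1 - k + l) = m \<longleftrightarrow> k = l" using x y by auto
    ultimately show ?thesis using x y by auto
  qed
  have E: "?E i \<in> V" "?E' i \<in> V" if i: "i \<in> ?I" for i
  proof -
    obtain k j where "i = (k, j)" "j < 4" using i by auto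
    then show "?E i \<in> V" "?E' i \<in> V" using e_in[of j] e_in[of "partner j"] partner4[of j] by simp_all
  qed
  obtain w where w: "linear_on_V w" "\<And>x. x \<in> V \<Longrightarrow> b x (w x) = 0"
      "\<And>i. i \<in> ?I \<Longrightarrow> w (?E i) = (\<lambda>(k, j). g k j) i"
  proof (rule exists_alternating_extension[of ?I ?E ?E' "\<lambda>(k, j). g k j"])
    show "V \<subseteq> span (?E ` ?I)" by (rule spanning)
    show "b (?E i) ((\<lambda>(k, j). g k j) i) = 0" if i: "i \<in> ?I" for i using i alt(1) by auto
    show "b (?E i) ((\<lambda>(k, j). g k j) j) + b (?E j) ((\<lambda>(k, j). g k j) i) = 0"
      if "i \<in> ?I" "j \<in> ?I" for i j
    proof -
      obtain k1 j1 k2 j2 where "i = (k1, j1)" "j = (k2, j2)" "j1 < 4" "j2 < 4" using \<open>i \<in> ?I\<close> \<open>j \<in> ?I\<close> by auto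
      then show ?thesis using alt(2)[of j1 j2 k1 k2] by simp
    qed
    show "(\<lambda>(k, j). g k j) i \<in> V" if i: "i \<in> ?I" for i using i g by auto
    fix w assume "linear_on_V w" "\<And>x. x \<in> V \<Longrightarrow> b x (w x) = 0"
      "\<And>i. i \<in> ?I \<Longrightarrow> w (?E i) = (\<lambda>(k, j). g k j) i"
    then show thesis by (rule that)
  qed (use dual E in blast)+
  have "w 0 = 0" using w(1) V_0 unfolding linear_on_V_def by (metis scale_zero_left)
  have "w (T ^ k \<diamondop> e j) = g k j" if "j < 4" for k j
    using w(3)[of "(k, j)"] that T_zero[of j k] g(2)[of j k] \<open>w 0 = 0\<close> by (cases "k < m") auto
  then show ?thesis using that w by blast
qed

end

lemma less_4_cases:
  fixes j :: nat
  assumes "j < 4" "P 0" "P (Suc 0)" "P 2" "P 3"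
  shows "P j"
proof -
  have "j = 0 \<or> j = Suc 0 \<or> j = 2 \<or> j = 3" using assms(1) by auto
  then show ?thesis using assms by auto
qed

lemma std_gram_simps [simp]:
  "std_gram 0 (Suc 0) = - 1" "std_gram (Suc 0) 0 = 1" "std_gram 2 3 = - 1" "std_gram 3 2 = 1"
  "std_gram i i = 0" "std_gram 0 2 = 0" "std_gram 0 3 = 0" "std_gram (Suc 0) 2 = 0" "std_gram (Suc 0) 3 = 0"
  "std_gram 2 0 = 0" "std_gram 3 0 = 0" "std_gram 2 (Suc 0) = 0" "std_gram 3 (Suc 0) = 0"
  by (auto simp: std_gram_def)

section \<open>Differences on a single cell\<close>

context endo_space
begin

lemma span_stable:
  assumes "B \<subseteq> V" "\<And>x. x \<in> B \<Longrightarrow> u x \<in> span B" "x \<in> span B"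
  shows "u x \<in> span B"
proof -
  have "subspace {x \<in> V. u x \<in> span B}"
    by (rule subspaceI) (auto simp: u_add u_scale span_zero span_add span_scale)
  then have "span B \<subseteq> {x \<in> V. u x \<in> span B}" using assms(1,2) by (intro span_minimal) auto
  then show ?thesis using assms(3) by blast
qed

lemma act_power_Suc: "z \<in> V \<Longrightarrow> f ^ k \<diamondop> f \<diamondop> z = f ^ Suc k \<diamondop> z"
  by (simp add: mult.commute flip: act_mult)

end

lemma top_coeff_monic:
  assumes "Polynomial.degree f = Polynomial.degree s - 1" "Polynomial.degree s > 0" "Polynomial.lead_coeff f = 1"
  shows "top_coeff s f = 1"
proof -
  have "f mod s = f" using assms by (intro mod_poly_less) auto
  then show ?thesis using assms by (simp add: top_coeff_def)
qed

context nilpotent_basis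
begin

definition Tb :: "nat \<Rightarrow> nat \<Rightarrow> 'v" where
  "Tb k j = T ^ k \<diamondop> e j"

lemma Tb_in [simp]: "Tb k 0 \<in> V" "Tb k (Suc 0) \<in> V" "Tb k 2 \<in> V" "Tb k 3 \<in> V"
  by (simp_all add: Tb_def)

lemma Tb_gram: "i < 4 \<Longrightarrow> j < 4 \<Longrightarrow>
    b (Tb k i) (Tb l j) = std_gram i j * (if Suc (k + l) = m then 1 else 0)"
  unfolding Tb_def by (rule gram)

lemma Tb_zero: "j < 4 \<Longrightarrow> m \<le> k \<Longrightarrow> Tb k j = 0"
  unfolding Tb_def by (rule T_zero)

lemmas Tb_agree = agree_on_V[folded Tb_def]
lemmas Tb_extension = exists_extension[folded Tb_def]

end

context sympl
begin

text \<open>\<open>c\<close> is arbitrary: when \<kappa> - \<mu> = 2 d, the choice c = d^2 makes the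
  quadratic (t - d)^2, which covers the even powers of t - d. Since u_1 must commute with u^2 -
  \<delta> u, it is sought as a 4 by 4 matrix over the polynomials in P(u), P being the
  quadratic.\<close>

lemma difference_of_quadratic_power_frame:
  assumes fr: "frame ([:c, - (\<kappa> - \<mu>), 1:] ^ m) 1 z" and full: "gen (2*1) z = V"
  shows "symplectic_difference [:\<alpha>, - \<kappa>, 1:] [:\<beta>, - \<mu>, 1:] (pair V)"
proof -
  define \<delta> where "\<delta> = \<kappa> - \<mu>"
  define P where "P = [:c, - \<delta>, 1:]"
  let ?s = "P ^ m"
  have fr: "frame ?s 1 z" using fr by (simp add: P_def \<delta>_def)
  have P: "Polynomial.lead_coeff P = 1" "Polynomial.degree P = 2" by (simp_all add: P_def)
  note Pk = monic_degree_power[OF P(1)]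
  have m: "m > 0" using frame_s(2)[OF fr] by (cases m) auto
  define x where "x = z 1"
  define y where "y = z 0"
  have xy: "x \<in> V" "y \<in> V" using frame_in[OF fr] by (auto simp: x_def y_def)
  \<comment> \<open>Taking u y - \<delta> y instead of u y makes this generator orthogonal to u x,
    because (t - \<delta>) t = P - c contributes nothing to the top coefficient. The Gram matrix
    then consists of two standard planes.\<close>
  define e where "e = (\<lambda>j::nat. if j = 0 then u y - \<delta> *s y else if j = 1 then x else if j = 2 then y else u x)"
  have e: "e 0 = u y - \<delta> *s y" "e (Suc 0) = x" "e 2 = y" "e 3 = u x" by (simp_all add: e_def)
  \<comment> \<open>Each generator is the polynomial \<open>Ep j\<close> applied to the frame vector
    at index 0 or 1, which turns the Gram matrix into values of \<open>top_coeff\<close>.\<close>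
  define Ep where "Ep = (\<lambda>j::nat. if j = 0 then [:- \<delta>, 1:] else if j = 3 then [:0, 1:] else 1)"
  define \<sigma> where "\<sigma> = (\<lambda>j::nat. if even j then 0 else 1 :: nat)"
  have e_Ep: "e j = Ep j \<diamondop> z (\<sigma> j)" if "j < 4" for j
    by (rule less_4_cases[OF that])
      (use xy in \<open>auto simp: e_def Ep_def \<sigma>_def x_def y_def act_lin\<close>)
  have Pu: "P \<diamondop> v = c *s v - \<delta> *s u v + u (u v)" if "v \<in> V" for v
    using act_quad[OF that, of c "- \<delta>"] by (simp add: P_def)
  have ue: "u (e 0) = P \<diamondop> e 2 - c *s e 2" "u (e (Suc 0)) = e 3" "u (e 2) = e 0 + \<delta> *s e 2"
    "u (e 3) = P \<diamondop> e (Suc 0) - c *s e (Suc 0) + \<delta> *s e 3"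
    using xy by (simp_all add: e Pu u_diff u_scale)
  have e_in: "e j \<in> V" if "j < 4" for j
    by (rule less_4_cases[OF that]) (use xy in \<open>simp_all add: e\<close>)
  have s_nil: "?s \<diamondop> e j = 0" if "j < 4" for j
  proof -
    have "\<sigma> j < 2 * 1" by (simp add: \<sigma>_def)
    then show ?thesis
      using act_commute[of "z (\<sigma> j)" ?s "Ep j"] frame_ann[OF fr] frame_in[OF fr] e_Ep[OF that] by simp
  qed
  \<comment> \<open>\<open>top_coeff\<close> reads degree 2 m - 1. The degree 2 k of P^k does not
    reach it for k < m, and the degree 2 k + 1 of P^k t reaches it exactly for k = m - 1.\<close>
  have top0: "top_coeff ?s (P ^ k) = 0" for k
  proof (cases "k < m")
    case True
    then show ?thesis by (intro top_coeff_small) (simp add: Pk P)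
  qed (simp add: top_coeff_dvd le_imp_power_dvd)
  have top1: "top_coeff ?s (P ^ k * [:0, 1:]) = (if k = m - 1 then 1 else 0)" if "k < m" for k
  proof -
    have deg: "Polynomial.degree (P ^ k * [:0, 1:]) = 2 * k + 1"
      using P by (subst degree_mult_eq) (auto simp: Pk)
    show ?thesis
    proof (cases "k = m - 1")
      case True
      have "Polynomial.lead_coeff (P ^ k * [:0, 1:]) = 1" using Pk P by (simp add: lead_coeff_mult del: mult_pCons_right)
      moreover have "2 * k + 1 = 2 * m - 1" using True that by auto
      ultimately show ?thesis using True m deg by (simp add: top_coeff_monic Pk P del: mult_pCons_right)
    next
      case False
      then show ?thesis using that deg by (simp add: top_coeff_small Pk P del: mult_pCons_right)
    qed
  qed
  have top2: "top_coeff ?s (P ^ k * [:- \<delta>, 1:]) = (if k = m - 1 then 1 else 0)" if "k < m" for k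
  proof -
    have "P ^ k * [:- \<delta>, 1:] = P ^ k * [:0, 1:] + smult (- \<delta>) (P ^ k)" by (simp add: algebra_simps)
    then show ?thesis by (simp only: top_coeff_add top_coeff_smult top0 top1[OF that]) simp
  qed
  have top3: "top_coeff ?s (P ^ k * ([:- \<delta>, 1:] * [:0, 1:])) = 0" for k
  proof -
    have "[:- \<delta>, 1:] * [:0, 1:] = P - [:c:]" by (simp add: P_def)
    then have "P ^ k * ([:- \<delta>, 1:] * [:0, 1:]) = P ^ Suc k + smult (- c) (P ^ k)"
      by (simp only:) (simp add: algebra_simps)
    then show ?thesis by (simp only: top_coeff_add top_coeff_smult top0) simp
  qed
  have gram: "b (e i) (P ^ k \<diamondop> e j) = std_gram i j * (if k = m - 1 then 1 else 0)"
    if ij: "i < 4" "j < 4" "k < m" for i j k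
  proof -
    have "b (e i) (P ^ k \<diamondop> e j) = b (z (\<sigma> i)) ((P ^ k * (Ep i * Ep j)) \<diamondop> z (\<sigma> j))"
      using ij frame_in[OF fr]
      by (simp add: e_Ep b_act \<sigma>_def mult.left_commute[of "P ^ k"] flip: act_mult)
    also have "\<dots> = std_gram (\<sigma> i) (\<sigma> j) * top_coeff ?s (P ^ k * (Ep i * Ep j))"
      by (intro frame_gram[OF fr]) (auto simp: \<sigma>_def)
    also have "\<dots> = std_gram i j * (if k = m - 1 then 1 else 0)"
      by (rule less_4_cases[OF ij(1)]; rule less_4_cases[OF ij(2)])
        (use top0[of k] top1[OF ij(3)] top2[OF ij(3)] top3[of k] in
          \<open>simp_all add: \<sigma>_def Ep_def mult.commute[of "[:0, 1:]" "[:- \<delta>, 1:]"] del: mult_pCons_left mult_pCons_right\<close>)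
    finally show ?thesis .
  qed
  define B where "B = (\<lambda>(k, j). P ^ k \<diamondop> e j) ` ({..<m} \<times> {..<4::nat})"
  have inB: "P ^ k \<diamondop> e j \<in> span B" if "j < 4" for k j
  proof (cases "k < m")
    case True
    then show ?thesis using that unfolding B_def by (intro span_base) auto
  next
    case False
    then have "P ^ k \<diamondop> e j = 0" using act_dvd_0[of "e j" ?s "P ^ k"] e_in s_nil that by (simp add: le_imp_power_dvd)
    then show ?thesis by (simp add: span_zero)
  qed
  have spanning: "V \<subseteq> span B"
  proof -
    have ub: "u (P ^ k \<diamondop> e j) \<in> span B" if "j < 4" for k j
      by (rule less_4_cases[OF that])
        (use e_in[of 0] e_in[of 1] e_in[of 2] e_in[of 3] in
          \<open>auto simp: ue act_vadd act_vdiff act_vscale act_power_Suc simp del: power_Suc simp flip: act_u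
            intro!: span_add span_diff span_scale inB\<close>)
    have "gen (2*1) z \<subseteq> span B"
    proof (rule gen_subset_subspace)
      show "u v \<in> span B" if "v \<in> span B" for v
      proof (rule span_stable[OF _ _ that])
        show "B \<subseteq> V" unfolding B_def using e_in by auto
      qed (use ub in \<open>auto simp: B_def\<close>)
      show "z i \<in> span B" if "i < 2 * 1" for i
      proof -
        have "i = 0 \<or> i = 1" using that by auto
        then show ?thesis using inB[of 1 0] inB[of 2 0] by (auto simp: e x_def y_def)
      qed
    qed simp
    then show ?thesis using full by simp
  qed
  interpret nilpotent_basis "(*s)" V u b P m e
    by unfold_locales (use m e_in s_nil gram spanning in \<open>auto simp: B_def\<close>)
  have uT: "u (Tb k 0) = Tb (Suc k) 2 - c *s Tb k 2" "u (Tb k (Suc 0)) = Tb k 3"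
    "u (Tb k 2) = Tb k 0 + \<delta> *s Tb k 2" "u (Tb k 3) = Tb (Suc k) (Suc 0) - c *s Tb k (Suc 0) + \<delta> *s Tb k 3" for k
    unfolding Tb_def
    by (simp_all add: ue act_vadd act_vdiff act_vscale act_power_Suc del: power_Suc flip: act_u)
  \<comment> \<open>The one choice made is u_1 x = u x - y, that is u_2 x = - y. Everything else
    follows: the linear relation at x gives u_1 (u x), then p(u_1) = 0 at x gives u_1 y, and the
    linear relation at y gives the value at u y - \<delta> y.\<close>
  define g where "g = (\<lambda>k j::nat.
    if j = 0 then (\<beta> - \<alpha>) *s Tb k 2 - \<beta> *s Tb k 3
    else if j = 1 then Tb k 3 - Tb k 2
    else if j = 2 then \<beta> *s Tb k (Suc 0) + (Tb k 0 + \<kappa> *s Tb k 2)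
    else (\<beta> - \<alpha>) *s Tb k (Suc 0) + (Tb k 0 + \<kappa> *s Tb k 3))"
  obtain w where w: "linear_on_V w" "\<And>x. x \<in> V \<Longrightarrow> b x (w x) = 0" "\<And>k j. j < 4 \<Longrightarrow> w (Tb k j) = g k j"
  proof (rule Tb_extension[of g])
    fix k j k' j' :: nat assume j: "j < 4" and j': "j' < 4"
    show "g k j \<in> V" by (simp add: g_def)
    show "g k j = 0" if "m \<le> k" using that by (simp add: g_def Tb_zero)
    show "b (Tb k j) (g k j) = 0"
      by (rule less_4_cases[OF j]) (simp_all add: g_def b_lin Tb_gram)
    show "b (Tb k j) (g k' j') + b (Tb k' j') (g k j) = 0"
      by (rule less_4_cases[OF j]; rule less_4_cases[OF j'])
        (simp_all add: g_def b_lin Tb_gram add.commute[of k' k])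
  qed blast
  interpret w: endo_space "(*s)" V w using w(1) by (rule linear_on_V_endo)
  have wT: "w (Tb k 0) = (\<beta> - \<alpha>) *s Tb k 2 - \<beta> *s Tb k 3" "w (Tb k (Suc 0)) = Tb k 3 - Tb k 2"
    "w (Tb k 2) = \<beta> *s Tb k (Suc 0) + (Tb k 0 + \<kappa> *s Tb k 2)"
    "w (Tb k 3) = (\<beta> - \<alpha>) *s Tb k (Suc 0) + (Tb k 0 + \<kappa> *s Tb k 3)" for k
    using w(3)[of _ k] by (simp_all add: g_def)
  show ?thesis
  proof (rule differenceI[OF w(1,2)])
    fix v assume v: "v \<in> V"
    show "w (w v) = \<kappa> *s w v - \<alpha> *s v"
    proof (rule Tb_agree[OF _ _ _ v])
      fix k j :: nat assume "j < 4"
      then show "w (w (Tb k j)) = \<kappa> *s w (Tb k j) - \<alpha> *s Tb k j"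
        by (rule less_4_cases) (simp_all add: wT w.u_add w.u_diff w.u_scale algebra_simps)
    qed (intro linear_on_V_intros linear_on_V_comp[OF w(1)])+
    show "w (u v) + u (w v) = (\<kappa> - \<mu>) *s w v + (u (u v) + (\<mu> *s u v + (\<beta> - \<alpha>) *s v))"
    proof (rule Tb_agree[OF _ _ _ v])
      fix k j :: nat assume "j < 4"
      then show "w (u (Tb k j)) + u (w (Tb k j)) =
          (\<kappa> - \<mu>) *s w (Tb k j) + (u (u (Tb k j)) + (\<mu> *s u (Tb k j) + (\<beta> - \<alpha>) *s Tb k j))"
        by (rule less_4_cases)
          (simp_all add: wT uT \<delta>_def w.u_add w.u_diff w.u_scale u_add u_diff u_scale algebra_simps)
    qed (intro linear_on_V_intros linear_on_V_comp[OF w(1)])+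
  qed
qed

text \<open>The conditions on \<mu> and \<beta> say q(t) = p(t + d). With T = u - d the linear
  relation reads w T = T (\<kappa> - w) + T^2, so \<open>w\<close> commutes with T^2 and its values
  on a chain depend on the parity of the power of T.\<close>

lemma difference_of_odd_power_frame:
  assumes fr: "frame ([:- d, 1:] ^ n) 2 z" and full: "gen (2*2) z = V" and "odd n"
    and \<mu>: "\<mu> = \<kappa> - (d + d)" and \<beta>: "\<beta> = \<alpha> - d * \<kappa> + d * d"
  shows "symplectic_difference [:\<alpha>, - \<kappa>, 1:] [:\<beta>, - \<mu>, 1:] (pair V)"
proof -
  define T where "T = [:- d, 1:]"
  let ?s = "T ^ n"
  have fr: "frame ?s 2 z" using fr by (simp add: T_def)
  have T: "Polynomial.lead_coeff T = 1" "Polynomial.degree T = 1" by (simp_all add: T_def)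
  note Tk = monic_degree_power[OF T(1)]
  have n: "n > 0" using \<open>odd n\<close> by (cases n) auto
  have uz: "u v = d *s v + T \<diamondop> v" if "v \<in> V" for v
    using act_lin[OF that, of "- d"] by (simp add: T_def)
  have z_in: "z j \<in> V" if "j < 4" for j using frame_in[OF fr] that by simp
  have nil: "?s \<diamondop> z j = 0" if "j < 4" for j using frame_ann[OF fr] that by simp
  have gram: "b (z i) (T ^ k \<diamondop> z j) = std_gram i j * (if k = n - 1 then 1 else 0)"
    if ij: "i < 4" "j < 4" "k < n" for i j k
  proof -
    have "Polynomial.coeff (T ^ k) k = 1" using Tk[of k] T by simp
    then have "top_coeff ?s (T ^ k) = (if k = n - 1 then 1 else 0)"
      using ij(3) by (auto simp: Tk T intro!: top_coeff_monic top_coeff_small)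
    then show ?thesis using frame_gram[OF fr, of i j "T ^ k"] ij by simp
  qed
  define B where "B = (\<lambda>(k, j). T ^ k \<diamondop> z j) ` ({..<n} \<times> {..<4::nat})"
  have inB: "T ^ k \<diamondop> z j \<in> span B" if "j < 4" for k j
  proof (cases "k < n")
    case True
    then show ?thesis using that unfolding B_def by (intro span_base) auto
  next
    case False
    then have "T ^ k \<diamondop> z j = 0" using act_dvd_0[of "z j" ?s "T ^ k"] z_in nil that by (simp add: le_imp_power_dvd)
    then show ?thesis by (simp add: span_zero)
  qed
  have uT: "u (T ^ k \<diamondop> z j) = d *s T ^ k \<diamondop> z j + T ^ Suc k \<diamondop> z j" if "j < 4" for k j
    using z_in[OF that] by (simp add: uz act_mult)
  have spanning: "V \<subseteq> span B"
  proof -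
    have "gen (2*2) z \<subseteq> span B"
    proof (rule gen_subset_subspace)
      show "u v \<in> span B" if "v \<in> span B" for v
      proof (rule span_stable[OF _ _ that])
        show "B \<subseteq> V" unfolding B_def using z_in by auto
        show "u x \<in> span B" if "x \<in> B" for x
          using that inB by (auto simp: B_def uT simp del: power_Suc intro!: span_add span_scale)
      qed
      show "z i \<in> span B" if "i < 2 * 2" for i using inB[of i 0] that by simp
    qed simp
    then show ?thesis using full by simp
  qed
  interpret nilpotent_basis "(*s)" V u b T n z
    by unfold_locales (use n z_in nil gram spanning in \<open>auto simp: B_def\<close>)
  have uT: "u (Tb k 0) = d *s Tb k 0 + Tb (Suc k) 0" "u (Tb k (Suc 0)) = d *s Tb k (Suc 0) + Tb (Suc k) (Suc 0)"
    "u (Tb k 2) = d *s Tb k 2 + Tb (Suc k) 2" "u (Tb k 3) = d *s Tb k 3 + Tb (Suc k) 3" for k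
    unfolding Tb_def by (simp_all add: uT del: power_Suc)
  \<comment> \<open>On even powers \<open>w\<close> acts on \<open>z 0\<close>, \<open>z 2\<close>
    by the companion matrix of p. The values on \<open>z 1\<close>, \<open>z 3\<close>, including
    their terms with one more T, are then dictated by selfadjointness, and the values on odd powers
    by the relation for w T.\<close>
  define g where "g = (\<lambda>k j::nat.
    if j = 0 then if even k then Tb k 2 else \<kappa> *s Tb k 0 + Tb (Suc k) 0 - Tb k 2
    else if j = 1 then if even k then Tb (Suc k) (Suc 0) - \<alpha> *s Tb k 3 else \<kappa> *s Tb k (Suc 0) + \<alpha> *s Tb k 3
    else if j = 2 then if even k then \<kappa> *s Tb k 2 - \<alpha> *s Tb k 0 else \<alpha> *s Tb k 0 + Tb (Suc k) 2
    else if even k then Tb k (Suc 0) + \<kappa> *s Tb k 3 + Tb (Suc k) 3 else - Tb k (Suc 0))"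
  \<comment> \<open>Oddness of \<open>n\<close> enters here: the form couples T^k with T^(n-1-k),
    two powers of equal parity, so the two sets of formulas fit together.\<close>
  have parity: "even k \<noteq> even k' \<Longrightarrow> Suc (k + k') \<noteq> n" "even k \<noteq> even k' \<Longrightarrow> Suc (k' + k) \<noteq> n"
    "even k = even k' \<Longrightarrow> Suc (Suc (k + k')) \<noteq> n" "even k = even k' \<Longrightarrow> Suc (Suc (k' + k)) \<noteq> n" for k k'
    using \<open>odd n\<close> by (metis even_Suc even_add)+
  obtain w where w: "linear_on_V w" "\<And>x. x \<in> V \<Longrightarrow> b x (w x) = 0" "\<And>k j. j < 4 \<Longrightarrow> w (Tb k j) = g k j"
  proof (rule Tb_extension[of g])
    fix k j k' j' :: nat assume j: "j < 4" and j': "j' < 4"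
    show "g k j \<in> V" by (simp add: g_def)
    show "g k j = 0" if "n \<le> k" using that by (simp add: g_def Tb_zero)
    show "b (Tb k j) (g k j) = 0"
      by (rule less_4_cases[OF j]) (simp_all add: g_def b_lin Tb_gram)
    show "b (Tb k j) (g k' j') + b (Tb k' j') (g k j) = 0"
      by (cases "even k"; cases "even k'"; rule less_4_cases[OF j]; rule less_4_cases[OF j'])
        (simp_all add: g_def b_lin Tb_gram parity add.commute[of k' k])
  qed blast
  interpret w: endo_space "(*s)" V w using w(1) by (rule linear_on_V_endo)
  have wT: "w (Tb k 0) = (if even k then Tb k 2 else \<kappa> *s Tb k 0 + Tb (Suc k) 0 - Tb k 2)"
    "w (Tb k (Suc 0)) = (if even k then Tb (Suc k) (Suc 0) - \<alpha> *s Tb k 3 else \<kappa> *s Tb k (Suc 0) + \<alpha> *s Tb k 3)"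
    "w (Tb k 2) = (if even k then \<kappa> *s Tb k 2 - \<alpha> *s Tb k 0 else \<alpha> *s Tb k 0 + Tb (Suc k) 2)"
    "w (Tb k 3) = (if even k then Tb k (Suc 0) + \<kappa> *s Tb k 3 + Tb (Suc k) 3 else - Tb k (Suc 0))" for k
    using w(3)[of _ k] by (simp_all add: g_def)
  have sc: "(\<kappa> - \<mu>) *s v = d *s v + d *s v" "\<mu> *s v = \<kappa> *s v - (d *s v + d *s v)"
    "(\<beta> - \<alpha>) *s v = (d * d) *s v - (d * \<kappa>) *s v" for v
    by (simp_all add: \<mu> \<beta> scale_left_diff_distrib flip: scale_left_distrib)
  show ?thesis
  proof (rule differenceI[OF w(1,2)])
    fix v assume v: "v \<in> V"
    show "w (w v) = \<kappa> *s w v - \<alpha> *s v"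
    proof (rule Tb_agree[OF _ _ _ v])
      fix k j :: nat assume "j < 4"
      then show "w (w (Tb k j)) = \<kappa> *s w (Tb k j) - \<alpha> *s Tb k j"
        by (cases "even k"; rule less_4_cases)
          (simp_all add: wT w.u_add w.u_diff w.u_scale w.u_neg algebra_simps)
    qed (intro linear_on_V_intros linear_on_V_comp[OF w(1)])+
    show "w (u v) + u (w v) = (\<kappa> - \<mu>) *s w v + (u (u v) + (\<mu> *s u v + (\<beta> - \<alpha>) *s v))"
    proof (rule Tb_agree[OF _ _ _ v])
      fix k j :: nat assume "j < 4"
      then show "w (u (Tb k j)) + u (w (Tb k j)) =
          (\<kappa> - \<mu>) *s w (Tb k j) + (u (u (Tb k j)) + (\<mu> *s u (Tb k j) + (\<beta> - \<alpha>) *s Tb k j))"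
        unfolding sc by (cases "even k"; rule less_4_cases)
          (simp_all add: wT uT w.u_add w.u_diff w.u_scale w.u_neg u_add u_diff u_scale u_neg algebra_simps)
    qed (intro linear_on_V_intros linear_on_V_comp[OF w(1)])+
  qed
qed

text \<open>The image of \<open>(u - d)^(2k)\<close> carries the symplectic form \<open>(R x, R y) \<mapsto> b (x, R y)\<close> for
  \<open>R = (u - d)^(2k)\<close>, and \<open>u\<^sub>1\<close> acts on it as an alternating root of \<open>p\<close>.\<close>

lemma four_dvd_dim_image:
  assumes diff: "symplectic_difference [:\<alpha>, - \<kappa>, 1:] [:\<beta>, - \<mu>, 1:] (pair V)"
    and irr: "Factorial_Ring.irreducible [:\<alpha>, - \<kappa>, 1:]"
    and \<mu>: "\<mu> = \<kappa> - (d + d)" and \<beta>: "\<beta> = \<alpha> - d * \<kappa> + d * d"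
  shows "4 dvd dim ((\<lambda>x. [:- d, 1:] ^ (2 * k) \<diamondop> x) ` V)"
proof -
  obtain w where w: "linear_on_V w" "\<And>x. x \<in> V \<Longrightarrow> b x (w x) = 0"
    "\<And>x. x \<in> V \<Longrightarrow> w (w x) = \<kappa> *s w x - \<alpha> *s x"
    "\<And>x. x \<in> V \<Longrightarrow>
      w (u x) + u (w x) = (\<kappa> - \<mu>) *s w x + (u (u x) + (\<mu> *s u x + (\<beta> - \<alpha>) *s x))"
    using differenceD[OF diff] by metis
  interpret w: endo_space "(*s)" V w using w(1) by (rule linear_on_V_endo)
  define T where "T = [:- d, 1:]"
  have T: "T \<diamondop> x = u x - d *s x" if "x \<in> V" for x
    using act_lin[OF that, of "- d"] by (simp add: T_def algebra_simps)
  have sc: "(\<kappa> - \<mu>) *s v = d *s v + d *s v" "\<mu> *s v = \<kappa> *s v - (d *s v + d *s v)"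
    "(\<beta> - \<alpha>) *s v = (d * d) *s v - (d * \<kappa>) *s v" for v
    by (simp_all add: \<mu> \<beta> scale_left_diff_distrib flip: scale_left_distrib)
  \<comment> \<open>This is the linear relation rewritten as w T + T w = \<kappa> T + T^2. Applied
    twice, all terms but T^2 w cancel, so \<open>w\<close> commutes with even powers of T.\<close>
  have wT: "w (T \<diamondop> x) = \<kappa> *s T \<diamondop> x + T \<diamondop> T \<diamondop> x - T \<diamondop> w x" if "x \<in> V" for x
  proof -
    have "w (u x) = (\<kappa> - \<mu>) *s w x + (u (u x) + (\<mu> *s u x + (\<beta> - \<alpha>) *s x)) - u (w x)"
      using w(4)[OF that] by (metis add_diff_cancel_right')
    then show ?thesis unfolding sc using that by (simp add: T w.u_diff w.u_scale u_diff u_scale algebra_simps)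
  qed
  have wTT: "w (T \<diamondop> T \<diamondop> x) = T \<diamondop> T \<diamondop> w x" if "x \<in> V" for x
    using that by (simp add: wT act_vadd act_vdiff act_vscale algebra_simps)
  have wR: "w (T ^ (2 * j) \<diamondop> x) = T ^ (2 * j) \<diamondop> w x" if "x \<in> V" for j x
    using that
  proof (induction j arbitrary: x)
    case (Suc j)
    have "T ^ (2 * Suc j) = T ^ (2 * j) * (T * T)" by (simp add: mult_ac)
    then have "T ^ (2 * Suc j) \<diamondop> y = T ^ (2 * j) \<diamondop> T \<diamondop> T \<diamondop> y" if "y \<in> V" for y
      using that by (simp only: act_mult act_in)
    then show ?case using Suc by (simp add: wTT del: power_Suc)
  qed simp
  define R where "R = T ^ (2 * k)"
  \<comment> \<open>Half of R = T^(2k), namely T^k, is moved across the form. For even k this half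
    commutes with \<open>w\<close>. For odd k one T is left over on each side, and T (w y) is
    rewritten into \<kappa> T y + T^2 y - w (T y), whose terms all pair to zero with T y.\<close>
  have alt: "b x (R \<diamondop> w x) = 0" if x: "x \<in> V" for x
  proof (cases "even k")
    case True
    then obtain j where "2 * k = 2 * j + 2 * j" by (metis evenE mult_2)
    then have "b x (R \<diamondop> w x) = b (T ^ (2 * j) \<diamondop> x) (T ^ (2 * j) \<diamondop> w x)"
      using x by (simp only: R_def power_add act_mult b_act act_in w.u_in)
    then show ?thesis using x w(2) by (simp flip: wR)
  next
    case False
    then obtain j where "2 * k = 2 * j + (1 + (1 + 2 * j))" by (metis oddE mult_2 add.commute add.assoc)
    then have "b x (R \<diamondop> w x) = b (T \<diamondop> T ^ (2 * j) \<diamondop> x) (T \<diamondop> T ^ (2 * j) \<diamondop> w x)"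
      using x by (simp only: R_def power_add act_mult b_act act_in w.u_in power_one_right)
    also have "\<dots> = b (T \<diamondop> T ^ (2 * j) \<diamondop> x) (T \<diamondop> w (T ^ (2 * j) \<diamondop> x))" using x by (simp add: wR)
    also have "\<dots> = 0"
    proof -
      define y where "y = T ^ (2 * j) \<diamondop> x"
      have y: "y \<in> V" using x by (simp add: y_def)
      have "T \<diamondop> w y = \<kappa> *s T \<diamondop> y + T \<diamondop> T \<diamondop> y - w (T \<diamondop> y)" using wT[OF y] by (simp add: algebra_simps)
      then show ?thesis unfolding y_def[symmetric] using y by (simp add: b_lin w)
    qed
    finally show ?thesis .
  qed
  define I where "I = (\<lambda>x. R \<diamondop> x) ` V"
  \<comment> \<open>A chosen preimage under R. As R is selfadjoint, b(pre s, Y) is independent of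
    the choice for Y in the image.\<close>
  define pre where "pre = (\<lambda>s. SOME x. x \<in> V \<and> R \<diamondop> x = s)"
  have pre: "pre s \<in> V" "R \<diamondop> pre s = s" if s: "s \<in> I" for s
  proof -
    have "\<exists>x. x \<in> V \<and> R \<diamondop> x = s" using s unfolding I_def by blast
    from someI_ex[OF this] show "pre s \<in> V" "R \<diamondop> pre s = s" by (simp_all add: pre_def)
  qed
  define b' where "b' = (\<lambda>s Y. b (pre s) Y)"
  have IV: "I \<subseteq> V" unfolding I_def by auto
  have b': "b' (R \<diamondop> x) Y = b x Y" if "x \<in> V" "Y \<in> I" for x Y
  proof -
    obtain y where y: "y \<in> V" "Y = R \<diamondop> y" using \<open>Y \<in> I\<close> unfolding I_def by blast
    have *: "R \<diamondop> x \<in> I" using \<open>x \<in> V\<close> unfolding I_def by blast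
    have "b' (R \<diamondop> x) Y = b (R \<diamondop> pre (R \<diamondop> x)) y" unfolding b'_def y(2) using y(1) pre(1)[OF *] by (intro b_act[symmetric])
    also have "\<dots> = b x Y" unfolding pre(2)[OF *] y(2) using \<open>x \<in> V\<close> y(1) by (rule b_act)
    finally show ?thesis .
  qed
  have subI: "subspace I" unfolding I_def by (rule subspace_act_image[OF subspace_V]) simp
  have wI: "w (R \<diamondop> x) = R \<diamondop> w x" if "x \<in> V" for x using wR that by (simp add: R_def)
  have sI: "sympl (*s) I w b'"
  proof unfold_locales
    show "subspace I" by (rule subI)
    show "finitely_spanned I" using finitely_spanned_subset[OF fin_V IV] .
    show "w s \<in> I" if "s \<in> I" for s using that wI unfolding I_def by auto
    show "w (s + Y) = w s + w Y" if "s \<in> I" "Y \<in> I" for s Y using that IV by (auto intro: w.u_add)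
    show "w (c *s s) = c *s w s" if "s \<in> I" for c s using that IV by (auto intro: w.u_scale)
    show "b' s (Y + Z) = b' s Y + b' s Z" if "s \<in> I" "Y \<in> I" "Z \<in> I" for s Y Z
      using that IV pre by (auto simp: b'_def b_add_right subset_iff)
    show "b' s (c *s Y) = c * b' s Y" if "s \<in> I" "Y \<in> I" for c s Y
      using that IV pre by (auto simp: b'_def b_scale_right subset_iff)
    show "b' (s + Y) Z = b' s Z + b' Y Z" if XYZ: "s \<in> I" "Y \<in> I" "Z \<in> I" for s Y Z
    proof -
      have "s + Y = R \<diamondop> (pre s + pre Y)" using pre XYZ by (simp add: act_vadd)
      then show ?thesis using b'[of "pre s + pre Y" Z] pre XYZ IV by (auto simp: b'_def b_add_left subset_iff)
    qed
    show "b' (c *s s) Y = c * b' s Y" if XY: "s \<in> I" "Y \<in> I" for c s Y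
    proof -
      have "c *s s = R \<diamondop> (c *s pre s)" using pre XY by (simp add: act_vscale)
      then show ?thesis using b'[of "c *s pre s" Y] pre XY IV by (auto simp: b'_def b_scale_left subset_iff)
    qed
    show "b' s s = 0" if s: "s \<in> I" for s
    proof -
      have "b' s s = b (pre s) (R \<diamondop> pre s)" unfolding b'_def using pre(2)[OF s] by simp
      then show ?thesis using pre(1)[OF s] by simp
    qed
    show "b' s (w s) = 0" if s: "s \<in> I" for s
    proof -
      have "w s = R \<diamondop> w (pre s)" using wI[of "pre s"] pre[OF s] by simp
      then have "b' s (w s) = b (pre s) (R \<diamondop> w (pre s))" unfolding b'_def by simp
      then show ?thesis using pre(1)[OF s] alt by simp
    qed
    show "s = 0" if s: "s \<in> I" and 0: "\<And>Y. Y \<in> I \<Longrightarrow> b' s Y = 0" for s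
    proof (rule nondeg)
      show "s \<in> V" using s IV by blast
      fix y assume y: "y \<in> V"
      have "b s y = b (R \<diamondop> pre s) y" using pre(2)[OF s] by simp
      also have "\<dots> = b' s (R \<diamondop> y)" unfolding b'_def using pre(1)[OF s] y by (simp add: b_act)
      also have "\<dots> = 0" using y by (intro 0) (simp add: I_def)
      finally show "b s y = 0" .
    qed
  qed
  have "4 dvd dim I"
  proof (rule four_dvd_dim[OF irr _ _ sI])
    show "act (*s) w [:\<alpha>, - \<kappa>, 1:] s = 0" if "s \<in> I" for s
    proof -
      have "s \<in> V" using that IV by blast
      then show ?thesis by (simp add: w.act_quad w(3))
    qed
  qed simp_all
  then show ?thesis by (simp add: I_def R_def T_def)
qed

end

section \<open>Splitting exceptional pairs\<close>

lemma exists_irreducible_divisor: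
  fixes f :: "'a::field poly"
  assumes "Polynomial.degree f > 0"
  obtains \<pi> where "Factorial_Ring.irreducible \<pi>" "\<pi> dvd f"
proof -
  let ?Q = "\<lambda>g. Polynomial.degree g > 0 \<and> g dvd f"
  obtain g where g: "?Q g" and min: "\<And>h. ?Q h \<Longrightarrow> Polynomial.degree g \<le> Polynomial.degree h"
    using ex_has_least_nat[of ?Q f Polynomial.degree] assms by auto
  have "Factorial_Ring.irreducible g"
  proof (rule irreducibleI)
    show "g \<noteq> 0" using g by auto
    show "\<not> g dvd 1" using g by (auto simp: is_unit_iff_degree)
    fix a c assume gac: "g = a * c"
    then have nz: "a \<noteq> 0" "c \<noteq> 0" using \<open>g \<noteq> 0\<close> by auto
    have deg: "Polynomial.degree g = Polynomial.degree a + Polynomial.degree c"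
      using gac nz by (simp add: degree_mult_eq)
    show "a dvd 1 \<or> c dvd 1"
    proof (rule ccontr)
      assume "\<not> (a dvd 1 \<or> c dvd 1)"
      then have pos: "Polynomial.degree a > 0" "Polynomial.degree c > 0" using nz by (auto simp: is_unit_iff_degree)
      have "a dvd f" using g gac by (metis dvd_mult_left)
      then show False using min[of a] pos deg by simp
    qed
  qed
  then show ?thesis using that g by blast
qed

lemma exists_power_decomposition:
  fixes f \<pi> :: "'a::field poly"
  assumes "f \<noteq> 0" "Polynomial.degree \<pi> > 0"
  shows "\<exists>n m. f = \<pi> ^ n * m \<and> \<not> \<pi> dvd m"
  using assms(1)
proof (induction "Polynomial.degree f" arbitrary: f rule: less_induct)
  case less
  show ?case
  proof (cases "\<pi> dvd f")
    case True
    then obtain g where g: "f = \<pi> * g" by blast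
    then have "g \<noteq> 0" "\<pi> \<noteq> 0" using less.prems by auto
    then have "Polynomial.degree g < Polynomial.degree f" using g assms(2) by (simp add: degree_mult_eq)
    from less.hyps[OF this \<open>g \<noteq> 0\<close>] obtain n m where "g = \<pi> ^ n * m" "\<not> \<pi> dvd m" by blast
    then show ?thesis using g by (intro exI[of _ "Suc n"] exI[of _ m]) (simp add: mult_ac)
  qed (intro exI[of _ 0] exI[of _ f], simp)
qed

lemma irreducible_linear: "Factorial_Ring.irreducible [:- d, 1:]" for d :: "'a::field"
  by (rule irreducible_linear_field_poly) simp


context sympl
begin

text \<open>Assembles the four-vector frame of the odd case from a cell and an equal cell in its
  orthogonal complement.\<close>

lemma frame_append:
  assumes z: "frame s 1 z" and z': "frame s 1 z'" "z' 0 \<in> perp (gen (2*1) z)" "z' 1 \<in> perp (gen (2*1) z)"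
  shows "frame s 2 (\<lambda>i. if i < 2 then z i else z' (i - 2))"
proof -
  let ?z = "\<lambda>i. if i < 2 then z i else z' (i - 2)"
  have in_V: "z i \<in> V" "z' i \<in> V" "s \<diamondop> z i = 0" "s \<diamondop> z' i = 0" if "i < 2" for i
    using frame_in[OF z] frame_in[OF z'(1)] frame_ann[OF z] frame_ann[OF z'(1)] that by simp_all
  have z'_perp: "z' i \<in> perp (gen (2*1) z)" if "i < 2" for i
    using that z'(2,3) by (cases "i = 0") (auto simp: less_Suc_eq numeral_2_eq_2)
  have cross: "b (z' i) (h \<diamondop> z l) = 0" "b (z l) (h \<diamondop> z' i) = 0" if "i < 2" "l < 2" for i l h
  proof -
    have "h \<diamondop> z l \<in> gen (2*1) z" using that by (intro act_base_gen) simp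
    then show *: "b (z' i) (h \<diamondop> z l) = 0" using z'_perp[OF that(1)] by (simp add: perp_def)
    have "b (z l) (h \<diamondop> z' i) = - b (z' i) (h \<diamondop> z l)"
      using in_V that b_act[of "z l" "z' i" h] b_swap[of "h \<diamondop> z l" "z' i"] by simp
    then show "b (z l) (h \<diamondop> z' i) = 0" using * by simp
  qed
  show ?thesis unfolding frame_def
  proof (intro conjI allI impI frame_s[OF z])
    fix i :: nat assume i: "i < 2 * 2"
    then show "?z i \<in> V" "s \<diamondop> ?z i = 0" using in_V by auto
    fix l h assume l: "l < 2 * (2::nat)"
    have shift: "std_gram (i - 2) (l - 2) = (std_gram i l :: 'a)" if "\<not> i < 2" "\<not> l < 2"
    proof -
      have "Suc (Suc (i - 2)) = i" "Suc (Suc (l - 2)) = l" using that by auto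
      moreover have "std_gram (Suc (Suc (i - 2))) (Suc (Suc (l - 2))) = (std_gram (i - 2) (l - 2) :: 'a)"
        by (simp add: std_gram_def)
      ultimately show ?thesis by simp
    qed
    have mixed: "std_gram i l = (0 :: 'a)" if "i < 2 \<longleftrightarrow> \<not> l < 2" 
      using that partner_less[of i 1] by (intro std_gram_eq_0) auto
    show "b (?z i) (h \<diamondop> ?z l) = std_gram i l * top_coeff s h"
    proof (cases "i < 2"; cases "l < 2")
      assume "i < 2" "l < 2"
      then show ?thesis using frame_gram[OF z, of i l h] by simp
    next
      assume il: "i < 2" "\<not> l < 2"
      then show ?thesis using cross(2)[of "l - 2" i h] mixed l by simp
    next
      assume il: "\<not> i < 2" "l < 2"
      then show ?thesis using cross(1)[of "i - 2" l h] mixed i by simp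
    next
      assume il: "\<not> i < 2" "\<not> l < 2"
      then show ?thesis using frame_gram[OF z'(1), of "i - 2" "l - 2" h] shift i l by simp
    qed
  qed
qed

text \<open>The two solutions are added. As they satisfy the same polynomial conditions on
  \<open>W\<close> and on \<open>R\<close>, and the cross terms of the form vanish in both orders,
  \<open>differenceI\<close> applies to the sum.\<close>

lemma difference_of_orthogonal_sum:
  assumes W: "sympl (*s) W u b" "W \<subseteq> V" and R: "sympl (*s) R u b" "R \<subseteq> V"
    and inter: "W \<inter> R = {0}" and sum: "\<And>x. x \<in> V \<Longrightarrow> \<exists>w\<in>W. \<exists>r\<in>R. x = w + r"
    and orth: "\<And>w r. w \<in> W \<Longrightarrow> r \<in> R \<Longrightarrow> b w r = 0"
    and diff: "symplectic_difference [:\<alpha>, - \<kappa>, 1:] [:\<beta>, - \<mu>, 1:] (pair W)"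
      "symplectic_difference [:\<alpha>, - \<kappa>, 1:] [:\<beta>, - \<mu>, 1:] (pair R)"
  shows "symplectic_difference [:\<alpha>, - \<kappa>, 1:] [:\<beta>, - \<mu>, 1:] (pair V)"
proof -
  interpret W: sympl "(*s)" W u b by (rule W)
  interpret R: sympl "(*s)" R u b by (rule R)
  obtain f where f: "W.linear_on_V f" "\<And>x. x \<in> W \<Longrightarrow> b x (f x) = 0"
    "\<And>x. x \<in> W \<Longrightarrow> f (f x) = \<kappa> *s f x - \<alpha> *s x"
    "\<And>x. x \<in> W \<Longrightarrow>
      f (u x) + u (f x) = (\<kappa> - \<mu>) *s f x + (u (u x) + (\<mu> *s u x + (\<beta> - \<alpha>) *s x))"
    using W.differenceD[OF diff(1)] by metis
  obtain g where g: "R.linear_on_V g" "\<And>x. x \<in> R \<Longrightarrow> b x (g x) = 0"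
    "\<And>x. x \<in> R \<Longrightarrow> g (g x) = \<kappa> *s g x - \<alpha> *s x"
    "\<And>x. x \<in> R \<Longrightarrow>
      g (u x) + u (g x) = (\<kappa> - \<mu>) *s g x + (u (u x) + (\<mu> *s u x + (\<beta> - \<alpha>) *s x))"
    using R.differenceD[OF diff(2)] by metis
  interpret f: endo_space "(*s)" W f using f(1) by (rule W.linear_on_V_endo)
  interpret g: endo_space "(*s)" R g using g(1) by (rule R.linear_on_V_endo)
  have "\<forall>x\<in>V. \<exists>w r. w \<in> W \<and> r \<in> R \<and> x = w + r" using sum by blast
  then obtain pw pr where pr: "\<And>x. x \<in> V \<Longrightarrow> pw x \<in> W \<and> pr x \<in> R \<and> x = pw x + pr x" by metis
  have uniq: "w = w' \<and> r = r'" if "w + r = w' + r'" "w \<in> W" "w' \<in> W" "r \<in> R" "r' \<in> R" for w w' r r'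
  proof -
    have "w - w' = r' - r" using that(1) by (metis add.commute add_diff_cancel_left' add_diff_eq diff_diff_eq2)
    then have "w - w' \<in> W \<inter> R" using that W.V_diff[of w w'] R.V_diff[of r' r] by simp
    then show ?thesis using inter \<open>w - w' = r' - r\<close> by auto
  qed
  define v where "v = (\<lambda>x. f (pw x) + g (pr x))"
  have v: "v (w + r) = f w + g r" if "w \<in> W" "r \<in> R" for w r
  proof -
    have "w + r \<in> V" using that W(2) R(2) by (intro V_add) auto
    then have "w = pw (w + r) \<and> r = pr (w + r)" using pr[of "w + r"] that by (intro uniq) auto
    then show ?thesis unfolding v_def by simp
  qed
  have in_V: "x \<in> W \<Longrightarrow> x \<in> V" "x \<in> R \<Longrightarrow> x \<in> V" for x using W(2) R(2) by auto
  have *: "\<exists>w r. w \<in> W \<and> r \<in> R \<and> x = w + r" if "x \<in> V" for x using pr[OF that] by blast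
  show ?thesis
  proof (rule differenceI)
    show "linear_on_V v" unfolding linear_on_V_def
    proof (intro conjI ballI allI)
      fix x assume "x \<in> V"
      then obtain w r where x: "w \<in> W" "r \<in> R" "x = w + r" using * by blast
      then show "v x \<in> V" by (simp add: v in_V)
      show "v (c *s x) = c *s v x" for c
        using v[of "c *s w" "c *s r"] x by (simp add: v scale_right_distrib f.u_scale g.u_scale)
      fix y assume "y \<in> V"
      then obtain w' r' where y: "w' \<in> W" "r' \<in> R" "y = w' + r'" using * by blast
      have "x + y = (w + w') + (r + r')" using x y by (simp add: algebra_simps)
      moreover have "v x = f w + g r" "v y = f w' + g r'" using x y v by simp_all
      ultimately show "v (x + y) = v x + v y"
        using x(1,2) y(1,2) v[of "w + w'" "r + r'"] by (simp add: f.u_add g.u_add)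
    qed
    fix x assume "x \<in> V"
    then obtain w r where x: "w \<in> W" "r \<in> R" "x = w + r" using * by blast
    have "b r (f w) = 0" using orth[of "f w" r] x b_swap[of r "f w"] by (simp add: in_V)
    then show "b x (v x) = 0" using x f(2) g(2) orth[of w "g r"] by (simp add: v b_add_left b_add_right in_V)
    have vx: "v x = f w + g r" using x by (simp add: v)
    have "v (v x) = f (f w) + g (g r)" using x by (simp add: vx v)
    also have "\<dots> = \<kappa> *s v x - \<alpha> *s x"
      unfolding vx f(3)[OF x(1)] g(3)[OF x(2)] unfolding x(3) by (simp add: algebra_simps)
    finally show "v (v x) = \<kappa> *s v x - \<alpha> *s x" .
    have "v (u x) = f (u w) + g (u r)" using x by (simp add: u_add in_V v)
    moreover have "u (v x) = u (f w) + u (g r)" using x by (simp add: v u_add in_V)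
    ultimately have "v (u x) + u (v x) = (f (u w) + u (f w)) + (g (u r) + u (g r))"
      by (simp add: algebra_simps)
    also have "\<dots> = (\<kappa> - \<mu>) *s v x + (u (u x) + (\<mu> *s u x + (\<beta> - \<alpha>) *s x))"
      unfolding f(4)[OF x(1)] g(4)[OF x(2)] vx unfolding x(3)
      using x(1,2) by (simp add: u_add in_V algebra_simps)
    finally show "v (u x) + u (v x) = (\<kappa> - \<mu>) *s v x + (u (u x) + (\<mu> *s u x + (\<beta> - \<alpha>) *s x))" .
  qed
qed

end


section \<open>Which sums of cells are differences\<close>

locale difference_data =
  fixes \<alpha> \<kappa> \<beta> \<mu> :: "'a::field" and C D :: "'a set"
  assumes irr_p: "Factorial_Ring.irreducible [:\<alpha>, - \<kappa>, 1:]"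
    and C_irr: "c \<in> C \<Longrightarrow> Factorial_Ring.irreducible [:c, - (\<kappa> - \<mu>), 1:]"
    and D: "d \<in> D \<Longrightarrow> \<mu> = \<kappa> - (d + d)" "d \<in> D \<Longrightarrow> \<beta> = \<alpha> - d * \<kappa> + d * d"
begin

abbreviation pol_p :: "'a poly" where "pol_p \<equiv> [:\<alpha>, - \<kappa>, 1:]"
abbreviation pol_q :: "'a poly" where "pol_q \<equiv> [:\<beta>, - \<mu>, 1:]"

text \<open>\<open>k\<close> is the number of companion blocks of \<open>s\<close> in the model
  matrix, so the cell is generated by a frame of 2 k vectors.\<close>

definition model_type :: "'a poly \<Rightarrow> nat \<Rightarrow> bool" where
  "model_type s k \<longleftrightarrow>
     (k = 1 \<and> (\<exists>c\<in>C. \<exists>n>0. s = [:c, - (\<kappa> - \<mu>), 1:] ^ n)) \<or>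
     (k = 2 \<and> (\<exists>d\<in>D. \<exists>n. odd n \<and> s = [:- d, 1:] ^ n)) \<or>
     (k = 1 \<and> (\<exists>d\<in>D. \<exists>n>0. even n \<and> s = [:- d, 1:] ^ n))"

text \<open>The eigenvalue condition expressed over F: an irreducible polynomial with a nonzero
  kernel is, up to a unit, one of the listed ones. In this form the condition visibly passes to
  subspaces.\<close>

definition exceptional_on :: "('a \<Rightarrow> 'v::ab_group_add \<Rightarrow> 'v) \<Rightarrow> 'v set \<Rightarrow> ('v \<Rightarrow> 'v) \<Rightarrow> bool" where
  "exceptional_on sc V u \<longleftrightarrow>
     (\<forall>\<pi>. \<forall>z\<in>V. Factorial_Ring.irreducible \<pi> \<longrightarrow> z \<noteq> 0 \<longrightarrow> act sc u \<pi> z = 0 \<longrightarrow>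
        (\<exists>c\<in>C. [:c, - (\<kappa> - \<mu>), 1:] dvd \<pi>) \<or> (\<exists>d\<in>D. [:- d, 1:] dvd \<pi>))"

text \<open>The obstruction to being a difference. Unlike u_1 it passes to complements of cells, and
  by \<open>difference_of_exceptional\<close> it is the only obstruction for exceptional
  pairs.\<close>

definition even_ranks :: "('a \<Rightarrow> 'v::ab_group_add \<Rightarrow> 'v) \<Rightarrow> 'v set \<Rightarrow> ('v \<Rightarrow> 'v) \<Rightarrow> bool" where
  "even_ranks sc V u \<longleftrightarrow>
     (\<forall>d\<in>D. \<forall>k. 4 dvd vector_space.dim sc ((\<lambda>x. act sc u ([:- d, 1:] ^ (2 * k)) x) ` V))"

lemma exceptional_on_subset: "exceptional_on sc V u \<Longrightarrow> W \<subseteq> V \<Longrightarrow> exceptional_on sc W u"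
  unfolding exceptional_on_def by blast

lemma even_ranks_of_difference:
  assumes "sympl sc V u b" "symplectic_difference pol_p pol_q \<lparr>vectors = V, scale = sc, form = b, endo = u\<rparr>"
  shows "even_ranks sc V u"
proof -
  interpret sympl sc V u b by fact
  show ?thesis unfolding even_ranks_def using four_dvd_dim_image[OF assms(2) irr_p D] by blast
qed

lemma model_frame_difference:
  assumes "sympl sc V u b" "sympl.frame sc V u b s k z" "endo_space.gen sc u (2*k) z = V" "model_type s k"
  shows "symplectic_difference pol_p pol_q \<lparr>vectors = V, scale = sc, form = b, endo = u\<rparr>"
proof -
  interpret sympl sc V u b by fact
  from assms(4) show ?thesis
    unfolding model_type_def
  proof (elim disjE conjE bexE exE)
    fix c n assume "k = 1" "s = [:c, - (\<kappa> - \<mu>), 1:] ^ n"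
    then show ?thesis using difference_of_quadratic_power_frame[of c \<kappa> \<mu> n z \<alpha> \<beta>] assms(2,3) by simp
  next
    fix d n assume "k = 2" "d \<in> D" "odd n" "s = [:- d, 1:] ^ n"
    then show ?thesis
      using difference_of_odd_power_frame[of d n z \<mu> \<kappa> \<beta> \<alpha>] D[OF \<open>d \<in> D\<close>] assms(2,3) by simp
  next
    fix d n assume d: "k = 1" "d \<in> D" "even n" "s = [:- d, 1:] ^ n"
    obtain m where m: "n = 2 * m" using d(3) by (rule evenE)
    \<comment> \<open>Since \<kappa> - \<mu> = 2 d, an even power of t - d is a power of a quadratic
      with the required trace.\<close>
    have "[:- d, 1:] ^ 2 = [:d * d, - (\<kappa> - \<mu>), 1:]" using D(1)[OF d(2)] by (simp add: power2_eq_square)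
    then have "s = [:d * d, - (\<kappa> - \<mu>), 1:] ^ m" unfolding d(4) m by (simp only: power_mult)
    then show ?thesis
      using difference_of_quadratic_power_frame[of "d * d" \<kappa> \<mu> m z \<alpha> \<beta>] assms(2,3) d(1) by simp
  qed
qed

text \<open>An irreducible factor of the minimal polynomial has a nonzero kernel, so it is of the
  listed form, and its exact power yields a cell. If the factor is t - d and the power n + 1 is odd,
  the ranks force a second equal cell: otherwise the ranks of (u - d)^n and (u - d)^(n+2) would
  differ by 2, although 4 divides both.\<close>

lemma exists_model_frame:
  assumes V: "sympl sc V u b" and ranks: "even_ranks sc V u" and exc: "exceptional_on sc V u" and "V \<noteq> {0}"
  shows "\<exists>s k z. sympl.frame sc V u b s k z \<and> model_type s k"
proof -
  interpret sympl sc V u b by (rule V)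
  obtain f where f: "f \<noteq> 0" "\<And>z. z \<in> V \<Longrightarrow> f \<diamondop> z = 0"
    and min: "\<And>g. g \<noteq> 0 \<Longrightarrow> Polynomial.degree g < Polynomial.degree f \<Longrightarrow> \<exists>z\<in>V. g \<diamondop> z \<noteq> 0"
    by (rule exists_minimal_annihilator[OF fin_V]) (rule that)
  have "Polynomial.degree f > 0"
  proof (rule ccontr)
    assume "\<not> Polynomial.degree f > 0"
    then obtain c where "f = [:c:]" "c \<noteq> 0" using f(1) by (metis degree_eq_zeroE gr0I pCons_eq_0_iff)
    then have "V \<subseteq> {0}" using f(2) by auto
    then show False using \<open>V \<noteq> {0}\<close> V_0 by blast
  qed
  then obtain \<pi>' where \<pi>': "Factorial_Ring.irreducible \<pi>'" "\<pi>' dvd f" by (rule exists_irreducible_divisor)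
  then obtain g where g: "f = \<pi>' * g" by blast
  have "\<pi>' \<noteq> 0" using \<pi>'(1) by auto
  have "g \<noteq> 0" using g f(1) by auto
  have "Polynomial.degree \<pi>' > 0" using \<pi>'(1) \<open>\<pi>' \<noteq> 0\<close> by (auto simp: irreducible_def is_unit_iff_degree)
  then have "Polynomial.degree g < Polynomial.degree f"
    using g \<open>g \<noteq> 0\<close> \<open>\<pi>' \<noteq> 0\<close> by (simp add: degree_mult_eq)
  \<comment> \<open>By minimality the cofactor \<open>g\<close> does not kill \<open>V\<close>, and
    any nonzero value of g(u) is a kernel vector for the irreducible factor.\<close>
  then obtain z0 where z0: "z0 \<in> V" "g \<diamondop> z0 \<noteq> 0" using min \<open>g \<noteq> 0\<close> by blast
  have "\<pi>' \<diamondop> g \<diamondop> z0 = 0" using f(2)[OF z0(1)] z0(1) unfolding g by (simp add: act_mult)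
  then have "(\<exists>c\<in>C. [:c, - (\<kappa> - \<mu>), 1:] dvd \<pi>') \<or> (\<exists>d\<in>D. [:- d, 1:] dvd \<pi>')"
    using exc \<pi>'(1) z0 unfolding exceptional_on_def by (meson act_in)
  then obtain \<pi> where \<pi>_cases: "(\<exists>c\<in>C. \<pi> = [:c, - (\<kappa> - \<mu>), 1:]) \<or> (\<exists>d\<in>D. \<pi> = [:- d, 1:])" and "\<pi> dvd \<pi>'"
    by blast
  then have \<pi>: "Factorial_Ring.irreducible \<pi>" "Polynomial.lead_coeff \<pi> = 1" "Polynomial.degree \<pi> > 0"
    using C_irr irreducible_linear by auto
  have "\<pi> dvd f" using \<open>\<pi> dvd \<pi>'\<close> \<pi>'(2) dvd_trans by blast
  obtain n' m where n': "f = \<pi> ^ n' * m" "\<not> \<pi> dvd m" using exists_power_decomposition[OF f(1) \<pi>(3)] by blast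
  have "n' \<noteq> 0"
  proof
    assume "n' = 0"
    then show False using n' \<open>\<pi> dvd f\<close> by simp
  qed
  then obtain n where n: "n' = Suc n" using not0_implies_Suc by blast
  have nz: "\<pi> \<noteq> 0" "m \<noteq> 0" using f(1) n'(1) n by auto
  have "\<exists>x0\<in>V. (\<pi> ^ n * m) \<diamondop> x0 \<noteq> 0"
  proof (rule min)
    show "\<pi> ^ n * m \<noteq> 0" using nz by simp
    show "Polynomial.degree (\<pi> ^ n * m) < Polynomial.degree f"
      unfolding n'(1) n using nz \<pi>(3) by (simp add: degree_mult_eq)
  qed
  then obtain x0 where x0: "x0 \<in> V" "(\<pi> ^ n * m) \<diamondop> x0 \<noteq> 0" by blast
  have ann: "(\<pi> ^ Suc n * m) \<diamondop> z = 0" if "z \<in> V" for z using f(2)[OF that] n'(1) n by simp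
  obtain z where z: "frame (\<pi> ^ Suc n) 1 z" using exists_frame[OF \<pi>(1,2) n'(2) ann x0] by blast
  show ?thesis
  proof (cases "\<exists>d\<in>D. \<pi> = [:- d, 1:] \<and> odd (Suc n)")
    case False
    have "model_type (\<pi> ^ Suc n) 1"
    proof (cases "\<exists>d\<in>D. \<pi> = [:- d, 1:]")
      case True
      then obtain d where d: "d \<in> D" "\<pi> = [:- d, 1:]" by blast
      then have "even (Suc n)" using False by blast
      then show ?thesis unfolding model_type_def d(2)
        by (intro disjI2 conjI refl bexI[of _ d] exI[of _ "Suc n"] d(1)) simp_all
    next
      case False
      then obtain c where c: "c \<in> C" "\<pi> = [:c, - (\<kappa> - \<mu>), 1:]" using \<pi>_cases by blast
      then show ?thesis unfolding model_type_def c(2)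
        by (intro disjI1 conjI refl bexI[of _ c] exI[of _ "Suc n"] c(1)) simp_all
    qed
    then show ?thesis using z by blast
  next
    case True
    then obtain d where d: "d \<in> D" "\<pi> = [:- d, 1:]" and "odd (Suc n)" by blast
    obtain k where k: "n = 2 * k" using \<open>odd (Suc n)\<close> by auto
    let ?W = "gen (2*1) z" and ?R = "perp (gen (2*1) z)"
    note R = sympl_frame_perp[OF z]
    have RV: "r \<in> V" if "r \<in> ?R" for r using that by (simp add: perp_def)
    have subR: "subspace ?R" by (rule subspace_perp[OF frame_gen_subset[OF z]])
    have actR: "g \<diamondop> r \<in> ?R" if "r \<in> ?R" for g r
      by (rule act_in_stable[OF subR _ that]) (rule perp_stable[OF frame_gen_subset[OF z] u_frame_gen[OF z]])
    have "\<exists>r\<in>?R. (\<pi> ^ n * m) \<diamondop> r \<noteq> 0"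
    proof (rule ccontr)
      assume "\<not> (\<exists>r\<in>?R. (\<pi> ^ n * m) \<diamondop> r \<noteq> 0)"
      then have zero: "(\<pi> ^ n * m) \<diamondop> r = 0" if "r \<in> ?R" for r using that by blast
      \<comment> \<open>If \<pi>^n m kills the complement, inverting \<open>m\<close> modulo \<pi>^2
        shows that \<pi>^n and \<pi>^(n+2) have the same image there. The exponent 2 is taken
        because divisibility by 4 is known for even powers, and n is even.\<close>
      obtain m' l where m': "m * m' = 1 + \<pi> ^ 2 * l" using inverse_mod_irreducible_power[OF \<pi>(1) n'(2)] .
      have "(\<lambda>x. \<pi> ^ n \<diamondop> x) ` ?R = (\<lambda>x. \<pi> ^ (n + 2) \<diamondop> x) ` ?R"
      proof
        show "(\<lambda>x. \<pi> ^ n \<diamondop> x) ` ?R \<subseteq> (\<lambda>x. \<pi> ^ (n + 2) \<diamondop> x) ` ?R"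
        proof clarify
          fix r assume r: "r \<in> ?R"
          have "\<pi> ^ n = m' * (\<pi> ^ n * m) - \<pi> ^ (n + 2) * l"
          proof -
            have "m' * (\<pi> ^ n * m) = \<pi> ^ n * (m * m')" by (simp only: mult_ac)
            then show ?thesis unfolding m' by (simp add: algebra_simps power_add power2_eq_square)
          qed
          then have "\<pi> ^ n \<diamondop> r = m' \<diamondop> (\<pi> ^ n * m) \<diamondop> r - \<pi> ^ (n + 2) \<diamondop> l \<diamondop> r"
            using RV[OF r] by (metis act_diff act_mult)
          also have "\<dots> = \<pi> ^ (n + 2) \<diamondop> (- (l \<diamondop> r))" using RV[OF r] zero[OF r] by (simp add: act_vneg)
          finally show "\<pi> ^ n \<diamondop> r \<in> (\<lambda>x. \<pi> ^ (n + 2) \<diamondop> x) ` ?R" 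
            using actR[OF r] subspace_neg[OF subR] by blast
        qed
        show "(\<lambda>x. \<pi> ^ (n + 2) \<diamondop> x) ` ?R \<subseteq> (\<lambda>x. \<pi> ^ n \<diamondop> x) ` ?R"
        proof clarify
          fix r assume r: "r \<in> ?R"
          have "\<pi> ^ (n + 2) \<diamondop> r = \<pi> ^ n \<diamondop> \<pi> ^ 2 \<diamondop> r" using RV[OF r] by (simp only: power_add act_mult)
          then show "\<pi> ^ (n + 2) \<diamondop> r \<in> (\<lambda>x. \<pi> ^ n \<diamondop> x) ` ?R" using actR[OF r] by auto
        qed
      qed
      moreover have "(\<lambda>x. \<pi> ^ (n + 2) \<diamondop> x) ` ?W = {0}"
        using frame_gen_ann[OF z, of _ "\<pi> ^ (n + 2)"] subspace_0[OF subspace_frame_gen[OF z]]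
        by (auto simp: image_iff le_imp_power_dvd intro!: bexI[of _ 0])
      \<comment> \<open>On the cell itself \<pi>^n has rank 2 and \<pi>^(n+2) vanishes, which
        produces the contradiction modulo 4.\<close>
      moreover have "dim ((\<lambda>x. \<pi> ^ n \<diamondop> x) ` ?W) = 2"
      proof -
        have "Polynomial.degree (\<pi> ^ Suc n) - Polynomial.degree (\<pi> ^ n) = 1"
          using monic_degree_power(2)[OF \<pi>(2)] d(2) by (simp del: power_Suc)
        then show ?thesis using dim_image_frame_gen[OF z, of "\<pi> ^ n"] by simp
      qed
      ultimately have "dim ((\<lambda>x. \<pi> ^ n \<diamondop> x) ` V) = 2 + dim ((\<lambda>x. \<pi> ^ (n + 2) \<diamondop> x) ` V)"
        using dim_image_split[OF z, of "\<pi> ^ n"] dim_image_split[OF z, of "\<pi> ^ (n + 2)"]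
          dim_eq_0_iff[of "{0}"] finitely_spanned_subset[OF fin_V, of "{0}"] by simp
      moreover have "4 dvd dim ((\<lambda>x. \<pi> ^ (2 * j) \<diamondop> x) ` V)" for j
        using ranks d(1) unfolding even_ranks_def d(2) by blast
      from this[of k] this[of "Suc k"] have "4 dvd dim ((\<lambda>x. \<pi> ^ n \<diamondop> x) ` V)"
        "4 dvd dim ((\<lambda>x. \<pi> ^ (n + 2) \<diamondop> x) ` V)"
        unfolding k by (simp_all only: mult_Suc_right add.commute[of 2])
      moreover have False if "x = 2 + y" "4 dvd x" "4 dvd y" for x y :: nat using that by presburger
      ultimately show False by blast
    qed
    then obtain r where r: "r \<in> ?R" "(\<pi> ^ n * m) \<diamondop> r \<noteq> 0" by blast
    have "\<exists>z'. sympl.frame sc ?R u b (\<pi> ^ Suc n) 1 z'"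
      by (rule sympl.exists_frame[OF R \<pi>(1,2) n'(2) _ r]) (use ann RV in blast)
    then obtain z' where z': "sympl.frame sc ?R u b (\<pi> ^ Suc n) 1 z'" by blast
    have "?R \<subseteq> V" using RV by blast
    from frame_sub_iff[OF R this] z' have "frame (\<pi> ^ Suc n) 1 z'" "\<forall>i<2*1. z' i \<in> ?R" by blast+
    then have "frame (\<pi> ^ Suc n) 1 z'" "z' 0 \<in> ?R" "z' 1 \<in> ?R" by simp_all
    then have "frame (\<pi> ^ Suc n) 2 (\<lambda>i. if i < 2 then z i else z' (i - 2))"
      using frame_append[OF z] by blast
    moreover have "model_type (\<pi> ^ Suc n) 2" unfolding model_type_def d(2)
      by (rule disjI2, rule disjI1) (intro conjI refl bexI[of _ d] exI[of _ "Suc n"] d(1) \<open>odd (Suc n)\<close>)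
    ultimately show ?thesis by blast
  qed
qed

text \<open>The cell is a difference by explicit construction, hence its own ranks are divisible by
  4. Ranks add up, so subtraction gives the complement.\<close>

lemma even_ranks_perp:
  assumes V: "sympl sc V u b" and "even_ranks sc V u" and z: "sympl.frame sc V u b s k z" and "model_type s k"
  shows "symplectic_difference pol_p pol_q \<lparr>vectors = endo_space.gen sc u (2*k) z, scale = sc, form = b, endo = u\<rparr>"
    and "even_ranks sc (sympl.perp V b (endo_space.gen sc u (2*k) z)) u"
proof -
  interpret sympl sc V u b by (rule V)
  let ?W = "gen (2*k) z"
  interpret W: sympl sc ?W u b by (rule sympl_frame_gen[OF z])
  have "z i \<in> ?W" if "i < 2*k" for i using act_base_gen[OF that, of 1 z] by simp
  then have "W.frame s k z" using frame_sub_iff[OF W.sympl_axioms frame_gen_subset[OF z]] z by blast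
  then show diff: "symplectic_difference pol_p pol_q (pair ?W)"
    using model_frame_difference[OF W.sympl_axioms _ refl \<open>model_type s k\<close>] by blast
  then have "even_ranks sc ?W u" by (rule even_ranks_of_difference[OF W.sympl_axioms])
  then show "even_ranks sc (perp ?W) u"
    using \<open>even_ranks sc V u\<close> unfolding even_ranks_def dim_image_split[OF z] by (metis dvd_add_right_iff)
qed

text \<open>Model cells are peeled off by induction on the dimension and their solutions glued. This
  supplies what restriction of u_1 cannot: the complement of a cell is again a difference, so
  indecomposability can be applied to it.\<close>

lemma difference_of_exceptional:
  assumes "sympl sc V u b" "even_ranks sc V u" "exceptional_on sc V u"
  shows "symplectic_difference pol_p pol_q \<lparr>vectors = V, scale = sc, form = b, endo = u\<rparr>"
  using assms
proof (induction "vector_space.dim sc V" arbitrary: V rule: less_induct)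
  case less
  interpret sympl sc V u b by (rule less.prems(1))
  show ?case
  proof (cases "V = {0}")
    case True
    show ?thesis
      by (rule differenceI[OF linear_on_V_id]) (use True in auto)
  next
    case False
    then obtain s k z where z: "frame s k z" and ty: "model_type s k"
      using exists_model_frame[OF less.prems] by blast
    have k: "k > 0" using ty by (auto simp: model_type_def)
    note * = even_ranks_perp[OF less.prems(1,2) z ty]
    have perpV: "perp (gen (2*k) z) \<subseteq> V" by (auto simp: perp_def)
    have "symplectic_difference pol_p pol_q (pair (perp (gen (2*k) z)))"
    proof (rule less.hyps[OF _ sympl_frame_perp[OF z] *(2)])
      show "dim (perp (gen (2*k) z)) < dim V" using dim_split[OF z] k frame_s(2)[OF z] by simp
      show "exceptional_on sc (perp (gen (2*k) z)) u" by (rule exceptional_on_subset[OF less.prems(3) perpV])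
    qed
    then show ?thesis
    proof (rule difference_of_orthogonal_sum[OF sympl_frame_gen[OF z] frame_gen_subset[OF z]
          sympl_frame_perp[OF z] perpV frame_gen_perp_trivial[OF z] _ _ *(1), rotated -1])
      show "\<exists>w\<in>gen (2*k) z. \<exists>r\<in>perp (gen (2*k) z). x = w + r" if "x \<in> V" for x
        using frame_decomposition[OF z that] by metis
      show "b w r = 0" if "w \<in> gen (2*k) z" "r \<in> perp (gen (2*k) z)" for w r
        using that b_swap[of w r] frame_gen_subset[OF z] by (auto simp: perp_def)
    qed
  qed
qed

end

section \<open>Isometries and orthogonal sums\<close>

lemma linear_map_sum:
  assumes "linear_map V W f" "fd_space V" "fd_space W" "finite I" "\<And>i. i \<in> I \<Longrightarrow> g i \<in> vectors V"
  shows "f (sum g I) = (\<Sum>i\<in>I. f (g i))" "sum g I \<in> vectors V"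
proof -
  interpret V: vector_space "scale V" using assms(2) by (simp add: fd_space_def)
  interpret W: vector_space "scale W" using assms(3) by (simp add: fd_space_def)
  have V: "V.subspace (vectors V)" using assms(2) by (simp add: fd_space_def)
  have lin: "f (x + y) = f x + f y" if "x \<in> vectors V" "y \<in> vectors V" for x y
    using assms(1) that by (simp add: linear_map_def)
  have "f (scale V 0 0) = scale W 0 (f 0)" using assms(1) V.subspace_0[OF V] unfolding linear_map_def by blast
  then have "f 0 = 0" by simp
  show "sum g I \<in> vectors V" using V.subspace_sum[OF V] assms(5) by blast
  show "f (sum g I) = (\<Sum>i\<in>I. f (g i))" using assms(4,5)
  proof (induction I rule: finite_induct)
    case (insert i I)
    have "g i \<in> vectors V" "sum g I \<in> vectors V"
      using insert.prems V.subspace_sum[OF V, of I g] by auto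
    then have "f (g i + sum g I) = f (g i) + f (sum g I)" by (rule lin)
    then show ?case using insert by simp
  qed (simp add: \<open>f 0 = 0\<close>)
qed

text \<open>Endomorphisms are conjugated by the isometry, and the symplectic structure of
  \<open>Q\<close> is itself carried over from \<open>P\<close>.\<close>

lemma symplectic_difference_transfer:
  assumes P: "symplectic_difference p q P" and iso: "isometric P Q" and Q: "fd_space Q"
  shows "symplectic_difference p q Q"
proof -
  obtain u1 u2 where u: "alternating_endo P (form P) u1" "alternating_endo P (form P) u2"
    "\<And>x. x \<in> vectors P \<Longrightarrow> endo P x = u1 x - u2 x" "annihilates p P u1" "annihilates q P u2"
    using P unfolding symplectic_difference_def by blast
  have sP: "symplectic_pair P" using P by (simp add: symplectic_difference_def)
  then interpret P: sympl "scale P" "vectors P" "endo P" "form P" by (simp add: symplectic_pair_iff)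
  have fdP: "fd_space P" using sP by (simp add: symplectic_pair_def)
  interpret Q: vector_space "scale Q" using Q by (simp add: fd_space_def)
  have subQ: "Q.subspace (vectors Q)" using Q by (simp add: fd_space_def)
  obtain f where f: "linear_map P Q f" "bij_betw f (vectors P) (vectors Q)"
    "\<And>x y. x \<in> vectors P \<Longrightarrow> y \<in> vectors P \<Longrightarrow> form Q (f x) (f y) = form P x y"
    "\<And>x. x \<in> vectors P \<Longrightarrow> endo Q (f x) = f (endo P x)"
    using iso unfolding isometric_def linear_iso_def by blast
  define g where "g = inv_into (vectors P) f"
  have gf: "g (f x) = x" if "x \<in> vectors P" for x
    unfolding g_def using f(2) that by (simp add: bij_betw_def)
  have onto: "\<exists>x\<in>vectors P. y = f x" if "y \<in> vectors Q" for y using f(2) that by (auto simp: bij_betw_def)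
  have fin: "f x \<in> vectors Q" if "x \<in> vectors P" for x using f(1) that by (simp add: linear_map_def)
  have fadd: "f (x + y) = f x + f y" if "x \<in> vectors P" "y \<in> vectors P" for x y
    using f(1) that by (simp add: linear_map_def)
  have fscale: "f (scale P c x) = scale Q c (f x)" if "x \<in> vectors P" for c x
    using f(1) that by (simp add: linear_map_def)
  have fdiff: "f (x - y) = f x - f y" if "x \<in> vectors P" "y \<in> vectors P" for x y
    using fadd[of "x - y" y] that by simp
  have f0: "f 0 = 0" using fdiff[of 0 0] by simp
  have tr: "alternating_endo Q (form Q) (\<lambda>y. f (w (g y)))" if w: "alternating_endo P (form P) w" for w
  proof -
    have win: "w x \<in> vectors P" if "x \<in> vectors P" for x
      using w that by (simp add: alternating_endo_def linear_map_def)
    have wlin: "w (x + y) = w x + w y" "w (scale P c x) = scale P c (w x)"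
      if "x \<in> vectors P" "y \<in> vectors P" for c x y
      using w that by (simp_all add: alternating_endo_def linear_map_def)
    have walt: "form P x (w x) = 0" if "x \<in> vectors P" for x using w that by (simp add: alternating_endo_def)
    show ?thesis unfolding alternating_endo_def linear_map_def
    proof (intro conjI ballI allI)
      fix y assume "y \<in> vectors Q"
      then obtain x where x: "x \<in> vectors P" "y = f x" using onto by blast
      then show "f (w (g y)) \<in> vectors Q" "form Q y (f (w (g y))) = 0"
        by (simp_all add: gf win fin f(3) walt)
      show "f (w (g (scale Q c y))) = scale Q c (f (w (g y)))" for c
        using x gf[of "scale P c x"] wlin(2)[of x x c] by (simp add: gf win flip: fscale)
      fix y' assume "y' \<in> vectors Q"
      then obtain x' where x': "x' \<in> vectors P" "y' = f x'" using onto by blast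
      show "f (w (g (y + y'))) = f (w (g y)) + f (w (g y'))"
        using x x' gf[of "x + x'"] by (simp add: gf win wlin flip: fadd)
    qed
  qed
  have ann: "annihilates r Q (\<lambda>y. f (w (g y)))"
    if w: "alternating_endo P (form P) w" and r: "annihilates r P w" for w r
    unfolding annihilates_def
  proof
    fix y assume "y \<in> vectors Q"
    then obtain x where x: "x \<in> vectors P" "y = f x" using onto by blast
    have pow: "(w ^^ i) x \<in> vectors P" for i
      using w x by (induction i) (auto simp: alternating_endo_def linear_map_def)
    have pow': "((\<lambda>y. f (w (g y))) ^^ i) y = f ((w ^^ i) x)" for i
      using x pow by (induction i) (auto simp: gf)
    have "(\<Sum>i\<le>Polynomial.degree r. scale Q (Polynomial.coeff r i) (((\<lambda>y. f (w (g y))) ^^ i) y)) =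
        (\<Sum>i\<le>Polynomial.degree r. f (scale P (Polynomial.coeff r i) ((w ^^ i) x)))"
      using pow by (simp add: pow' fscale)
    also have "\<dots> = f (\<Sum>i\<le>Polynomial.degree r. scale P (Polynomial.coeff r i) ((w ^^ i) x))"
      using linear_map_sum(1)[OF f(1) fdP Q, of "{..Polynomial.degree r}"] pow by simp
    also have "\<dots> = 0" using r x by (simp add: annihilates_def f0)
    finally show "(\<Sum>i\<le>Polynomial.degree r. scale Q (Polynomial.coeff r i) (((\<lambda>y. f (w (g y))) ^^ i) y)) = 0" .
  qed
  have endoP: "alternating_endo P (form P) (endo P)" using sP by (simp add: symplectic_pair_def)
  have "alternating_endo Q (form Q) (endo Q)"
  proof -
    have eq: "f (endo P (g y)) = endo Q y" if "y \<in> vectors Q" for y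
      using onto[OF that] by (auto simp: gf f(4))
    then show ?thesis using tr[OF endoP] Q.subspace_add[OF subQ] Q.subspace_scale[OF subQ]
      unfolding alternating_endo_def linear_map_def by simp
  qed
  moreover have "symplectic_form Q (form Q)"
  proof -
    have 1: "form Q y y = 0" if "y \<in> vectors Q" for y
      using onto[OF that] by (auto simp: f(3))
    have 2: "y = 0" if y: "y \<in> vectors Q" and 0: "\<forall>y'\<in>vectors Q. form Q y y' = 0" for y
    proof -
      obtain x where x: "x \<in> vectors P" "y = f x" using onto[OF y] by blast
      have "x = 0" using x(1)
      proof (rule P.nondeg)
        fix x' assume "x' \<in> vectors P"
        then show "form P x x' = 0" using 0 x fin f(3) by metis
      qed
      then show ?thesis using x f0 by simp
    qed
    have 3: "form Q y (scale Q c y') = c * form Q y y'" "form Q (scale Q c y) y' = c * form Q y y'"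
      if "y \<in> vectors Q" "y' \<in> vectors Q" for c y y'
      using onto[OF that(1)] onto[OF that(2)] by (auto simp: f(3) P.b_lin simp flip: fscale)
    have 4: "form Q y (y' + y'') = form Q y y' + form Q y y''" "form Q (y' + y'') y = form Q y' y + form Q y'' y"
      if "y \<in> vectors Q" "y' \<in> vectors Q" "y'' \<in> vectors Q" for y y' y''
      using onto[OF that(1)] onto[OF that(2)] onto[OF that(3)] by (auto simp: f(3) P.b_lin simp flip: fadd)
    show ?thesis unfolding symplectic_form_def linear_map_def ground_def
      using 1 2 3 4 by simp
  qed
  ultimately have "symplectic_pair Q" using Q by (simp add: symplectic_pair_def)
  moreover have "endo Q y = f (u1 (g y)) - f (u2 (g y))" if y: "y \<in> vectors Q" for y
  proof -
    obtain x where x: "x \<in> vectors P" "y = f x" using onto[OF y] by blast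
    moreover have "u1 x \<in> vectors P" "u2 x \<in> vectors P"
      using u(1,2) x by (simp_all add: alternating_endo_def linear_map_def)
    ultimately show ?thesis by (simp add: gf f(4) u(3) fdiff)
  qed
  ultimately show ?thesis unfolding symplectic_difference_def
    using tr[OF u(1)] tr[OF u(2)] ann[OF u(1,4)] ann[OF u(2,5)] by blast
qed

lemma isometric_sym:
  assumes P: "symplectic_pair P" and iso: "isometric P Q"
  shows "isometric Q P"
proof -
  interpret P: sympl "scale P" "vectors P" "endo P" "form P" using P by (simp add: symplectic_pair_iff)
  obtain f where f: "linear_map P Q f" "bij_betw f (vectors P) (vectors Q)"
    "\<And>x y. x \<in> vectors P \<Longrightarrow> y \<in> vectors P \<Longrightarrow> form Q (f x) (f y) = form P x y"
    "\<And>x. x \<in> vectors P \<Longrightarrow> endo Q (f x) = f (endo P x)"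
    using iso unfolding isometric_def linear_iso_def by blast
  define g where "g = inv_into (vectors P) f"
  have gf: "g (f x) = x" if "x \<in> vectors P" for x
    unfolding g_def using f(2) that by (simp add: bij_betw_def)
  have onto: "\<exists>x\<in>vectors P. y = f x" if "y \<in> vectors Q" for y using f(2) that by (auto simp: bij_betw_def)
  have fl: "f (x + y) = f x + f y" "f (scale P c x) = scale Q c (f x)"
    if "x \<in> vectors P" "y \<in> vectors P" for c x y
    using f(1) that by (simp_all add: linear_map_def)
  have bij: "bij_betw g (vectors Q) (vectors P)" unfolding g_def using f(2) by (rule bij_betw_inv_into)
  have "linear_map Q P g" unfolding linear_map_def
  proof (intro conjI ballI allI)
    fix y assume y: "y \<in> vectors Q"
    then show "g y \<in> vectors P" using bij by (auto simp: bij_betw_def)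
    obtain x where x: "x \<in> vectors P" "y = f x" using onto y by blast
    show "g (scale Q c y) = scale P c (g y)" for c using x gf[of "scale P c x"] by (simp add: gf flip: fl(2)[OF _ x(1)])
    fix y' assume "y' \<in> vectors Q"
    then obtain x' where x': "x' \<in> vectors P" "y' = f x'" using onto by blast
    show "g (y + y') = g y + g y'" using x x' gf[of "x + x'"] by (simp add: gf flip: fl(1))
  qed
  moreover have "form P (g y) (g y') = form Q y y'" if "y \<in> vectors Q" "y' \<in> vectors Q" for y y'
    using onto[OF that(1)] onto[OF that(2)] by (auto simp: gf f(3))
  moreover have "endo P (g y) = g (endo Q y)" if "y \<in> vectors Q" for y
    using onto[OF that] by (auto simp: gf f(4))
  ultimately show ?thesis unfolding isometric_def linear_iso_def using bij by blast
qed

text \<open>Needed because the summands in \<open>indecomposable_difference\<close> are spaces of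
  sequences, while decompositions arise inside an arbitrary ambient type.\<close>

lemma exists_sequence_copy:
  fixes P :: "('a::field, 'v::ab_group_add) form_space"
  assumes "symplectic_pair P"
  obtains Q :: "('a, nat \<Rightarrow> 'a) form_space" where "isometric P Q" "fd_space Q"
proof -
  interpret P: sympl "scale P" "vectors P" "endo P" "form P" using assms by (simp add: symplectic_pair_iff)
  have "fd_space P" using assms by (simp add: symplectic_pair_def)
  then obtain W :: "('a, nat \<Rightarrow> 'a) vspace" and f where W: "fd_space W" and f: "linear_iso P W f"
    using fd_space_iso_sequences by blast
  define g where "g = inv_into (vectors P) f"
  have gf: "g (f x) = x" if "x \<in> vectors P" for x
    unfolding g_def using f that by (simp add: linear_iso_def bij_betw_def)
  define Q :: "('a, nat \<Rightarrow> 'a) form_space" where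
    "Q = \<lparr>vectors = vectors W, scale = scale W, form = (\<lambda>x y. form P (g x) (g y)), endo = (\<lambda>x. f (endo P (g x)))\<rparr>"
  have "isometric P Q" unfolding isometric_def
    using f by (intro exI[of _ f]) (auto simp: Q_def linear_iso_def linear_map_def gf)
  moreover have "fd_space Q" using W by (simp add: Q_def fd_space_def)
  ultimately show ?thesis by (rule that)
qed


context sympl
begin

text \<open>Internal counterpart of \<open>orth_sum\<close>, with two subspaces of one space in
  place of a product.\<close>

definition orthogonal_decomposition :: "'v set \<Rightarrow> 'v set \<Rightarrow> bool" where
  "orthogonal_decomposition W R \<longleftrightarrow>
     sympl (*s) W u b \<and> W \<subseteq> V \<and> sympl (*s) R u b \<and> R \<subseteq> V \<and> W \<inter> R = {0} \<and>
     (\<forall>x\<in>V. \<exists>w\<in>W. \<exists>r\<in>R. x = w + r) \<and> (\<forall>w\<in>W. \<forall>r\<in>R. b w r = 0)"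

lemma frame_orthogonal_decomposition:
  assumes z: "frame s k z"
  shows "orthogonal_decomposition (gen (2*k) z) (perp (gen (2*k) z))"
  unfolding orthogonal_decomposition_def
proof (intro conjI ballI)
  show "\<exists>w\<in>gen (2*k) z. \<exists>r\<in>perp (gen (2*k) z). x = w + r" if "x \<in> V" for x
    using frame_decomposition[OF z that] by metis
  show "b w r = 0" if "w \<in> gen (2*k) z" "r \<in> perp (gen (2*k) z)" for w r
    using that b_swap[of w r] frame_gen_subset[OF z] by (auto simp: perp_def)
qed (use sympl_frame_gen[OF z] sympl_frame_perp[OF z] frame_gen_subset[OF z] frame_gen_perp_trivial[OF z]
  in \<open>auto simp: perp_def\<close>)

lemma isometric_orth_sum:
  assumes dec: "orthogonal_decomposition W R"
    and iso: "isometric (pair W) P1" "isometric (pair R) P2" and fd: "fd_space P1" "fd_space P2"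
  shows "isometric (pair V) (orth_sum P1 P2)"
proof -
  interpret W: sympl "(*s)" W u b using dec by (simp add: orthogonal_decomposition_def)
  interpret R: sympl "(*s)" R u b using dec by (simp add: orthogonal_decomposition_def)
  have sub: "W \<subseteq> V" "R \<subseteq> V" and int: "W \<inter> R = {0}" and orth: "\<And>w r. w \<in> W \<Longrightarrow> r \<in> R \<Longrightarrow> b w r = 0"
    using dec by (auto simp: orthogonal_decomposition_def)
  obtain f where f: "linear_map (pair W) P1 f" "bij_betw f W (vectors P1)"
    "\<And>x y. x \<in> W \<Longrightarrow> y \<in> W \<Longrightarrow> form P1 (f x) (f y) = b x y"
    "\<And>x. x \<in> W \<Longrightarrow> endo P1 (f x) = f (u x)"
    using iso(1) unfolding isometric_def linear_iso_def by auto
  obtain g where g: "linear_map (pair R) P2 g" "bij_betw g R (vectors P2)"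
    "\<And>x y. x \<in> R \<Longrightarrow> y \<in> R \<Longrightarrow> form P2 (g x) (g y) = b x y"
    "\<And>x. x \<in> R \<Longrightarrow> endo P2 (g x) = g (u x)"
    using iso(2) unfolding isometric_def linear_iso_def by auto
  have "\<forall>x\<in>V. \<exists>w r. w \<in> W \<and> r \<in> R \<and> x = w + r" using dec unfolding orthogonal_decomposition_def by blast
  then obtain pw pr where pr: "\<And>x. x \<in> V \<Longrightarrow> pw x \<in> W \<and> pr x \<in> R \<and> x = pw x + pr x" by metis
  have proj: "pw (w + r) = w \<and> pr (w + r) = r" if "w \<in> W" "r \<in> R" for w r
  proof -
    have "w + r \<in> V" using that sub by (intro V_add) auto
    then have *: "pw (w + r) \<in> W" "pr (w + r) \<in> R" "w + r = pw (w + r) + pr (w + r)"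
      using pr by blast+
    then have "w - pw (w + r) = pr (w + r) - r" by (metis add.commute add_diff_cancel_left' add_diff_eq diff_diff_eq2)
    moreover have "w - pw (w + r) \<in> W" "pr (w + r) - r \<in> R" using * that by simp_all
    ultimately have "w - pw (w + r) \<in> W \<inter> R" "pr (w + r) - r = w - pw (w + r)" by simp_all
    then have "w - pw (w + r) = 0" "pr (w + r) - r = 0" using int by simp_all
    then show ?thesis by simp
  qed
  define h where "h = (\<lambda>x. (f (pw x), g (pr x)))"
  have h: "h (w + r) = (f w, g r)" if "w \<in> W" "r \<in> R" for w r
    using proj[OF that] by (simp add: h_def)
  have ex: "\<exists>w r. w \<in> W \<and> r \<in> R \<and> x = w + r" if "x \<in> V" for x using pr[OF that] by blast
  have inV: "x \<in> W \<Longrightarrow> x \<in> V" "x \<in> R \<Longrightarrow> x \<in> V" for x using sub by auto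
  have fl: "f (x + y) = f x + f y" "f (c *s x) = scale P1 c (f x)" "f x \<in> vectors P1"
    if "x \<in> W" "y \<in> W" for x y c using f(1) that by (simp_all add: linear_map_def)
  have gl: "g (x + y) = g x + g y" "g (c *s x) = scale P2 c (g x)" "g x \<in> vectors P2"
    if "x \<in> R" "y \<in> R" for x y c using g(1) that by (simp_all add: linear_map_def)
  show ?thesis unfolding isometric_def linear_iso_def
  proof (intro exI[of _ h] conjI ballI)
    show "linear_map (pair V) (orth_sum P1 P2) h"
      unfolding linear_map_def orth_sum_def form_space.simps vspace.simps
    proof (intro conjI ballI allI)
      fix x assume "x \<in> V"
      then obtain w r where x: "w \<in> W" "r \<in> R" "x = w + r" using ex by blast
      then show "h x \<in> vectors P1 \<times> vectors P2" by (simp add: h fl gl)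
      show "h (c *s x) = map_prod (scale P1 c) (scale P2 c) (h x)" for c
        using x h[of "c *s w" "c *s r"] by (simp add: h scale_right_distrib fl gl)
      fix y assume "y \<in> V"
      then obtain w' r' where y: "w' \<in> W" "r' \<in> R" "y = w' + r'" using ex by blast
      have "x + y = (w + w') + (r + r')" using x y by (simp add: algebra_simps)
      moreover have "h x = (f w, g r)" "h y = (f w', g r')" using x y h by simp_all
      ultimately show "h (x + y) = h x + h y"
        using h[of "w + w'" "r + r'"] x(1,2) y(1,2) by (simp add: fl gl)
    qed
    show "bij_betw h (vectors (pair V)) (vectors (orth_sum P1 P2))"
      unfolding bij_betw_def
    proof
      show "inj_on h (vectors (pair V))"
      proof
        fix x y assume "x \<in> vectors (pair V)" "y \<in> vectors (pair V)" and eq: "h x = h y"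
        then have "x \<in> V" "y \<in> V" by simp_all
        then obtain w r w' r' where x: "w \<in> W" "r \<in> R" "x = w + r" and y: "w' \<in> W" "r' \<in> R" "y = w' + r'"
          using ex by meson
        then have "f w = f w'" "g r = g r'" using eq h[OF x(1,2)] h[OF y(1,2)] by simp_all
        then have "w = w'" "r = r'" using f(2) g(2) x y by (auto simp: bij_betw_def inj_on_def)
        then show "x = y" using x y by simp
      qed
      show "h ` vectors (pair V) = vectors (orth_sum P1 P2)"
      proof
        show "h ` vectors (pair V) \<subseteq> vectors (orth_sum P1 P2)"
        proof
          fix y assume "y \<in> h ` vectors (pair V)"
          then obtain x where x: "y = h x" "x \<in> V" by auto
          then have "pw x \<in> W" "pr x \<in> R" using pr by auto
          then show "y \<in> vectors (orth_sum P1 P2)"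
            unfolding x(1) using fl(3)[of "pw x" "pw x"] gl(3)[of "pr x" "pr x"] by (simp add: h_def orth_sum_def)
        qed
        show "vectors (orth_sum P1 P2) \<subseteq> h ` vectors (pair V)"
        proof
          fix y assume "y \<in> vectors (orth_sum P1 P2)"
          then have "y \<in> f ` W \<times> g ` R" using f(2) g(2) by (simp add: orth_sum_def bij_betw_def)
          then obtain w r where wr: "w \<in> W" "r \<in> R" "y = (f w, g r)" by blast
          then have "y = h (w + r)" "w + r \<in> V" using h inV by simp_all
          then show "y \<in> h ` vectors (pair V)" by auto
        qed
      qed
    qed
    fix x assume "x \<in> vectors (pair V)"
    then obtain w r where x: "w \<in> W" "r \<in> R" "x = w + r" using ex[of x] by force
    have "u x = u w + u r" using x by (simp add: u_add inV)
    then show "endo (orth_sum P1 P2) (h x) = h (endo (pair V) x)"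
      using x h[of "u w" "u r"] by (simp add: orth_sum_def h f(4) g(4))
    fix y assume "y \<in> vectors (pair V)"
    then obtain w' r' where y: "w' \<in> W" "r' \<in> R" "y = w' + r'" using ex[of y] by force
    have "b r w' = 0" using orth[OF y(1) x(2)] b_swap[of r w'] x y inV by simp
    then show "form (orth_sum P1 P2) (h x) (h y) = form (pair V) x y"
      using x y orth[OF x(1) y(2)] by (simp add: orth_sum_def h f(3) g(3) b_lin inV)
  qed
qed

text \<open>The subspaces are the images of the two factors of the product, embedded with 0 in the
  other coordinate.\<close>

lemma orthogonal_decomposition_of_isometric:
  fixes P1 P2 :: "('a, nat \<Rightarrow> 'a) form_space"
  assumes iso: "isometric (pair V) (orth_sum P1 P2)" and P: "symplectic_pair P1" "symplectic_pair P2"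
  obtains W R where "orthogonal_decomposition W R" "isometric P1 (pair W)" "isometric P2 (pair R)"
proof -
  interpret P1: sympl "scale P1" "vectors P1" "endo P1" "form P1" using P(1) by (simp add: symplectic_pair_iff)
  interpret P2: sympl "scale P2" "vectors P2" "endo P2" "form P2" using P(2) by (simp add: symplectic_pair_iff)
  have S_pair: "vectors (orth_sum P1 P2) = vectors P1 \<times> vectors P2"
    by (simp add: orth_sum_def)
  have "isometric (orth_sum P1 P2) (pair V)" using isometric_sym[OF symplectic_pair_V iso] .
  then obtain f where f: "linear_map (orth_sum P1 P2) (pair V) f" "bij_betw f (vectors P1 \<times> vectors P2) V"
    "\<And>x y. x \<in> vectors P1 \<times> vectors P2 \<Longrightarrow> y \<in> vectors P1 \<times> vectors P2 \<Longrightarrow>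
      b (f x) (f y) = form (orth_sum P1 P2) x y"
    "\<And>x. x \<in> vectors P1 \<times> vectors P2 \<Longrightarrow> u (f x) = f (endo (orth_sum P1 P2) x)"
    unfolding isometric_def linear_iso_def S_pair by auto
  have fV: "f (x, y) \<in> V" if "x \<in> vectors P1" "y \<in> vectors P2" for x y
    using f(2) that by (auto simp: bij_betw_def)
  have fadd: "f (x + x', y + y') = f (x, y) + f (x', y')"
    if "x \<in> vectors P1" "y \<in> vectors P2" "x' \<in> vectors P1" "y' \<in> vectors P2" for x y x' y'
    using f(1) that unfolding linear_map_def orth_sum_def by force
  have fscale: "f (scale P1 c x, scale P2 c y) = c *s f (x, y)"
    if "x \<in> vectors P1" "y \<in> vectors P2" for x y c
    using f(1) that unfolding linear_map_def orth_sum_def by force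
  have fb: "b (f (x, y)) (f (x', y')) = form P1 x x' + form P2 y y'"
    if "x \<in> vectors P1" "y \<in> vectors P2" "x' \<in> vectors P1" "y' \<in> vectors P2" for x y x' y'
    using f(3)[of "(x, y)" "(x', y')"] that by (simp add: orth_sum_def)
  have fu: "u (f (x, y)) = f (endo P1 x, endo P2 y)" if "x \<in> vectors P1" "y \<in> vectors P2" for x y
    using f(4)[of "(x, y)"] that by (simp add: orth_sum_def)
  have finj: "x = x' \<and> y = y'" if "f (x, y) = f (x', y')" "x \<in> vectors P1" "y \<in> vectors P2"
    "x' \<in> vectors P1" "y' \<in> vectors P2" for x y x' y'
    using f(2) that unfolding bij_betw_def inj_on_def by blast
  define f1 where "f1 = (\<lambda>x. f (x, 0))"
  define f2 where "f2 = (\<lambda>y. f (0, y))"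
  define W where "W = f1 ` vectors P1"
  define R where "R = f2 ` vectors P2"
  have isoW: "isometric P1 (pair W)" unfolding isometric_def linear_iso_def linear_map_def
    using fadd[of _ 0 _ 0] fscale[of _ 0] fb[of _ 0 _ 0] fu[of _ 0] finj[of _ 0 _ 0]
    by (intro exI[of _ f1] conjI ballI allI) (auto simp: f1_def W_def bij_betw_def inj_on_def)
  have isoR: "isometric P2 (pair R)" unfolding isometric_def linear_iso_def linear_map_def
    using fadd[of 0 _ 0 _] fscale[of 0] fb[of 0 _ 0 _] fu[of 0] finj[of 0 _ 0 _]
    by (intro exI[of _ f2] conjI ballI allI) (auto simp: f2_def R_def bij_betw_def inj_on_def)
  have f00: "f (0, 0) = 0" using fadd[of 0 0 0 0] by simp
  have split: "f (x, y) = f1 x + f2 y" if "x \<in> vectors P1" "y \<in> vectors P2" for x y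
    using fadd[of x 0 0 y] that by (simp add: f1_def f2_def)
  have subV: "W \<subseteq> V" "R \<subseteq> V" using fV by (auto simp: W_def R_def f1_def f2_def)
  have "sympl (*s) W u b"
  proof (rule sympl_restrict[OF _ subV(1)])
    show "subspace W"
    proof (rule subspaceI)
      show "0 \<in> W" unfolding W_def f1_def using f00 by (metis P1.V_0 imageI)
      show "x + y \<in> W" if xy: "x \<in> W" "y \<in> W" for x y
      proof -
        obtain x' y' where "x' \<in> vectors P1" "x = f1 x'" "y' \<in> vectors P1" "y = f1 y'"
          using xy unfolding W_def by blast
        then have "x + y = f1 (x' + y')" "x' + y' \<in> vectors P1" using fadd[of x' 0 y' 0] by (simp_all add: f1_def)
        then show ?thesis unfolding W_def by blast
      qed
      show "c *s x \<in> W" if x: "x \<in> W" for c x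
      proof -
        obtain x' where "x' \<in> vectors P1" "x = f1 x'" using x unfolding W_def by blast
        then have "c *s x = f1 (scale P1 c x')" "scale P1 c x' \<in> vectors P1" using fscale[of x' 0 c] by (simp_all add: f1_def)
        then show ?thesis unfolding W_def by blast
      qed
    qed
    show "u w \<in> W" if "w \<in> W" for w using that fu[of _ 0] by (auto simp: W_def f1_def)
    show "x = 0" if x: "x \<in> W" "\<And>y. y \<in> W \<Longrightarrow> b x y = 0" for x
    proof -
      obtain x' where x': "x' \<in> vectors P1" "x = f1 x'" using x(1) unfolding W_def by blast
      have "form P1 x' y' = 0" if "y' \<in> vectors P1" for y'
        using x(2)[of "f1 y'"] that x' fb[of x' 0 y' 0] by (simp add: W_def f1_def)
      then have "x' = 0" using P1.nondeg x' by blast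
      then show ?thesis using x' f00 by (simp add: f1_def)
    qed
  qed
  moreover have "sympl (*s) R u b"
  proof (rule sympl_restrict[OF _ subV(2)])
    show "subspace R"
    proof (rule subspaceI)
      show "0 \<in> R" unfolding R_def f2_def using f00 by (metis P2.V_0 imageI)
      show "x + y \<in> R" if xy: "x \<in> R" "y \<in> R" for x y
      proof -
        obtain x' y' where "x' \<in> vectors P2" "x = f2 x'" "y' \<in> vectors P2" "y = f2 y'"
          using xy unfolding R_def by blast
        then have "x + y = f2 (x' + y')" "x' + y' \<in> vectors P2" using fadd[of 0 x' 0 y'] by (simp_all add: f2_def)
        then show ?thesis unfolding R_def by blast
      qed
      show "c *s x \<in> R" if x: "x \<in> R" for c x
      proof -
        obtain x' where "x' \<in> vectors P2" "x = f2 x'" using x unfolding R_def by blast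
        then have "c *s x = f2 (scale P2 c x')" "scale P2 c x' \<in> vectors P2" using fscale[of 0 x' c] by (simp_all add: f2_def)
        then show ?thesis unfolding R_def by blast
      qed
    qed
    show "u w \<in> R" if "w \<in> R" for w using that fu[of 0] by (auto simp: R_def f2_def)
    show "x = 0" if x: "x \<in> R" "\<And>y. y \<in> R \<Longrightarrow> b x y = 0" for x
    proof -
      obtain x' where x': "x' \<in> vectors P2" "x = f2 x'" using x(1) unfolding R_def by blast
      have "form P2 x' y' = 0" if "y' \<in> vectors P2" for y'
        using x(2)[of "f2 y'"] that x' fb[of 0 x' 0 y'] by (simp add: R_def f2_def)
      then have "x' = 0" using P2.nondeg x' by blast
      then show ?thesis using x' f00 by (simp add: f2_def)
    qed
  qed
  moreover have "W \<inter> R = {0}"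
  proof -
    have "x = 0" if xWR: "x \<in> W" "x \<in> R" for x
    proof -
      obtain a c where "a \<in> vectors P1" "c \<in> vectors P2" "x = f (a, 0)" "x = f (0, c)"
        using xWR unfolding W_def R_def f1_def f2_def by blast
      then show ?thesis using finj[of a 0 0 c] f00 by simp
    qed
    moreover have "0 \<in> W" "0 \<in> R" unfolding W_def R_def f1_def f2_def using f00 P1.V_0 P2.V_0 by (metis imageI)+
    ultimately show ?thesis by blast
  qed
  moreover have "\<exists>w\<in>W. \<exists>r\<in>R. x = w + r" if x: "x \<in> V" for x
  proof -
    obtain a c where "a \<in> vectors P1" "c \<in> vectors P2" "x = f (a, c)" using f(2) x by (auto simp: bij_betw_def)
    then show ?thesis using split unfolding W_def R_def by blast
  qed
  moreover have "b w r = 0" if "w \<in> W" "r \<in> R" for w r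
    using that fb[of _ 0 0] by (auto simp: W_def R_def f1_def f2_def)
  ultimately have "orthogonal_decomposition W R" using subV unfolding orthogonal_decomposition_def by blast
  then show ?thesis using that isoW isoR by blast
qed

lemma fd_space_sub: "sympl (*s) W u b \<Longrightarrow> fd_space (pair W)"
  using symplectic_pair_iff[of "pair W"] by (simp add: symplectic_pair_def)

text \<open>Together with \<open>indecomposableD\<close>, this replaces external sums over sequence
  spaces by internal decompositions.\<close>

lemma indecomposableI:
  assumes "symplectic_difference p q (pair V)" "V \<noteq> {0}"
    and dec: "\<And>W R. \<lbrakk>orthogonal_decomposition W R; symplectic_difference p q (pair W);
      symplectic_difference p q (pair R); W \<noteq> {0}; R \<noteq> {0}\<rbrakk> \<Longrightarrow> False"
  shows "indecomposable_difference p q (pair V)"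
  unfolding indecomposable_difference_def
proof (intro conjI notI assms(1))
  show False if "trivial_pair (pair V)" using that assms(2) by (simp add: trivial_pair_def)
  assume "\<exists>(P1 :: ('a, nat \<Rightarrow> 'a) form_space) (P2 :: ('a, nat \<Rightarrow> 'a) form_space).
    symplectic_difference p q P1 \<and> \<not> trivial_pair P1 \<and>
    symplectic_difference p q P2 \<and> \<not> trivial_pair P2 \<and> isometric (pair V) (orth_sum P1 P2)"
  then obtain P1 P2 :: "('a, nat \<Rightarrow> 'a) form_space" where
    P: "symplectic_difference p q P1" "\<not> trivial_pair P1" "symplectic_difference p q P2" "\<not> trivial_pair P2"
      "isometric (pair V) (orth_sum P1 P2)" by blast
  then have "symplectic_pair P1" "symplectic_pair P2" by (simp_all add: symplectic_difference_def)
  then obtain W R where WR: "orthogonal_decomposition W R" "isometric P1 (pair W)" "isometric P2 (pair R)"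
    using orthogonal_decomposition_of_isometric[OF P(5)] by blast
  have fd: "fd_space (pair W)" "fd_space (pair R)"
    using WR(1) fd_space_sub by (auto simp: orthogonal_decomposition_def)
  have triv: "U \<noteq> {0}" if Q: "symplectic_pair Q" "isometric Q (pair U)" "\<not> trivial_pair Q"
    for U and Q :: "('a, nat \<Rightarrow> 'a) form_space"
  proof
    assume "U = {0}"
    obtain f where "linear_iso Q (pair U) f" using Q(2) unfolding isometric_def by blast
    then have "bij_betw f (vectors Q) {0}" using \<open>U = {0}\<close> by (simp add: linear_iso_def)
    then have inj: "inj_on f (vectors Q)" and im: "f ` vectors Q = {0}" by (auto simp: bij_betw_def)
    interpret Q: sympl "scale Q" "vectors Q" "endo Q" "form Q" using Q(1) by (simp add: symplectic_pair_iff)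
    have "x = 0" if "x \<in> vectors Q" for x
      using inj_onD[OF inj, of x 0] im that Q.V_0 by (metis imageI singletonD)
    then show False using Q(3) Q.V_0 by (auto simp: trivial_pair_def)
  qed
  show False
    using dec[OF WR(1)] symplectic_difference_transfer[OF P(1) WR(2) fd(1)]
      symplectic_difference_transfer[OF P(3) WR(3) fd(2)]
      triv[OF \<open>symplectic_pair P1\<close> WR(2) P(2)] triv[OF \<open>symplectic_pair P2\<close> WR(3) P(4)] by blast
qed

lemma indecomposableD:
  assumes ind: "indecomposable_difference p q (pair V)" and dec: "orthogonal_decomposition W R"
    and W: "symplectic_difference p q (pair W)" and R: "symplectic_difference p q (pair R)"
  shows "W = {0} \<or> R = {0}"
proof (rule ccontr)
  assume nz: "\<not> (W = {0} \<or> R = {0})"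
  have sp: "symplectic_pair (pair W)" "symplectic_pair (pair R)"
    using W R by (simp_all add: symplectic_difference_def)
  obtain P1 :: "('a, nat \<Rightarrow> 'a) form_space" where P1: "isometric (pair W) P1" "fd_space P1"
    using exists_sequence_copy[OF sp(1)] .
  obtain P2 :: "('a, nat \<Rightarrow> 'a) form_space" where P2: "isometric (pair R) P2" "fd_space P2"
    using exists_sequence_copy[OF sp(2)] .
  have d: "symplectic_difference p q P1" "symplectic_difference p q P2"
    using symplectic_difference_transfer[OF W P1] symplectic_difference_transfer[OF R P2] .
  have triv: "\<not> trivial_pair Q" if Q: "symplectic_pair (pair U)" "isometric (pair U) Q" "U \<noteq> {0}"
    for U and Q :: "('a, nat \<Rightarrow> 'a) form_space"
  proof
    assume "trivial_pair Q"
    obtain f where "linear_iso (pair U) Q f" using Q(2) unfolding isometric_def by blast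
    then have "bij_betw f U {0}" using \<open>trivial_pair Q\<close> by (simp add: linear_iso_def trivial_pair_def)
    then have inj: "inj_on f U" and im: "f ` U = {0}" by (auto simp: bij_betw_def)
    interpret U: sympl "(*s)" U u b using Q(1) by (simp add: symplectic_pair_iff)
    have "x = 0" if "x \<in> U" for x using inj_onD[OF inj, of x 0] im that U.V_0 by (metis imageI singletonD)
    then show False using Q(3) U.V_0 by auto
  qed
  have "isometric (pair V) (orth_sum P1 P2)" using isometric_orth_sum[OF dec P1(1) P2(1) P1(2) P2(2)] .
  moreover have "\<not> trivial_pair P1" "\<not> trivial_pair P2" using triv[OF sp(1) P1(1)] triv[OF sp(2) P2(1)] nz by blast+
  ultimately show False using ind d unfolding indecomposable_difference_def by blast
qed

end

text \<open>The isometry keeps the coefficient polynomials and exchanges the frames. By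
  \<open>frame_pair\<close> the form values depend on \<open>s\<close> and these coefficients only;
  non-degeneracy on both sides then shows that two coefficient families give equal vectors for one
  frame exactly if they do for the other.\<close>

lemma frames_isometric:
  assumes P: "sympl sc V u b" "sympl.frame sc V u b s k z" "endo_space.gen sc u (2*k) z = V"
    and Q: "sympl sc' V' u' b'" "sympl.frame sc' V' u' b' s k z'" "endo_space.gen sc' u' (2*k) z' = V'"
  shows "isometric \<lparr>vectors = V, scale = sc, form = b, endo = u\<rparr> \<lparr>vectors = V', scale = sc', form = b', endo = u'\<rparr>"
proof -
  interpret P: sympl sc V u b by (rule P(1))
  interpret Q: sympl sc' V' u' b' by (rule Q(1))
  define F where "F = (\<lambda>h. \<Sum>i<2*k. act sc u (h i) (z i))"
  define G where "G = (\<lambda>h. \<Sum>i<2*k. act sc' u' (h i) (z' i))"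
  have V: "V = range F" and V': "V' = range G"
    using P(3) Q(3) by (auto simp: P.gen_def Q.gen_def F_def G_def)
  note z = P.frame_in[OF P(2)] and z' = Q.frame_in[OF Q(2)]
  have form: "b (F h) (F h') = b' (G h) (G h')" for h h'
    unfolding F_def G_def using z z'
    by (simp add: P.b_sum_right_less Q.b_sum_right_less P.frame_pair[OF P(2)] Q.frame_pair[OF Q(2)])
  have add: "F (\<lambda>i. h i + h' i) = F h + F h'" "G (\<lambda>i. h i + h' i) = G h + G h'" for h h'
    unfolding F_def G_def using z z' by (simp_all add: P.act_add Q.act_add sum.distrib)
  have smult: "F (\<lambda>i. smult c (h i)) = sc c (F h)" "G (\<lambda>i. smult c (h i)) = sc' c (G h)" for c h
    unfolding F_def G_def by (simp_all add: P.act_smult Q.act_smult P.scale_sum_right Q.scale_sum_right)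
  have shift: "F (\<lambda>i. [:0, 1:] * h i) = u (F h)" "G (\<lambda>i. [:0, 1:] * h i) = u' (G h)" for h
    unfolding F_def G_def
    using z z' P.u_sum[of "{..<2*k}" "\<lambda>i. act sc u (h i) (z i)"]
      Q.u_sum[of "{..<2*k}" "\<lambda>i. act sc' u' (h i) (z' i)"]
    by (simp_all add: P.act_mult P.act_X Q.act_mult Q.act_X del: mult_pCons_left)
  have FG: "F h = F h' \<longleftrightarrow> G h = G h'" for h h'
  proof -
    have nz: "x = y" if "x \<in> V" "y \<in> V" "\<And>v. v \<in> V \<Longrightarrow> b x v = b y v" for x y
      using P.nondeg[of "x - y"] that by (simp add: P.b_diff_left)
    have nz': "x = y" if "x \<in> V'" "y \<in> V'" "\<And>v. v \<in> V' \<Longrightarrow> b' x v = b' y v" for x y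
      using Q.nondeg[of "x - y"] that by (simp add: Q.b_diff_left)
    show ?thesis
    proof
      assume "F h = F h'"
      then show "G h = G h'" using V' form by (intro nz') (auto simp flip: form)
    next
      assume "G h = G h'"
      then show "F h = F h'" using V form by (intro nz) (auto simp: form)
    qed
  qed
  define f where "f = (\<lambda>x. G (SOME h. F h = x))"
  have f: "f (F h) = G h" for h
    unfolding f_def using FG someI[of "\<lambda>h'. F h' = F h" h] by blast
  show ?thesis unfolding isometric_def linear_iso_def
  proof (intro exI[of _ f] conjI ballI; (simp only: form_space.simps vspace.simps)?)
    show "linear_map \<lparr>vectors = V, scale = sc, form = b, endo = u\<rparr> \<lparr>vectors = V', scale = sc', form = b', endo = u'\<rparr> f"
      unfolding linear_map_def V V' by (auto simp: f simp flip: add smult)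
    show "bij_betw f V V'" unfolding bij_betw_def V V' inj_on_def by (auto simp: f FG image_image)
    show "b' (f x) (f y) = b x y" if "x \<in> V" "y \<in> V" for x y
      using that unfolding V by (auto simp: f form)
    show "u' (f x) = f (u x)" if "x \<in> V" for x
      using that unfolding V by (auto simp: f simp flip: shift)
  qed
qed

section \<open>Indecomposable cells\<close>

context sympl
begin

lemma dim_image_orthogonal_decomposition:
  assumes dec: "orthogonal_decomposition W R"
  shows "dim ((\<lambda>x. f \<diamondop> x) ` V) = dim ((\<lambda>x. f \<diamondop> x) ` W) + dim ((\<lambda>x. f \<diamondop> x) ` R)"
proof -
  have "sympl (*s) W u b" "sympl (*s) R u b" using dec by (simp_all add: orthogonal_decomposition_def)
  then have es: "endo_space (*s) W u" "endo_space (*s) R u" by (simp_all add: sympl.axioms(1))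
  note W = endo_space.subspace_V[OF es(1)] endo_space.u_in[OF es(1)]
    and R = endo_space.subspace_V[OF es(2)] endo_space.u_in[OF es(2)]
  have sub: "W \<subseteq> V" "R \<subseteq> V" and int: "W \<inter> R = {0}" and ex: "\<And>x. x \<in> V \<Longrightarrow> \<exists>w\<in>W. \<exists>r\<in>R. x = w + r"
    using dec by (auto simp: orthogonal_decomposition_def)
  have im: "(\<lambda>x. f \<diamondop> x) ` W \<subseteq> W" "(\<lambda>x. f \<diamondop> x) ` R \<subseteq> R"
    using act_in_stable[OF W] act_in_stable[OF R] by blast+
  have "(\<lambda>x. f \<diamondop> x) ` V = {x + y |x y. x \<in> (\<lambda>x. f \<diamondop> x) ` W \<and> y \<in> (\<lambda>x. f \<diamondop> x) ` R}" (is "_ = ?S")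
  proof
    show "(\<lambda>x. f \<diamondop> x) ` V \<subseteq> ?S"
    proof
      fix y assume "y \<in> (\<lambda>x. f \<diamondop> x) ` V"
      then obtain x where x: "x \<in> V" "y = f \<diamondop> x" by blast
      obtain w r where wr: "w \<in> W" "r \<in> R" "x = w + r" using ex[OF x(1)] by blast
      then have "y = f \<diamondop> w + f \<diamondop> r" using x sub by (auto intro: act_vadd)
      then show "y \<in> ?S" using wr by blast
    qed
    show "?S \<subseteq> (\<lambda>x. f \<diamondop> x) ` V" using sub by (auto simp: subset_iff simp flip: act_vadd)
  qed
  moreover have "(\<lambda>x. f \<diamondop> x) ` W \<inter> (\<lambda>x. f \<diamondop> x) ` R = {0}"
  proof -
    have "0 \<in> (\<lambda>x. f \<diamondop> x) ` W" "0 \<in> (\<lambda>x. f \<diamondop> x) ` R"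
      using subspace_0[OF W(1)] subspace_0[OF R(1)] act_vzero by (metis imageI)+
    then show ?thesis using im int by blast
  qed
  moreover have "finitely_spanned ((\<lambda>x. f \<diamondop> x) ` W)" "finitely_spanned ((\<lambda>x. f \<diamondop> x) ` R)"
    using im sub finitely_spanned_subset[OF fin_V] by (meson subset_trans)+
  ultimately show ?thesis
    using dim_direct_sum subspace_act_image[OF W(1) sub(1)] subspace_act_image[OF R(1) sub(2)] by simp
qed

lemma exists_frame_of_nilpotent:
  assumes \<pi>: "Factorial_Ring.irreducible \<pi>" "Polynomial.lead_coeff \<pi> = 1"
    and nil: "\<And>x. x \<in> V \<Longrightarrow> \<pi> ^ N \<diamondop> x = 0" and "V \<noteq> {0}"
  obtains n z where "Suc n \<le> N" "frame (\<pi> ^ Suc n) 1 z"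
proof -
  let ?Q = "\<lambda>n. \<forall>x\<in>V. \<pi> ^ n \<diamondop> x = 0"
  define n0 where "n0 = (LEAST n. ?Q n)"
  have "?Q N" using nil by blast
  then have n0: "?Q n0" "n0 \<le> N" unfolding n0_def by (rule LeastI[of ?Q], rule Least_le[of ?Q])
  have "n0 \<noteq> 0"
  proof
    assume "n0 = 0"
    then have "V \<subseteq> {0}" using n0(1) by auto
    then show False using \<open>V \<noteq> {0}\<close> V_0 by blast
  qed
  then obtain n where n: "n0 = Suc n" using not0_implies_Suc by blast
  have "\<not> ?Q n" using not_less_Least[of n ?Q] n unfolding n0_def by simp
  then obtain x0 where x0: "x0 \<in> V" "\<pi> ^ n \<diamondop> x0 \<noteq> 0" by blast
  have "\<not> \<pi> dvd 1" using \<pi>(1) by (rule irreducible_not_unit)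
  then have "\<exists>z. frame (\<pi> ^ Suc n) 1 z" using exists_frame[OF \<pi>, of 1 n x0] n0(1) n x0 by simp
  then show ?thesis using that n n0(2) by blast
qed

lemma dim_image_le: "dim ((\<lambda>x. f \<diamondop> x) ` V) \<le> dim V"
  by (rule dim_subspace_le[OF fin_V subspace_V]) auto

text \<open>The defect, dimension minus rank of \<pi>(u), is 2 deg \<pi> on each cell and never
  negative on the complement; every nonzero pair killed by a power of \<pi> contains a cell.\<close>

lemma dim_image_bound:
  assumes \<pi>: "Factorial_Ring.irreducible \<pi>" "Polynomial.lead_coeff \<pi> = 1"
    and nil: "\<And>x. x \<in> V \<Longrightarrow> \<pi> ^ N \<diamondop> x = 0" and "V \<noteq> {0}"
  shows "dim ((\<lambda>x. \<pi> \<diamondop> x) ` V) + 2 * Polynomial.degree \<pi> \<le> dim V"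
proof -
  obtain n z where z: "frame (\<pi> ^ Suc n) 1 z" using exists_frame_of_nilpotent[OF assms] .
  interpret R: sympl "(*s)" "perp (gen (2*1) z)" u b by (rule sympl_frame_perp[OF z])
  have "Polynomial.degree (\<pi> ^ Suc n) = Suc n * Polynomial.degree \<pi>" using monic_degree_power[OF \<pi>(2)] by blast
  then show ?thesis
    using dim_image_split[OF z, of \<pi>] dim_image_frame_gen[OF z, of \<pi>] dim_split[OF z] R.dim_image_le[of \<pi>]
    by (simp del: power_Suc add: dvd_power)
qed

text \<open>If the defect is the least possible, nothing is left of it for the complement of a cell,
  and \<open>dim_image_bound\<close> forces this complement to be zero.\<close>

lemma dim_of_single_cell:
  assumes \<pi>: "Factorial_Ring.irreducible \<pi>" "Polynomial.lead_coeff \<pi> = 1"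
    and nil: "\<And>x. x \<in> V \<Longrightarrow> \<pi> ^ N \<diamondop> x = 0" and "V \<noteq> {0}"
    and dim: "dim V = dim ((\<lambda>x. \<pi> \<diamondop> x) ` V) + 2 * Polynomial.degree \<pi>"
  obtains n where "n \<le> N" "dim V = 2 * (n * Polynomial.degree \<pi>)"
proof -
  obtain n z where n: "Suc n \<le> N" and z: "frame (\<pi> ^ Suc n) 1 z" using exists_frame_of_nilpotent[OF \<pi> nil \<open>V \<noteq> {0}\<close>] .
  let ?R = "perp (gen (2*1) z)"
  interpret R: sympl "(*s)" ?R u b by (rule sympl_frame_perp[OF z])
  have deg: "Polynomial.degree (\<pi> ^ Suc n) = Suc n * Polynomial.degree \<pi>" using monic_degree_power[OF \<pi>(2)] by blast
  have "\<pi> \<noteq> 0" using \<pi>(1) by auto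
  then have "Polynomial.degree \<pi> > 0" using \<pi>(1) by (auto simp: irreducible_def is_unit_iff_degree)
  have eq: "dim ?R = dim ((\<lambda>x. act (*s) u \<pi> x) ` ?R)"
    using dim_image_split[OF z, of \<pi>] dim_image_frame_gen[OF z, of \<pi>] dim_split[OF z] deg dim
    by (simp del: power_Suc add: dvd_power)
  have "?R = {0}"
  proof (rule ccontr)
    assume "?R \<noteq> {0}"
    then have "dim ((\<lambda>x. act (*s) u \<pi> x) ` ?R) + 2 * Polynomial.degree \<pi> \<le> dim ?R"
      using nil by (intro R.dim_image_bound[OF \<pi>]) (auto simp: perp_def)
    then show False using eq \<open>Polynomial.degree \<pi> > 0\<close> by simp
  qed
  then have "dim ?R = 0" using dim_eq_0_iff[OF R.fin_V R.subspace_V] by simp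
  then have "dim V = 2 * (Suc n * Polynomial.degree \<pi>)" using dim_split[OF z] deg by simp
  then show ?thesis using that n by blast
qed

end


context difference_data
begin

text \<open>The defect of \<open>V\<close> is 2 k deg \<pi>, and each nonzero summand uses up at
  least 2 deg \<pi>, which settles k = 1. For k = 2 both summands are single cells, of dimension at
  most 2 N each and 4 N together. So each has dimension 2 N with N odd, contradicting divisibility
  by 4.\<close>

lemma model_frame_indecomposable:
  assumes V: "sympl sc V u b" and z: "sympl.frame sc V u b s k z" and full: "endo_space.gen sc u (2*k) z = V"
    and ty: "model_type s k"
  shows "indecomposable_difference pol_p pol_q \<lparr>vectors = V, scale = sc, form = b, endo = u\<rparr>"
proof -
  interpret sympl sc V u b by (rule V)
  obtain \<pi> N where \<pi>: "s = \<pi> ^ N" "Factorial_Ring.irreducible \<pi>" "Polynomial.lead_coeff \<pi> = 1"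
    and k: "k = 1 \<or> k = 2 \<and> Polynomial.degree \<pi> = 1 \<and> odd N \<and> (\<exists>d. d \<in> D)"
    using ty C_irr irreducible_linear unfolding model_type_def by fastforce
  have degs: "Polynomial.degree s = N * Polynomial.degree \<pi>" using monic_degree_power(2)[OF \<pi>(3)] \<pi>(1) by simp
  have "\<pi> \<noteq> 0" using \<pi>(2) by auto
  then have pos: "Polynomial.degree \<pi> > 0" using \<pi>(2) by (auto simp: irreducible_def is_unit_iff_degree)
  have "N > 0" using frame_s(2)[OF z] degs by simp
  have dimV: "dim V = 2 * k * (N * Polynomial.degree \<pi>)"
    using dim_image_frame_gen[OF z, of 1] full degs by simp
  have "dim ((\<lambda>x. \<pi> \<diamondop> x) ` V) = 2 * k * (N * Polynomial.degree \<pi> - Polynomial.degree \<pi>)"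
    using dim_image_frame_gen[OF z, of \<pi>] full degs \<pi>(1) \<open>N > 0\<close> by (simp add: dvd_power)
  moreover have "N * Polynomial.degree \<pi> \<ge> Polynomial.degree \<pi>" using \<open>N > 0\<close> by simp
  ultimately have dimV': "dim V = dim ((\<lambda>x. \<pi> \<diamondop> x) ` V) + 2 * k * Polynomial.degree \<pi>"
    unfolding dimV by (simp flip: distrib_left)
  have nil: "\<pi> ^ N \<diamondop> x = 0" if "x \<in> V" for x
    using frame_gen_ann[OF z, of x s] that full \<pi>(1) by simp
  have "k > 0" using k by auto
  show ?thesis
  proof (rule indecomposableI)
    show "symplectic_difference pol_p pol_q (pair V)" by (rule model_frame_difference[OF V z full ty])
    show "V \<noteq> {0}"
    proof
      assume "V = {0}"
      then have "dim V = 0" using dim_eq_0_iff[OF fin_V subspace_V] by simp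
      then show False using dimV pos \<open>N > 0\<close> \<open>k > 0\<close> by simp
    qed
    fix W R assume dec: "orthogonal_decomposition W R" and dW: "symplectic_difference pol_p pol_q (pair W)"
      and dR: "symplectic_difference pol_p pol_q (pair R)" and nz: "W \<noteq> {0}" "R \<noteq> {0}"
    have sW: "sympl sc W u b" and sR: "sympl sc R u b" and sub: "W \<subseteq> V" "R \<subseteq> V"
      using dec by (auto simp: orthogonal_decomposition_def)
    have nilW: "\<pi> ^ N \<diamondop> x = 0" if "x \<in> W" for x using nil that sub by blast
    have nilR: "\<pi> ^ N \<diamondop> x = 0" if "x \<in> R" for x using nil that sub by blast
    note bW = sympl.dim_image_bound[OF sW \<pi>(2,3) nilW nz(1)]
    note bR = sympl.dim_image_bound[OF sR \<pi>(2,3) nilR nz(2)]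
    have "(\<lambda>x. 1 \<diamondop> x) ` U = U" for U by simp
    then have sumV: "dim V = dim W + dim R"
      using dim_image_orthogonal_decomposition[OF dec, of 1] by simp
    note sumV' = dim_image_orthogonal_decomposition[OF dec, of \<pi>]
    show False
    proof (cases "k = 1")
      case True
      then show ?thesis using bW bR sumV sumV' dimV' pos by simp
    next
      case False
      then have k2: "k = 2" and deg1: "Polynomial.degree \<pi> = 1" and "odd N" and "\<exists>d. d \<in> D" using k by auto
      then obtain d where d: "d \<in> D" by blast
      have eW: "dim W = dim ((\<lambda>x. \<pi> \<diamondop> x) ` W) + 2 * Polynomial.degree \<pi>"
        and eR: "dim R = dim ((\<lambda>x. \<pi> \<diamondop> x) ` R) + 2 * Polynomial.degree \<pi>"
        using bW bR sumV sumV' dimV' k2 by simp_all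
      obtain n where n: "n \<le> N" "dim W = 2 * n"
        using sympl.dim_of_single_cell[OF sW \<pi>(2,3) nilW nz(1) eW] deg1 by auto
      obtain n' where n': "n' \<le> N" "dim R = 2 * n'"
        using sympl.dim_of_single_cell[OF sR \<pi>(2,3) nilR nz(2) eR] deg1 by auto
      have "n = N" using n n' sumV dimV k2 deg1 by simp
      \<comment> \<open>The zeroth power of u - d is the identity, so the rank statement concerns
        the dimension of \<open>W\<close>.\<close>
      have "4 dvd dim W"
        using sympl.four_dvd_dim_image[OF sW dW irr_p D[OF d], of 0] by simp
      then show ?thesis using n(2) \<open>n = N\<close> \<open>odd N\<close> by presburger
    qed
  qed
qed

end


section \<open>Coordinates, dual bases and the symplectic extension\<close>

lemma fd_space_coordinates:
  fixes V :: "('a::field, 'v::ab_group_add, 'm) vspace_scheme"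
  assumes "fd_space V" "ordered_basis V n e"
  obtains co where "\<And>i. i < n \<Longrightarrow> co i \<in> vectors (dual V)"
    "\<And>i j. i < n \<Longrightarrow> j < n \<Longrightarrow> co i (e j) = (if i = j then 1 else 0)"
    "\<And>x. x \<in> vectors V \<Longrightarrow> x = (\<Sum>i<n. scale V (co i x) (e i))" "\<And>i. i < n \<Longrightarrow> e i \<in> vectors V"
proof -
  interpret vector_space "scale V" using assms(1) by (simp add: fd_space_def)
  define B where "B = e ` {..<n}"
  have B: "inj_on e {..<n}" "independent B" "span B = vectors V"
    using assms(2) by (auto simp: ordered_basis_def B_def)
  have sub: "subspace (vectors V)" using assms(1) by (simp add: fd_space_def)
  have eB: "e i \<in> B" if "i < n" for i using that by (simp add: B_def)
  define co where "co = (\<lambda>i x. if x \<in> vectors V then representation B x (e i) else 0)"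
  have eV: "e i \<in> vectors V" if "i < n" for i using eB[OF that] B(3) span_base by blast
  have "co i \<in> vectors (dual V)" for i
    using subspace_add[OF sub] subspace_scale[OF sub]
    by (auto simp: dual_def linear_map_def ground_def co_def representation_add[OF B(2)]
        representation_scale[OF B(2)] B(3))
  moreover have "co i (e j) = (if i = j then 1 else 0)" if "i < n" "j < n" for i j
    using that eV eB B(1) by (auto simp: co_def representation_basis[OF B(2)] inj_on_def)
  moreover have "x = (\<Sum>i<n. scale V (co i x) (e i))" if "x \<in> vectors V" for x
  proof -
    have "(\<Sum>i<n. scale V (co i x) (e i)) = (\<Sum>v\<in>B. scale V (representation B x v) v)"
      unfolding B_def sum.reindex[OF B(1)] using that by (simp add: co_def B_def)
    also have "\<dots> = x" using that B by (intro sum_representation_eq) (auto simp: B_def)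
    finally show ?thesis by simp
  qed
  ultimately show ?thesis using that eV by blast
qed

lemma exists_ordered_basis:
  fixes V :: "('a::field, 'v::ab_group_add, 'm) vspace_scheme"
  assumes "fd_space V"
  obtains n e where "ordered_basis V n e"
proof -
  interpret scalar_space "scale V" using assms by (simp add: fd_space_def scalar_space_def)
  have "finitely_spanned (vectors V)" "subspace (vectors V)"
    using assms by (auto simp: fd_space_def finitely_spanned_def)
  then obtain B where B: "finite B" "independent B" "span B = vectors V"
    using finitely_spanned_basis by metis
  obtain e where "bij_betw e {..<card B} B"
    using B(1) ex_bij_betw_nat_finite lessThan_atLeast0 by metis
  then have "ordered_basis V (card B) e"
    using B by (simp add: ordered_basis_def bij_betw_def)
  then show ?thesis by (rule that)
qed

text \<open>The coordinate forms of a basis do both jobs on the dual side: they span it, which gives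
  finite dimension, and they separate vectors, which gives non-degeneracy.\<close>

lemma symplectic_extension_sympl:
  fixes V :: "('a::field, 'v::ab_group_add) vspace"
  assumes V: "fd_space V" "linear_map V V v"
  shows "sympl (scale (symplectic_extension V v)) (vectors (symplectic_extension V v))
    (endo (symplectic_extension V v)) (form (symplectic_extension V v))"
proof -
  interpret V: vector_space "scale V" using V(1) by (simp add: fd_space_def)
  have sub: "V.subspace (vectors V)" using V(1) by (simp add: fd_space_def)
  have VV: "x \<in> vectors V \<Longrightarrow> y \<in> vectors V \<Longrightarrow> x + y \<in> vectors V"
    "x \<in> vectors V \<Longrightarrow> scale V c x \<in> vectors V" "0 \<in> vectors V" for x y c
    using sub by (simp_all add: V.subspace_add V.subspace_scale V.subspace_0)
  have v: "x \<in> vectors V \<Longrightarrow> v x \<in> vectors V"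
    "x \<in> vectors V \<Longrightarrow> y \<in> vectors V \<Longrightarrow> v (x + y) = v x + v y"
    "x \<in> vectors V \<Longrightarrow> v (scale V c x) = scale V c (v x)" for x y c
    using V(2) by (simp_all add: linear_map_def)
  have dual: "\<phi> \<in> vectors (dual V) \<Longrightarrow> x \<in> vectors V \<Longrightarrow> y \<in> vectors V \<Longrightarrow> \<phi> (x + y) = \<phi> x + \<phi> y"
    "\<phi> \<in> vectors (dual V) \<Longrightarrow> x \<in> vectors V \<Longrightarrow> \<phi> (scale V c x) = c * \<phi> x" for \<phi> x y c
    by (simp_all add: dual_def linear_map_def ground_def)
  have outside: "\<phi> x = 0" if "\<phi> \<in> vectors (dual V)" "x \<notin> vectors V" for \<phi> x
    using that by (simp add: dual_def)
  have dualI: "\<phi> \<in> vectors (dual V)"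
    if "\<And>x y. x \<in> vectors V \<Longrightarrow> y \<in> vectors V \<Longrightarrow> \<phi> (x + y) = \<phi> x + \<phi> y"
      "\<And>c x. x \<in> vectors V \<Longrightarrow> \<phi> (scale V c x) = c * \<phi> x" "\<And>x. x \<notin> vectors V \<Longrightarrow> \<phi> x = 0" for \<phi>
    using that by (simp add: dual_def linear_map_def ground_def)
  let ?S = "symplectic_extension V v"
  let ?sc = "\<lambda>c. map_prod (scale V c) (\<lambda>\<phi> x. c * \<phi> x)"
  have S: "scale ?S = ?sc" "vectors ?S = vectors V \<times> vectors (dual V)"
    "endo ?S = map_prod v (transpose_map V v)" "form ?S = (\<lambda>(x, \<phi>) (y, \<psi>). \<phi> y - \<psi> x)"
    by (simp_all add: symplectic_extension_def dual_def)
  have vs: "vector_space ?sc"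
    by unfold_locales (auto simp: fun_eq_iff algebra_simps)
  interpret S: scalar_space ?sc using vs by (simp add: scalar_space_def)
  have dadd: "\<phi> + \<psi> \<in> vectors (dual V)" if "\<phi> \<in> vectors (dual V)" "\<psi> \<in> vectors (dual V)" for \<phi> \<psi>
    by (rule dualI) (use that in \<open>simp_all add: dual outside algebra_simps\<close>)
  have dscale: "(\<lambda>x. c * \<phi> x) \<in> vectors (dual V)" if "\<phi> \<in> vectors (dual V)" for \<phi> c
    by (rule dualI) (use that in \<open>simp_all add: dual outside algebra_simps\<close>)
  have dtr: "transpose_map V v \<phi> \<in> vectors (dual V)" if "\<phi> \<in> vectors (dual V)" for \<phi>
    by (rule dualI) (use that v VV in \<open>auto simp: transpose_map_def dual\<close>)
  have d0: "0 \<in> vectors (dual V)" by (rule dualI) simp_all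
  obtain n e where e: "ordered_basis V n e" using exists_ordered_basis[OF V(1)] .
  obtain co where co: "\<And>i. i < n \<Longrightarrow> co i \<in> vectors (dual V)"
    "\<And>i j. i < n \<Longrightarrow> j < n \<Longrightarrow> co i (e j) = (if i = j then 1 else 0)"
    "\<And>x. x \<in> vectors V \<Longrightarrow> x = (\<Sum>i<n. scale V (co i x) (e i))" "\<And>i. i < n \<Longrightarrow> e i \<in> vectors V"
    by (rule fd_space_coordinates[OF V(1) e]) (rule that)
  have dual_sum: "\<phi> (\<Sum>i<m. scale V (c i) (e i)) = (\<Sum>i<m. c i * \<phi> (e i))"
    if "\<phi> \<in> vectors (dual V)" "m \<le> n" for \<phi> c m
    using that(2)
  proof (induction m)
    case 0
    have "\<phi> 0 = 0" using dual(2)[OF that(1) VV(3), of 0] by simp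
    then show ?case by simp
  next
    case (Suc m)
    have "(\<Sum>i<m. scale V (c i) (e i)) \<in> vectors V"
      using Suc.prems co(4) VV by (intro V.subspace_sum[OF sub]) auto
    then show ?case using Suc co(4)[of m] VV by (simp add: dual[OF that(1)])
  qed
  have dual_exp: "\<phi> x = (\<Sum>i<n. co i x * \<phi> (e i))" if "\<phi> \<in> vectors (dual V)" "x \<in> vectors V" for \<phi> x
    using dual_sum[OF that(1) order_refl, of "\<lambda>i. co i x"] co(3)[OF that(2)] by simp
  have psum: "(\<Sum>i\<in>I. (g i, h i)) = (\<Sum>i\<in>I. g i, \<Sum>i\<in>I. h i)" for I :: "nat set" and g :: "nat \<Rightarrow> 'v" and h :: "nat \<Rightarrow> 'v \<Rightarrow> 'a"
    by (induction I rule: infinite_finite_induct) (auto simp: zero_prod_def)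
  have fsum: "(\<Sum>i\<in>I. h i) x = (\<Sum>i\<in>I. h i x)" for I :: "nat set" and h :: "nat \<Rightarrow> 'v \<Rightarrow> 'a" and x
    by (induction I rule: infinite_finite_induct) auto
  show ?thesis unfolding S
  proof (intro sympl.intro endo_space.intro sympl_axioms.intro endo_space_axioms.intro)
    show "scalar_space ?sc" by (rule S.scalar_space_axioms)
    show "S.subspace (vectors V \<times> vectors (dual V))"
      unfolding S.subspace_def using VV V.subspace_0[OF sub] d0 dadd dscale by (auto simp: zero_prod_def)
    show "map_prod v (transpose_map V v) z \<in> vectors V \<times> vectors (dual V)"
      if "z \<in> vectors V \<times> vectors (dual V)" for z using that v dtr by auto
    show "map_prod v (transpose_map V v) (x + y) = map_prod v (transpose_map V v) x + map_prod v (transpose_map V v) y"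
      if "x \<in> vectors V \<times> vectors (dual V)" "y \<in> vectors V \<times> vectors (dual V)" for x y
      using that v by (auto simp: transpose_map_def fun_eq_iff)
    show "map_prod v (transpose_map V v) (?sc c x) = ?sc c (map_prod v (transpose_map V v) x)"
      if "x \<in> vectors V \<times> vectors (dual V)" for c x
      using that v by (auto simp: transpose_map_def fun_eq_iff)
    show "S.finitely_spanned (vectors V \<times> vectors (dual V))"
      unfolding S.finitely_spanned_def
    proof (intro exI conjI)
      let ?B = "(\<lambda>i. (e i, 0)) ` {..<n} \<union> (\<lambda>i. (0, co i)) ` {..<n}"
      show "finite ?B" by simp
      show "vectors V \<times> vectors (dual V) \<subseteq> S.span ?B"
      proof clarify
        fix x \<phi> assume x: "x \<in> vectors V" and \<phi>: "\<phi> \<in> vectors (dual V)"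
        have "\<phi> = (\<Sum>i<n. (\<lambda>x. \<phi> (e i) * co i x))"
        proof
          fix y show "\<phi> y = (\<Sum>i<n. (\<lambda>x. \<phi> (e i) * co i x)) y"
            using dual_exp[OF \<phi>] outside[OF \<phi>] outside[OF co(1)]
            by (cases "y \<in> vectors V") (simp_all add: fsum mult.commute)
        qed
        then have "(x, \<phi>) = (\<Sum>i<n. ?sc (co i x) (e i, 0)) + (\<Sum>i<n. ?sc (\<phi> (e i)) (0, co i))"
          using co(3)[OF x] by (simp add: psum zero_fun_def sum.neutral_const) (simp add: fun_eq_iff fsum)
        also have "\<dots> \<in> S.span ?B"
          by (intro S.span_add S.span_sum S.span_scale S.span_base) auto
        finally show "(x, \<phi>) \<in> S.span ?B" .
      qed
    qed
    show "(case x of (x, \<phi>) \<Rightarrow> \<lambda>(y, \<psi>). \<phi> y - \<psi> x) (map_prod v (transpose_map V v) x) = 0"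
      if "x \<in> vectors V \<times> vectors (dual V)" for x
      using that by (auto simp: transpose_map_def)
    show "x = 0" if x: "x \<in> vectors V \<times> vectors (dual V)"
      "\<And>y. y \<in> vectors V \<times> vectors (dual V) \<Longrightarrow> (case x of (x, \<phi>) \<Rightarrow> \<lambda>(y, \<psi>). \<phi> y - \<psi> x) y = 0" for x
    proof -
      obtain a \<phi> where a: "x = (a, \<phi>)" "a \<in> vectors V" "\<phi> \<in> vectors (dual V)" using x(1) by auto
      have "\<phi> y = 0" for y
        using x(2)[of "(y, 0)"] a outside[OF a(3), of y] d0 by (cases "y \<in> vectors V") auto
      moreover have "co i a = 0" if "i < n" for i
        using x(2)[of "(0, co i)"] a co(1)[OF that] V.subspace_0[OF sub] \<open>\<And>y. \<phi> y = 0\<close> by auto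
      then have "a = 0" using co(3)[OF a(2)] by simp
      ultimately show ?thesis using a(1) by (auto simp: zero_prod_def)
    qed
  qed (auto simp: dual algebra_simps)
qed

section \<open>Roots, norms and splitting fields of quadratic polynomials\<close>

lemma Root_quadratic: "x \<in> Root [:a, - k, 1:] \<longleftrightarrow> x * x = to_ac k * x - to_ac a"
  by (simp add: Root_def map_poly_pCons algebra_simps eq_neg_iff_add_eq_0 add_eq_0_iff2)

lemma quadratic_other_root:
  assumes "x \<in> Root [:a, - k, 1:]" "y \<in> Root [:a, - k, 1:]"
  shows "y = x \<or> y = to_ac k - x"
proof -
  have "(y - x) * (y - (to_ac k - x)) = y * y - to_ac k * y - (x * x - to_ac k * x)" by (simp add: algebra_simps)
  also have "\<dots> = 0" using assms by (simp add: Root_quadratic)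
  finally show ?thesis by auto
qed

lemma root_conj: "x \<in> Root [:a, - k, 1:] \<Longrightarrow> to_ac k - x \<in> Root [:a, - k, 1:]"
  by (simp add: Root_quadratic algebra_simps)

lemma Root_to_ac_iff: "to_ac d \<in> Root f \<longleftrightarrow> poly f d = 0"
proof -
  have "poly (map_poly to_ac f) (to_ac d) = to_ac (poly f d)"
    by (induction f) (auto simp: map_poly_pCons)
  then show ?thesis by (simp add: Root_def)
qed

lemma irreducible_quadratic_no_root:
  fixes f :: "'a::field poly"
  assumes "Factorial_Ring.irreducible f" "Polynomial.degree f = 2"
  shows "Root f \<inter> range to_ac = {}"
proof (rule ccontr)
  assume "Root f \<inter> range to_ac \<noteq> {}"
  then obtain d where "poly f d = 0" using Root_to_ac_iff by blast
  then obtain g where g: "f = [:- d, 1:] * g" by (auto simp: poly_eq_0_iff_dvd)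
  then have "g \<noteq> 0" using assms(1) by auto
  then have "Polynomial.degree g = 1" using g assms(2) by (simp add: degree_mult_eq del: mult_pCons_left)
  then show False using irreducibleD[OF assms(1) g] \<open>g \<noteq> 0\<close> by (auto simp: is_unit_iff_degree)
qed

lemma irreducible_quadratic:
  fixes a k :: "'a::field"
  assumes "x \<in> Root [:a, - k, 1:]" "x \<notin> range to_ac"
  shows "Factorial_Ring.irreducible [:a, - k, 1:]"
proof (rule irreducibleI)
  show "\<not> [:a, - k, 1:] dvd 1" by (simp add: is_unit_iff_degree)
  fix f g assume fg: "[:a, - k, 1:] = f * g"
  then have nz: "f \<noteq> 0" "g \<noteq> 0" by auto
  have deg: "Polynomial.degree f + Polynomial.degree g = 2"
    using arg_cong[OF fg, of Polynomial.degree] nz by (simp add: degree_mult_eq)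
  have nroot: "poly [:a, - k, 1:] d \<noteq> 0" for d
  proof
    assume "poly [:a, - k, 1:] d = 0"
    then have "to_ac d \<in> Root [:a, - k, 1:]" using Root_to_ac_iff by blast
    from quadratic_other_root[OF this assms(1)] have "x = to_ac d \<or> x = to_ac (k - d)" by simp
    then show False using assms(2) by blast
  qed
  have lin: False if "Polynomial.degree h = 1" "h dvd f * g" for h
  proof -
    define c e where "c = Polynomial.coeff h 0" and "e = Polynomial.coeff h 1"
    have "e \<noteq> 0" unfolding e_def using that(1) leading_coeff_neq_0[of h] by force
    moreover have "h = [:c, e:]"
      using that(1) by (intro poly_eqI) (auto simp: c_def e_def coeff_pCons coeff_eq_0 split: nat.splits)
    ultimately have h: "h = [:c, e:]" "e \<noteq> 0" by blast+
    then have "poly h (- c / e) = 0" by simp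
    then have "poly [:a, - k, 1:] (- c / e) = 0" using that(2) fg by (metis dvdE mult_zero_left poly_mult)
    then show False using nroot by blast
  qed
  have "Polynomial.degree f \<noteq> 1" using lin[of f] by auto
  then have "Polynomial.degree f = 0 \<or> Polynomial.degree g = 0" using deg by linarith
  then show "f dvd 1 \<or> g dvd 1" using nz by (auto simp: is_unit_iff_degree)
qed simp

lemma closure_ring_simps [simp]:
  "carrier (closure_ring :: 'a::field alg_closure ring) = UNIV"
  "x \<otimes>\<^bsub>(closure_ring :: 'a alg_closure ring)\<^esub> y = x * y"
  "x \<oplus>\<^bsub>(closure_ring :: 'a alg_closure ring)\<^esub> y = x + y"
  "\<one>\<^bsub>(closure_ring :: 'a alg_closure ring)\<^esub> = 1"
  "\<zero>\<^bsub>(closure_ring :: 'a alg_closure ring)\<^esub> = 0"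
  by (simp_all add: ring_of_type_algebra_def)

lemma closure_ring_a_inv [simp]: "\<ominus>\<^bsub>closure_ring\<^esub> (x :: 'a::field alg_closure) = - x"
proof -
  interpret ring "closure_ring :: 'a alg_closure ring" by (rule ring_from_type_algebra)
  show ?thesis by (rule minus_equality) auto
qed

lemma closure_ring_m_inv [simp]: "x \<noteq> 0 \<Longrightarrow> inv\<^bsub>closure_ring\<^esub> (x :: 'a::field alg_closure) = inverse x"
proof -
  assume "x \<noteq> 0"
  interpret field "closure_ring :: 'a alg_closure ring" by (rule field_from_type_algebra)
  show ?thesis using \<open>x \<noteq> 0\<close> by (intro comm_inv_char) auto
qed


section \<open>The quadratic extension generated by a root, its conjugation and its norm\<close>

locale quadratic_root =
  fixes a k :: "'a::field" and x :: "'a alg_closure"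
  assumes x: "x \<in> Root [:a, - k, 1:]" "x \<notin> range to_ac"
begin

lemma x_sq: "x * x = to_ac k * x - to_ac a"
  using x(1) by (simp add: Root_quadratic)

lemma comb_eq_0_iff: "to_ac r + to_ac s * x = 0 \<longleftrightarrow> r = 0 \<and> s = 0"
proof
  assume *: "to_ac r + to_ac s * x = 0"
  have "s = 0"
  proof (rule ccontr)
    assume "s \<noteq> 0"
    then have "x = to_ac (- r / s)" using * by (simp add: field_simps add_eq_0_iff)
    then show False using x(2) by blast
  qed
  then show "r = 0 \<and> s = 0" using * by simp
qed simp

lemma comb_eq_iff: "to_ac r + to_ac s * x = to_ac r' + to_ac s' * x \<longleftrightarrow> r = r' \<and> s = s'"
proof -
  have "to_ac r + to_ac s * x = to_ac r' + to_ac s' * x \<longleftrightarrow> to_ac (r - r') + to_ac (s - s') * x = 0"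
    by (simp add: algebra_simps)
  then show ?thesis by (simp add: comb_eq_0_iff del: to_ac_diff)
qed

lemma comb_mult:
  "(to_ac r + to_ac s * x) * (to_ac r' + to_ac s' * x) =
   to_ac (r * r' - s * s' * a) + to_ac (r * s' + s * r' + s * s' * k) * x"
proof -
  have "(to_ac r + to_ac s * x) * (to_ac r' + to_ac s' * x) =
      to_ac r * to_ac r' + (to_ac r * to_ac s' + to_ac s * to_ac r') * x + to_ac s * to_ac s' * (x * x)"
    by (simp add: algebra_simps)
  then show ?thesis unfolding x_sq by (simp add: algebra_simps)
qed

text \<open>The product (r + s x)(r + s (k - x)), expanded with x^2 = k x - a.\<close>

definition nrm :: "'a \<Rightarrow> 'a \<Rightarrow> 'a" where
  "nrm r s = r * r + r * s * k + s * s * a"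

lemma comb_mult_conj: "(to_ac r + to_ac s * x) * (to_ac (r + s * k) + to_ac (- s) * x) = to_ac (nrm r s)"
  unfolding comb_mult by (simp add: nrm_def algebra_simps)

lemma splitting_field_eq: "splitting_field [:a, - k, 1:] = {to_ac r + to_ac s * x |r s. True}"
proof
  show "splitting_field [:a, - k, 1:] \<subseteq> {to_ac r + to_ac s * x |r s. True}"
  proof
    fix y assume "y \<in> splitting_field [:a, - k, 1:]"
    then show "y \<in> {to_ac r + to_ac s * x |r s. True}"
      unfolding splitting_field_def
    proof (induction rule: generate_field.induct)
      case one
      have "1 = to_ac 1 + to_ac 0 * x" by simp
      then show ?case unfolding closure_ring_simps by blast
    next
      case (incl h)
      then consider d where "h = to_ac d" | "h \<in> Root [:a, - k, 1:]" by blast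
      then show ?case
      proof cases
        case 1
        then have "h = to_ac d + to_ac 0 * x" by simp
        then show ?thesis by blast
      next
        case 2
        then have "h = to_ac 0 + to_ac 1 * x \<or> h = to_ac k + to_ac (- 1) * x"
          using quadratic_other_root[OF x(1)] by auto
        then show ?thesis by blast
      qed
    next
      case (a_inv h)
      then obtain r s where "h = to_ac r + to_ac s * x" by blast
      then have "- h = to_ac (- r) + to_ac (- s) * x" by simp
      then show ?case unfolding closure_ring_a_inv by blast
    next
      case (m_inv h)
      then obtain r s where h: "h = to_ac r + to_ac s * x" by blast
      have "h \<noteq> 0" using m_inv by simp
      \<comment> \<open>If the norm vanished, the conjugate would be zero, hence both coefficients
        and \<open>h\<close> too. The inverse is therefore the conjugate divided by the
        norm.\<close>
      have "nrm r s \<noteq> 0"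
      proof
        assume "nrm r s = 0"
        then have "to_ac (r + s * k) + to_ac (- s) * x = 0" using comb_mult_conj[of r s] h \<open>h \<noteq> 0\<close> by simp
        then have "r + s * k = 0" "s = 0" unfolding comb_eq_0_iff by auto
        then show False using h \<open>h \<noteq> 0\<close> by simp
      qed
      then have "h * (to_ac ((r + s * k) / nrm r s) + to_ac (- s / nrm r s) * x) = 1"
        using comb_mult_conj[of r s] unfolding h by (simp add: field_simps)
      then have "inverse h = to_ac ((r + s * k) / nrm r s) + to_ac (- s / nrm r s) * x" by (rule inverse_unique)
      then show ?case unfolding closure_ring_m_inv[OF \<open>h \<noteq> 0\<close>] by blast
    next
      case (eng_add h h')
      then obtain r s r' s' where "h = to_ac r + to_ac s * x" "h' = to_ac r' + to_ac s' * x" by blast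
      then have "h + h' = to_ac (r + r') + to_ac (s + s') * x" by (simp add: algebra_simps)
      then show ?case unfolding closure_ring_simps by blast
    next
      case (eng_mult h h')
      then obtain r s r' s' where "h = to_ac r + to_ac s * x" "h' = to_ac r' + to_ac s' * x" by blast
      then have "h * h' = to_ac (r * r' - s * s' * a) + to_ac (r * s' + s * r' + s * s' * k) * x"
        by (simp only: comb_mult)
      then show ?case unfolding closure_ring_simps by blast
    qed
  qed
  show "{to_ac r + to_ac s * x |r s. True} \<subseteq> splitting_field [:a, - k, 1:]"
  proof clarify
    fix r s
    have "to_ac r \<in> splitting_field [:a, - k, 1:]" "to_ac s \<in> splitting_field [:a, - k, 1:]"
      "x \<in> splitting_field [:a, - k, 1:]"
      unfolding splitting_field_def using x by (auto intro: generate_field.incl)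
    then show "to_ac r + to_ac s * x \<in> splitting_field [:a, - k, 1:]"
      unfolding splitting_field_def
      using generate_field.eng_mult[of "to_ac s" closure_ring _ x]
        generate_field.eng_add[of "to_ac r" closure_ring _ "to_ac s * x"] by simp
  qed
qed

definition L :: "'a alg_closure set" where "L = {to_ac r + to_ac s * x |r s. True}"

lemma LI: "to_ac r + to_ac s * x \<in> L"
  unfolding L_def by blast

lemma to_ac_in_L: "to_ac r \<in> L" and x_in_L: "x \<in> L"
  using LI[of r 0] LI[of 0 1] by simp_all

lemma LE: "z \<in> L \<Longrightarrow> (\<And>r s. z = to_ac r + to_ac s * x \<Longrightarrow> thesis) \<Longrightarrow> thesis"
  unfolding L_def by blast

text \<open>The substitution x \<mapsto> k - x, defined through the coordinates, which are unique on
  \<open>L\<close>; it is thus meaningful also when the two roots coincide, and then it is the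
  identity on \<open>L\<close>.\<close>

definition conj :: "'a alg_closure \<Rightarrow> 'a alg_closure" where
  "conj z = (THE y. \<exists>r s. z = to_ac r + to_ac s * x \<and> y = to_ac (r + s * k) + to_ac (- s) * x)"

lemma conj_comb: "conj (to_ac r + to_ac s * x) = to_ac (r + s * k) + to_ac (- s) * x"
  unfolding conj_def by (rule the_equality) (auto simp: comb_eq_iff)

lemma conj_in_automorphisms: "conj \<in> automorphisms L"
proof -
  have cl: "conj z \<in> L" if "z \<in> L" for z using that by (auto elim!: LE simp: conj_comb intro: LI simp del: to_ac_add to_ac_minus)
  have inv: "conj (conj z) = z" if z: "z \<in> L" for z
  proof -
    obtain r s where "z = to_ac r + to_ac s * x" using z by (rule LE)
    then show ?thesis by (simp only: conj_comb) simp
  qed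
  have "conj \<in> Ring.ring_hom (closure_ring\<lparr>carrier := L\<rparr>) (closure_ring\<lparr>carrier := L\<rparr>)"
  proof (rule ring_hom_memI)
    fix y z assume "y \<in> carrier (closure_ring\<lparr>carrier := L\<rparr>)" "z \<in> carrier (closure_ring\<lparr>carrier := L\<rparr>)"
    then obtain r s r' s' where yz: "y = to_ac r + to_ac s * x" "z = to_ac r' + to_ac s' * x"
      by (auto elim!: LE)
    have "conj (y * z) = conj y * conj z"
      unfolding yz conj_comb comb_mult by (simp add: comb_eq_iff algebra_simps del: to_ac_add to_ac_minus to_ac_mult to_ac_diff)
    moreover have "y + z = to_ac (r + r') + to_ac (s + s') * x" using yz by (simp add: algebra_simps)
    then have "conj (y + z) = conj y + conj z"
      by (simp only: conj_comb yz) (simp add: algebra_simps)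
    ultimately show "conj (y \<otimes>\<^bsub>closure_ring\<lparr>carrier := L\<rparr>\<^esub> z) = conj y \<otimes>\<^bsub>closure_ring\<lparr>carrier := L\<rparr>\<^esub> conj z"
      "conj (y \<oplus>\<^bsub>closure_ring\<lparr>carrier := L\<rparr>\<^esub> z) = conj y \<oplus>\<^bsub>closure_ring\<lparr>carrier := L\<rparr>\<^esub> conj z"
      by simp_all
  qed (use cl conj_comb[of 1 0] in auto)
  moreover have "bij_betw conj L L"
    by (rule bij_betwI[where g = conj]) (use cl inv in auto)
  moreover have "conj (to_ac c) = to_ac c" for c using conj_comb[of c 0] by simp
  ultimately show ?thesis by (simp add: automorphisms_def ring_iso_def)
qed

lemma automorphism_eq_conj:
  assumes \<sigma>: "\<sigma> \<in> automorphisms L" "\<exists>z\<in>L. \<sigma> z \<noteq> z" and "z \<in> L"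
  shows "\<sigma> z = conj z"
proof -
  have hom: "\<sigma> \<in> Ring.ring_hom (closure_ring\<lparr>carrier := L\<rparr>) (closure_ring\<lparr>carrier := L\<rparr>)"
    and fixed: "\<sigma> (to_ac c) = to_ac c" for c
    using \<sigma>(1) by (auto simp: automorphisms_def ring_iso_def)
  have add: "\<sigma> (y + z) = \<sigma> y + \<sigma> z" and mult: "\<sigma> (y * z) = \<sigma> y * \<sigma> z" if "y \<in> L" "z \<in> L" for y z
    using ring_hom_add[OF hom, of y z] ring_hom_mult[OF hom, of y z] that by simp_all
  have comb: "\<sigma> (to_ac r + to_ac s * x) = to_ac r + to_ac s * \<sigma> x" for r s
    using add[of "to_ac r" "to_ac s * x"] mult[of "to_ac s" x] LI[of 0 s] to_ac_in_L x_in_L fixed by simp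
  have "\<sigma> x * \<sigma> x = \<sigma> (x * x)" using mult x_in_L by simp
  also have "\<dots> = \<sigma> (to_ac (- a) + to_ac k * x)" by (simp add: x_sq)
  also have "\<dots> = to_ac k * \<sigma> x - to_ac a" unfolding comb by simp
  finally have "\<sigma> x \<in> Root [:a, - k, 1:]" by (simp add: Root_quadratic)
  then have "\<sigma> x = x \<or> \<sigma> x = to_ac k - x" by (rule quadratic_other_root[OF x(1)])
  moreover have "\<sigma> x \<noteq> x"
  proof
    assume "\<sigma> x = x"
    then have "\<sigma> z = z" if "z \<in> L" for z using that comb by (auto elim!: LE)
    then show False using \<sigma>(2) by blast
  qed
  ultimately have \<sigma>x: "\<sigma> x = to_ac k - x" by blast
  obtain r s where z: "z = to_ac r + to_ac s * x" using \<open>z \<in> L\<close> by (rule LE)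
  show ?thesis unfolding z conj_comb comb \<sigma>x by (simp add: algebra_simps)
qed

lemma rsquarefree_linear_product:
  assumes "(w :: 'b::field) \<noteq> w'"
  shows "rsquarefree ([:- w, 1:] * [:- w', 1:])"
proof -
  have lin: "order c [:- v, 1:] = (if c = v then 1 else 0)" for c v :: 'b
    using order_power_n_n[of v 1] by (auto intro: order_0I)
  have "order c ([:- w, 1:] * [:- w', 1:]) = order c [:- w, 1:] + order c [:- w', 1:]" for c
    by (rule order_mult) (simp del: mult_pCons_left mult_pCons_right)
  then show ?thesis using assms by (auto simp: rsquarefree_def lin simp del: mult_pCons_left mult_pCons_right)
qed

text \<open>A polynomial over F vanishing at \<open>x\<close> is a multiple of the quadratic, so a
  double root of the quadratic stays a multiple root. Conversely, r + s x with s nonzero differs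
  from its conjugate by s (x - (k - x)), so its own quadratic has distinct roots.\<close>

lemma separable_iff: "separable_over_base L \<longleftrightarrow> x \<noteq> to_ac k - x"
proof
  assume "separable_over_base L"
  then obtain r where r: "Factorial_Ring.irreducible r" "x \<in> Root r" "rsquarefree (map_poly to_ac r)"
    using x_in_L unfolding separable_over_base_def by blast
  let ?f = "[:a, - k, 1:]"
  have rem: "r mod ?f = 0"
  proof -
    define g where "g = r mod ?f"
    have "Polynomial.degree g < 2" unfolding g_def using degree_mod_less[of ?f r] by auto
    then have g: "g = [:Polynomial.coeff g 0, Polynomial.coeff g 1:]"
      by (intro poly_eqI) (auto simp: coeff_pCons coeff_eq_0 split: nat.splits)
    have "poly (map_poly to_ac r) x = poly (map_poly to_ac (?f * (r div ?f) + g)) x"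
      unfolding g_def mult_div_mod_eq ..
    also have "\<dots> = poly (map_poly to_ac ?f) x * poly (map_poly to_ac (r div ?f)) x + poly (map_poly to_ac g) x"
    proof -
      interpret h: map_poly_comm_semiring_hom "to_ac :: 'a \<Rightarrow> 'a alg_closure" by unfold_locales auto
      show ?thesis by (simp only: h.hom_add h.hom_mult poly_add poly_mult)
    qed
    finally have "poly (map_poly to_ac g) x = 0" using r(2) x(1) by (simp add: Root_def)
    then have "to_ac (Polynomial.coeff g 0) + to_ac (Polynomial.coeff g 1) * x = 0"
      by (subst (asm) g) (cases "Polynomial.coeff g (Suc 0) = 0"; simp add: Polynomial.map_poly_pCons mult.commute)
    then have "g = 0" unfolding comb_eq_0_iff by (subst g) simp
    then show ?thesis by (simp add: g_def)
  qed
  then obtain g where g: "r = ?f * g" by (metis dvd_eq_mod_eq_0 dvdE)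
  show "x \<noteq> to_ac k - x"
  proof
    assume eq: "x = to_ac k - x"
    then have k: "to_ac k = x + x" by (simp add: algebra_simps)
    have "map_poly to_ac ?f = [:- x, 1:] * [:- x, 1:]"
      using x_sq k by (simp add: map_poly_pCons algebra_simps)
    moreover have "map_poly to_ac r = map_poly to_ac ?f * map_poly to_ac g"
    proof -
      interpret h: map_poly_comm_semiring_hom "to_ac :: 'a \<Rightarrow> 'a alg_closure" by unfold_locales auto
      show ?thesis unfolding g by (rule h.hom_mult)
    qed
    ultimately have "[:- x, 1:] ^ 2 dvd map_poly to_ac r" by (simp add: power2_eq_square del: mult_pCons_left mult_pCons_right)
    moreover have "map_poly to_ac r \<noteq> 0" using r(3) by (simp add: rsquarefree_def)
    ultimately have "2 \<le> order x (map_poly to_ac r)" by (simp add: order_divides)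
    then show False using r(3) unfolding rsquarefree_def by (metis one_le_numeral not_numeral_le_zero numeral_le_one_iff semiring_norm(69))
  qed
next
  assume ne: "x \<noteq> to_ac k - x"
  show "separable_over_base L" unfolding separable_over_base_def
  proof
    fix w assume "w \<in> L"
    then obtain r s where w: "w = to_ac r + to_ac s * x" by (rule LE)
    show "\<exists>f. Factorial_Ring.irreducible f \<and> w \<in> Root f \<and> rsquarefree (map_poly to_ac f)"
    proof (cases "s = 0")
      case True
      have "order c [:- w, 1:] = (if c = w then 1 else 0)" for c
        using order_power_n_n[of w 1] by (auto intro: order_0I)
      then have "rsquarefree [:- w, 1:]" by (auto simp: rsquarefree_def)
      moreover have "Factorial_Ring.irreducible [:- r, 1:]" by (rule irreducible_linear_field_poly) simp
      ultimately show ?thesis using w True by (intro exI[of _ "[:- r, 1:]"]) (simp add: map_poly_pCons Root_def)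
    next
      case False
      define w' where "w' = to_ac (r + s * k) + to_ac (- s) * x"
      have prod: "w * w' = to_ac (nrm r s)" unfolding w w'_def by (rule comb_mult_conj)
      have sum: "w + w' = to_ac (r + (r + s * k))" unfolding w w'_def by (simp add: algebra_simps)
      have "w - w' = to_ac s * (x - (to_ac k - x))" unfolding w w'_def by (simp add: algebra_simps)
      then have "w \<noteq> w'" using ne False by auto
      let ?f = "[:nrm r s, - (r + (r + s * k)), 1:]"
      have f: "map_poly to_ac ?f = [:- w, 1:] * [:- w', 1:]"
      proof -
        have "map_poly to_ac [:m, n, 1:] = [:to_ac m, to_ac n, 1:]" for m n :: 'a
          by (simp add: map_poly_pCons)
        then have "map_poly to_ac ?f = [:w * w', - (w + w'), 1:]" by (simp only: prod sum to_ac_minus)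
        then show ?thesis by simp
      qed
      have root: "w \<in> Root ?f" unfolding Root_def f by simp
      have "w \<notin> range to_ac"
      proof
        assume "w \<in> range to_ac"
        then obtain c where "w = to_ac c + to_ac 0 * x" by auto
        then show False using w False comb_eq_iff by metis
      qed
      then have "Factorial_Ring.irreducible ?f" using root by (intro irreducible_quadratic)
      moreover have "rsquarefree (map_poly to_ac ?f)"
        unfolding f using \<open>w \<noteq> w'\<close> by (rule rsquarefree_linear_product)
      ultimately show ?thesis using root by blast
    qed
  qed
qed

text \<open>One formula covers both branches of \<open>quadratic_conj\<close>: in the inseparable
  case k - x = x, so the formula for the conjugate is the identity.\<close>

lemma quadratic_norm_comb:
  "quadratic_norm L (to_ac r + to_ac s * x) = to_ac (nrm r s)"
proof -
  have "quadratic_conj L (to_ac r + to_ac s * x) = to_ac (r + s * k) + to_ac (- s) * x"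
  proof (cases "separable_over_base L")
    case True
    define \<sigma> where "\<sigma> = quadratic_conj L"
    have "conj x \<noteq> x" using True conj_comb[of 0 1] by (simp add: separable_iff)
    then have "\<exists>\<sigma>. \<sigma> \<in> automorphisms L \<and> (\<exists>z\<in>L. \<sigma> z \<noteq> z)" using conj_in_automorphisms x_in_L by blast
    from someI_ex[OF this] have "\<sigma> \<in> automorphisms L \<and> (\<exists>z\<in>L. \<sigma> z \<noteq> z)"
      unfolding \<sigma>_def quadratic_conj_def using True by simp
    then show ?thesis using automorphism_eq_conj LI conj_comb unfolding \<sigma>_def by metis
  next
    case False
    then have eq: "to_ac k - x = x" by (simp add: separable_iff)
    have "to_ac (r + s * k) + to_ac (- s) * x = to_ac r + to_ac s * (to_ac k - x)" by (simp add: algebra_simps)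
    then have "to_ac (r + s * k) + to_ac (- s) * x = to_ac r + to_ac s * x" by (simp only: eq)
    then show ?thesis using False by (simp only: quadratic_conj_def if_False id_apply)
  qed
  then show ?thesis by (simp only: quadratic_norm_def comb_mult_conj)
qed

text \<open>The condition on r and s says that \<open>y\<close> has trace \<open>l\<close>. It
  results from comparing the x-coefficients in y^2 = l y - e and cancelling s, which is nonzero as
  \<open>y\<close> lies outside F.\<close>

lemma root_in_L:
  assumes y: "y \<in> L" "y \<in> Root [:e, - l, 1:]" "y \<notin> range to_ac"
  obtains r s where "y = to_ac r + to_ac s * x" "s * k + (r + r) = l"
proof -
  obtain r s where rs: "y = to_ac r + to_ac s * x" using y(1) by (rule LE)
  have "s \<noteq> 0"
  proof
    assume "s = 0"
    then show False using rs y(3) by simp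
  qed
  have "y * y = to_ac (l * r - e) + to_ac (l * s) * x"
    using y(2) unfolding Root_quadratic by (simp add: rs algebra_simps)
  then have "r * s + s * r + s * s * k = l * s" unfolding rs comb_mult comb_eq_iff by simp
  then have "s * (s * k + (r + r)) = s * l" by (simp add: algebra_simps)
  then show ?thesis using that rs \<open>s \<noteq> 0\<close> by simp
qed

text \<open>The conjugate of x - y is (k - x) - (l - y), so x - y and its conjugate add up to k - l.
  Hence x - y is a root of t^2 - (k - l) t + c with its norm c, which lies in F because
  \<open>y\<close> lies in F(x).\<close>

lemma difference_norm:
  assumes y: "y \<in> L" "y \<in> Root [:e, - l, 1:]" "y \<notin> range to_ac"
  obtains c where "quadratic_norm L (x - y) = to_ac c" "(x - y) * (to_ac (k - l) - (x - y)) = to_ac c"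
proof -
  obtain r s where rs: "y = to_ac r + to_ac s * x" "s * k + (r + r) = l" using root_in_L[OF y] .
  have diff: "x - y = to_ac (- r) + to_ac (1 - s) * x" unfolding rs by (simp add: algebra_simps)
  have "k - l - (- r) = - r + (1 - s) * k" using rs(2)[symmetric] by (simp add: algebra_simps)
  then have kl: "k - l + r = - r + (1 - s) * k" by simp
  have "to_ac (k - l) - (x - y) = to_ac (k - l + r) + to_ac (- (1 - s)) * x"
    unfolding diff by (simp add: algebra_simps)
  then have "to_ac (k - l) - (x - y) = to_ac (- r + (1 - s) * k) + to_ac (- (1 - s)) * x"
    unfolding kl .
  then have "(x - y) * (to_ac (k - l) - (x - y)) = to_ac (nrm (- r) (1 - s))"
    by (simp only: diff comb_mult_conj)
  moreover have "quadratic_norm L (x - y) = to_ac (nrm (- r) (1 - s))" unfolding diff by (rule quadratic_norm_comb)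
  ultimately show ?thesis by (rule that[rotated])
qed

text \<open>The two equations say that the quadratic of \<open>y\<close> is the quadratic of
  \<open>x\<close> taken at t + d.\<close>

lemma difference_in_base:
  assumes y: "y \<in> L" "y \<in> Root [:e, - l, 1:]" "y \<notin> range to_ac" and d: "x - y = to_ac d"
  shows "l = k - (d + d)" "e = a - d * k + d * d"
proof -
  obtain r s where rs: "y = to_ac r + to_ac s * x" "s * k + (r + r) = l" using root_in_L[OF y] .
  have yd: "y = to_ac (- d) + to_ac 1 * x" using d by (simp add: algebra_simps)
  then have "r = - d" "s = 1" using rs(1) comb_eq_iff by metis+
  then show l: "l = k - (d + d)" using rs(2) by (simp add: algebra_simps)
  have "to_ac e = to_ac l * y - y * y" using y(2) unfolding Root_quadratic by simp
  also have "\<dots> = to_ac (l * (- d)) + to_ac l * x - (to_ac (d * d - a) + to_ac (- d + - d + k) * x)"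
    unfolding yd comb_mult by (simp add: algebra_simps)
  also have "\<dots> = to_ac (l * (- d) - (d * d - a))" unfolding l by (simp add: algebra_simps)
  finally have "e = l * (- d) - (d * d - a)" by (simp only: to_ac_eq_iff)
  then show "e = a - d * k + d * d" unfolding l by (simp add: algebra_simps)
qed

end

section \<open>Symplectic extensions\<close>

lemma pair_sum: "(\<Sum>i\<in>I. (g i, h i)) = (\<Sum>i\<in>I. g i, \<Sum>i\<in>I. h i)"
  by (induction I rule: infinite_finite_induct) (auto simp: zero_prod_def)

lemma block_index_less: "q < k \<Longrightarrow> j < n \<Longrightarrow> q * n + j < k * (n :: nat)"
proof -
  assume "q < k" "j < n"
  then have "q * n + j < Suc q * n" by simp
  also have "\<dots> \<le> k * n" using \<open>q < k\<close> by (intro mult_le_mono1) simp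
  finally show ?thesis .
qed

lemma block_index_eq:
  assumes "j < n" "j' < (n :: nat)"
  shows "q * n + j = q' * n + j' \<longleftrightarrow> q = q' \<and> j = j'"
proof
  assume eq: "q * n + j = q' * n + j'"
  have "(q * n + j) div n = q" "(q' * n + j') div n = q'" using assms by auto
  then show "q = q' \<and> j = j'" using eq by auto
qed simp

text \<open>In block q the cyclic vector \<open>e (q * n)\<close> is paired with the form reading
  the last coordinate of the block: on the j-th iterate of the vector this form is 1 for j = n - 1
  and 0 before, which is the behaviour of \<open>top_coeff\<close>.\<close>

lemma symplectic_extension_frame:
  fixes V :: "('a::field, 'v::ab_group_add) vspace"
  assumes V: "fd_space V" "linear_map V V v" and e: "ordered_basis V (k * n) e"
    and s: "Polynomial.lead_coeff s = 1" "Polynomial.degree s = n" "n > 0"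
    and shift: "\<And>q j. q < k \<Longrightarrow> Suc j < n \<Longrightarrow> v (e (q * n + j)) = e (q * n + Suc j)"
    and last: "\<And>q. q < k \<Longrightarrow>
      v (e (q * n + (n - 1))) = (\<Sum>i<n. scale V (- Polynomial.coeff s i) (e (q * n + i)))"
  defines "S \<equiv> symplectic_extension V v"
  shows "\<exists>z. sympl.frame (scale S) (vectors S) (endo S) (form S) s k z \<and>
    endo_space.gen (scale S) (endo S) (2 * k) z = vectors S"
proof -
  interpret V: vector_space "scale V" using V(1) by (simp add: fd_space_def)
  interpret S: sympl "scale S" "vectors S" "endo S" "form S"
    unfolding S_def by (rule symplectic_extension_sympl[OF V])
  have subV: "V.subspace (vectors V)" using V(1) by (simp add: fd_space_def)
  have SS: "scale S c (x, \<phi>) = (scale V c x, \<lambda>y. c * \<phi> y)" "vectors S = vectors V \<times> vectors (dual V)"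
    "endo S (x, \<phi>) = (v x, transpose_map V v \<phi>)" "form S (x, \<phi>) (y, \<psi>) = \<phi> y - \<psi> x" for c x y \<phi> \<psi>
    by (simp_all add: S_def symplectic_extension_def dual_def)
  obtain co where co: "\<And>i. i < k * n \<Longrightarrow> co i \<in> vectors (dual V)"
    "\<And>i j. i < k * n \<Longrightarrow> j < k * n \<Longrightarrow> co i (e j) = (if i = j then 1 else 0)"
    "\<And>x. x \<in> vectors V \<Longrightarrow> x = (\<Sum>i<k * n. scale V (co i x) (e i))" "\<And>i. i < k * n \<Longrightarrow> e i \<in> vectors V"
    by (rule fd_space_coordinates[OF V(1) e]) (rule that)
  have d0: "0 \<in> vectors (dual V)" by (simp add: dual_def linear_map_def ground_def)
  have v0: "v 0 = 0"
  proof -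
    have "v (scale V 0 0) = scale V 0 (v 0)" using V(2) V.subspace_0[OF subV] unfolding linear_map_def by blast
    then show ?thesis by simp
  qed
  have zero_eval: "\<phi> 0 = 0" if "\<phi> \<in> vectors (dual V)" for \<phi>
  proof -
    have "\<forall>c. \<forall>x\<in>vectors V. \<phi> (scale V c x) = c * \<phi> x"
      using that by (simp add: dual_def linear_map_def ground_def)
    then have "\<phi> (scale V 0 0) = 0 * \<phi> 0" using V.subspace_0[OF subV] by blast
    then show ?thesis by simp
  qed
  have endo_left: "endo S (x, 0) = (v x, 0)" for x by (simp add: SS transpose_map_def fun_eq_iff)
  have in_S: "(x, 0) \<in> vectors S" if "x \<in> vectors V" for x using that d0 by (simp add: SS)
  have in_S': "(0, \<phi>) \<in> vectors S" if "\<phi> \<in> vectors (dual V)" for \<phi>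
    using that V.subspace_0[OF subV] by (simp add: SS)
  have left_sum: "(x, 0) = (\<Sum>i<k * n. scale S (co i x) (e i, 0))" if "x \<in> vectors V" for x
  proof -
    have "(\<lambda>y. c * (0::'v \<Rightarrow> 'a) y) = 0" for c by auto
    then show ?thesis using co(3)[OF that] by (simp add: SS pair_sum)
  qed
  have pow: "(endo S ^^ j) (e (q * n), 0) = (e (q * n + j), 0)" if "q < k" "j < n" for q j
    using that by (induction j) (auto simp: endo_left shift)
  have right: "\<exists>\<phi>'\<in>vectors (dual V). act (scale S) (endo S) f (0, \<phi>) = (0, \<phi>')" if "\<phi> \<in> vectors (dual V)" for f \<phi>
  proof -
    have sub: "S.subspace ({0::'v} \<times> vectors (dual V))"
    proof (rule S.subspaceI)
      show "0 \<in> {0::'v} \<times> vectors (dual V)" using d0 by (simp add: zero_prod_def)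
      show "x + y \<in> {0::'v} \<times> vectors (dual V)" if "x \<in> {0::'v} \<times> vectors (dual V)" "y \<in> {0::'v} \<times> vectors (dual V)" for x y
        using that S.V_add[of x y] V.subspace_0[OF subV] by (auto simp: SS)
      show "scale S c x \<in> {0::'v} \<times> vectors (dual V)" if "x \<in> {0::'v} \<times> vectors (dual V)" for c x
        using that S.V_scale[of x c] V.subspace_0[OF subV] by (auto simp: SS)
    qed
    have "act (scale S) (endo S) f (0, \<phi>) \<in> {0::'v} \<times> vectors (dual V)"
    proof (rule S.act_in_stable[OF sub])
      show "endo S z \<in> {0::'v} \<times> vectors (dual V)" if "z \<in> {0::'v} \<times> vectors (dual V)" for z
        using that S.u_in[of z] V.subspace_0[OF subV] v0 by (auto simp: SS)
    qed (use that in simp)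
    then show ?thesis by auto
  qed
  have ann_e: "act (scale S) (endo S) s (e (q * n), 0) = 0" if q: "q < k" for q
  proof -
    have top: "(endo S ^^ n) (e (q * n), 0) = (\<Sum>i<n. scale S (- Polynomial.coeff s i) (e (q * n + i), 0))"
    proof -
      obtain m where m: "n = Suc m" using s(3) by (cases n) auto
      have "(endo S ^^ n) (e (q * n), 0) = endo S ((endo S ^^ m) (e (q * n), 0))" unfolding m by simp
      also have "(endo S ^^ m) (e (q * n), 0) = (e (q * n + m), 0)" using pow[OF q, of m] m by simp
      also have "endo S \<dots> = (\<Sum>i<n. scale V (- Polynomial.coeff s i) (e (q * n + i)), 0)"
        unfolding endo_left using last[OF q] m by simp
      also have "\<dots> = (\<Sum>i<n. scale S (- Polynomial.coeff s i) (e (q * n + i), 0))"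
      proof -
        have "(\<lambda>y. c * (0::'v \<Rightarrow> 'a) y) = 0" for c by auto
        then show ?thesis by (simp add: SS pair_sum)
      qed
      finally show ?thesis .
    qed
    have "act (scale S) (endo S) s (e (q * n), 0) = (\<Sum>i<Suc n. scale S (Polynomial.coeff s i) ((endo S ^^ i) (e (q * n), 0)))"
      by (rule S.act_less) (simp add: s)
    also have "\<dots> = (\<Sum>i<n. scale S (Polynomial.coeff s i) (e (q * n + i), 0)) + (endo S ^^ n) (e (q * n), 0)"
      using s pow[OF q] by simp
    also have "\<dots> = 0" unfolding top by (simp add: S.scale_minus_left sum_negf)
    finally show ?thesis .
  qed
  have e_pow: "(e i, 0) = (endo S ^^ (i mod n)) (e (i div n * n), 0)" if "i < k * n" for i
    using pow[of "i div n" "i mod n"] that s(3) by (simp add: less_mult_imp_div_less)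
  have ann_left: "act (scale S) (endo S) s (x, 0) = 0" if "x \<in> vectors V" for x
  proof -
    have "act (scale S) (endo S) s (e i, 0) = 0" if i: "i < k * n" for i
    proof -
      have q: "i div n < k" using i by (simp add: less_mult_imp_div_less)
      then have "i div n * n < k * n" using s(3) by simp
      then have eS: "(e (i div n * n), 0) \<in> vectors S" using co(4) in_S by blast
      show ?thesis unfolding e_pow[OF i]
        using S.act_commute[OF eS, of s "Polynomial.monom 1 (i mod n)"] ann_e[OF q] by (simp add: S.act_monom)
    qed
    then have "(e i, 0) \<in> {z \<in> vectors S. act (scale S) (endo S) s z = 0}" if "i < k * n" for i using that co(4) in_S by blast
    then have "(\<Sum>i<k * n. scale S (co i x) (e i, 0)) \<in> {z \<in> vectors S. act (scale S) (endo S) s z = 0}"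
      by (intro S.subspace_sum[OF S.subspace_act_kernel] S.subspace_scale[OF S.subspace_act_kernel]) auto
    then show ?thesis using left_sum[OF that] by simp
  qed
  \<comment> \<open>By selfadjointness, \<open>s\<close> kills the linear forms because it kills the
    vectors.\<close>
  have ann_right: "act (scale S) (endo S) s (0, \<phi>) = 0" if \<phi>: "\<phi> \<in> vectors (dual V)" for \<phi>
  proof -
    obtain \<phi>' where \<phi>': "\<phi>' \<in> vectors (dual V)" "act (scale S) (endo S) s (0, \<phi>) = (0, \<phi>')" using right[OF \<phi>] by blast
    have "\<phi>' y = 0" for y
    proof (cases "y \<in> vectors V")
      case True
      have "\<phi>' y = form S (act (scale S) (endo S) s (0, \<phi>)) (y, 0)" unfolding \<phi>'(2) by (simp add: SS)
      also have "\<dots> = form S (0, \<phi>) (act (scale S) (endo S) s (y, 0))" using in_S[OF True] in_S'[OF \<phi>] by (rule S.b_act[rotated])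
      also have "\<dots> = 0" using ann_left[OF True] in_S'[OF \<phi>] by simp
      finally show ?thesis .
    qed (use \<phi>'(1) in \<open>simp add: dual_def\<close>)
    then show ?thesis unfolding \<phi>'(2) by (auto simp: zero_prod_def)
  qed
  define z where "z = (\<lambda>i. if even i then (e (i div 2 * n), 0) else (0, co (i div 2 * n + (n - 1))))"
  have idx: "i div 2 < k" if "i < 2 * k" for i using that by auto
  have first: "q * n < k * n" "q * n + (n - 1) < k * n" if "q < k" for q
    using that s(3) block_index_less[OF that, of "n - 1" n] by auto
  have z_in: "z i \<in> vectors S" if "i < 2 * k" for i
    using co(1,4) first idx[OF that] in_S in_S' by (simp add: z_def)
  have odd_even: "form S (z i) ((endo S ^^ j) (z l)) = std_gram i l * (if j = n - 1 then 1 else 0)"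
    if il: "i < 2 * k" "l < 2 * k" "j < n" "odd i" "even l" for i l j
  proof -
    have "form S (z i) ((endo S ^^ j) (z l)) = co (i div 2 * n + (n - 1)) (e (l div 2 * n + j)) - 0"
      using il by (simp add: z_def pow idx SS)
    also have "\<dots> = (if i div 2 * n + (n - 1) = l div 2 * n + j then 1 else 0)"
      unfolding co(2)[OF first(2)[OF idx[OF il(1)]] block_index_less[OF idx[OF il(2)] il(3)]] by simp
    also have "(i div 2 * n + (n - 1) = l div 2 * n + j) = (i div 2 = l div 2 \<and> n - 1 = j)"
      by (rule block_index_eq) (use il(3) s(3) in simp_all)
    also have "i div 2 = l div 2 \<longleftrightarrow> i = Suc l"
      using il(4,5) by (elim oddE evenE) simp
    finally have "form S (z i) ((endo S ^^ j) (z l)) = (if i = Suc l \<and> n - 1 = j then 1 else 0)" .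
    moreover have "std_gram i l = (if i = Suc l then 1 else 0 :: 'a)"
      using il(4,5) by (simp add: std_gram_def)
    ultimately show ?thesis by auto
  qed
  have fr: "S.frame s k z"
  proof (rule S.frameI)
    show "act (scale S) (endo S) s (z i) = 0" if "i < 2 * k" for i
      using that ann_left ann_right co(1,4) first idx[OF that] by (simp add: z_def)
    fix i l j assume il: "i < 2 * k" "l < 2 * k" and "j < Polynomial.degree s"
    then have j: "j < n" using s by simp
    have "form S (z i) ((endo S ^^ j) (z l)) = std_gram i l * (if j = n - 1 then 1 else 0)"
    proof (cases "even i"; cases "even l")
      assume "even i" "even l"
      then have "form S (z i) ((endo S ^^ j) (z l)) = 0" using il j by (simp add: z_def pow idx SS)
      moreover have "std_gram i l = (0::'a)" using \<open>even i\<close> \<open>even l\<close> by (auto simp: std_gram_def)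
      ultimately show ?thesis by simp
    next
      assume "odd i" "even l"
      then show ?thesis using odd_even il j by blast
    next
      assume "even i" "odd l"
      have "form S (z i) ((endo S ^^ j) (z l)) = form S ((endo S ^^ j) (z i)) (z l)"
        using S.b_funpow z_in il by blast
      also have "\<dots> = - form S (z l) ((endo S ^^ j) (z i))"
        using z_in il by (intro S.b_swap) auto
      finally show ?thesis
        using odd_even[OF il(2,1) j \<open>odd l\<close> \<open>even i\<close>] std_gram_swap[of i l, where 'a = 'a] by simp
    next
      assume "odd i" "odd l"
      have "co (l div 2 * n + (n - 1)) \<in> vectors (dual V)" using co(1) first(2) idx[OF il(2)] by blast
      then obtain \<phi> where \<phi>: "\<phi> \<in> vectors (dual V)" "(endo S ^^ j) (z l) = (0, \<phi>)"
        using right[of _ "Polynomial.monom 1 j"] \<open>odd l\<close> by (auto simp: z_def S.act_monom)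
      have co_i: "co (i div 2 * n + (n - 1)) \<in> vectors (dual V)" using co(1) first(2) idx[OF il(1)] by blast
      have "form S (z i) ((endo S ^^ j) (z l)) = 0"
        unfolding \<phi>(2) using \<open>odd i\<close> zero_eval[OF co_i] zero_eval[OF \<phi>(1)] by (simp add: z_def SS)
      moreover have "std_gram i l = (0::'a)" using \<open>odd i\<close> \<open>odd l\<close> by (auto simp: std_gram_def)
      ultimately show ?thesis by simp
    qed
    then show "form S (z i) ((endo S ^^ j) (z l)) =
        std_gram i l * (if j = Polynomial.degree s - 1 then 1 else 0)" using s by simp
  qed (use s z_in in auto)
  have e_gen: "(e i, 0) \<in> S.gen (2 * k) z" if i: "i < k * n" for i
  proof -
    have "i div n < k" using i by (simp add: less_mult_imp_div_less)
    then have "act (scale S) (endo S) (Polynomial.monom 1 (i mod n)) (z (2 * (i div n))) \<in> S.gen (2 * k) z"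
      by (intro S.act_base_gen) simp
    then show ?thesis unfolding e_pow[OF i] by (simp add: z_def S.act_monom)
  qed
  \<comment> \<open>A vector orthogonal to the generated subspace has a linear form vanishing on the
    basis, so it lies in the half \<open>V\<close>, which is already generated; non-degeneracy there
    finishes.\<close>
  have "S.gen (2 * k) z = vectors S"
    unfolding S.frame_gen_full_iff[OF fr]
  proof (intro ballI impI)
    fix r assume r: "r \<in> vectors S" and orth: "\<forall>i<2*k. \<forall>h. form S r (act (scale S) (endo S) h (z i)) = 0"
    obtain a \<psi> where a: "r = (a, \<psi>)" "a \<in> vectors V" "\<psi> \<in> vectors (dual V)" using r by (auto simp: SS)
    have perp: "form S r y = 0" if "y \<in> S.gen (2 * k) z" for y
      using that orth r z_in by (auto elim!: S.genE simp: S.b_sum_right_less)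
    have "\<psi> (e i) = 0" if "i < k * n" for i
      using perp[OF e_gen[OF that]] by (simp add: a SS)
    then have \<psi>e: "(e i, 0) \<in> {y \<in> vectors S. form S (0, \<psi>) y = 0}" if "i < k * n" for i
      using that co(4) d0 by (simp add: SS)
    have "\<psi> y = 0" for y
    proof (cases "y \<in> vectors V")
      case True
      have "form S (0, \<psi>) (\<Sum>i<k * n. scale S (co i y) (e i, 0)) = 0"
        using \<psi>e in_S'[OF a(3)] by (simp add: S.b_sum_right_less S.b_scale_right)
      then have "form S (0, \<psi>) (y, 0) = 0" using left_sum[OF True] by simp
      then show ?thesis by (simp add: SS)
    qed (use a(3) in \<open>simp add: dual_def\<close>)
    then have "\<psi> = 0" by auto
    then have "r = (\<Sum>i<k * n. scale S (co i a) (e i, 0))" using left_sum[OF a(2)] a(1) by simp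
    also have "\<dots> \<in> S.gen (2 * k) z"
      using e_gen S.subspace_frame_gen[OF fr] by (intro S.subspace_sum S.subspace_scale) auto
    finally show "r = 0" using S.frame_gen_nondegenerate[OF fr] perp by blast
  qed
  then show ?thesis using fr by blast
qed

text \<open>Index q n + i is place i in block q; the columns of a companion block become a shift and
  one closing relation.\<close>

lemma represented_by_blocks:
  assumes V: "fd_space V" and M: "represented_by V v M" "M \<in> carrier_mat (k * n) (k * n)"
    and n: "Polynomial.degree s = n" "n > 0"
    and entry: "\<And>q q' i j. \<lbrakk>q < k; q' < k; i < n; j < n\<rbrakk> \<Longrightarrow>
      M $$ (q * n + i, q' * n + j) = (if q = q' then companion_mat s $$ (i, j) else 0)"
  obtains e where "ordered_basis V (k * n) e"
    "\<And>q j. q < k \<Longrightarrow> Suc j < n \<Longrightarrow> v (e (q * n + j)) = e (q * n + Suc j)"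
    "\<And>q. q < k \<Longrightarrow> v (e (q * n + (n - 1))) = (\<Sum>i<n. scale V (- Polynomial.coeff s i) (e (q * n + i)))"
proof -
  interpret V: vector_space "scale V" using V by (simp add: fd_space_def)
  obtain m e where me: "M \<in> carrier_mat m m" "ordered_basis V m e"
    "\<forall>j<m. v (e j) = (\<Sum>i<m. scale V (M $$ (i, j)) (e i))"
    using M(1) unfolding represented_by_def by blast
  have "m = k * n" using me(1) M(2) by auto
  have comp: "companion_mat s $$ (i, j) =
      (if j = n - 1 then - Polynomial.coeff s i else if i = j + 1 then 1 else 0)" if "i < n" "j < n" for i j
    using that n by (simp add: companion_mat_def Let_def)
  have col: "v (e (q * n + j)) = (\<Sum>i<n. scale V (companion_mat s $$ (i, j)) (e (q * n + i)))"
    if q: "q < k" "j < n" for q j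
  proof -
    have "v (e (q * n + j)) = (\<Sum>i<k * n. scale V (M $$ (i, q * n + j)) (e i))"
      using me(3) \<open>m = k * n\<close> block_index_less[OF q] by simp
    also have "\<dots> = (\<Sum>i\<in>(\<lambda>i. q * n + i) ` {..<n}. scale V (M $$ (i, q * n + j)) (e i))"
    proof (rule sum.mono_neutral_right)
      show "(\<lambda>i. q * n + i) ` {..<n} \<subseteq> {..<k * n}" using block_index_less[OF q(1)] by auto
      show "\<forall>i\<in>{..<k * n} - (\<lambda>i. q * n + i) ` {..<n}. scale V (M $$ (i, q * n + j)) (e i) = 0"
      proof
        fix i assume i: "i \<in> {..<k * n} - (\<lambda>i. q * n + i) ` {..<n}"
        then have "i div n < k" "i mod n < n" using n by (auto simp: less_mult_imp_div_less)
        moreover have "i div n \<noteq> q"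
        proof
          assume "i div n = q"
          then have "i = q * n + i mod n" by auto
          then show False using i \<open>i mod n < n\<close> by blast
        qed
        ultimately have "M $$ (i div n * n + i mod n, q * n + j) = 0"
          using entry[of "i div n" q "i mod n" j] q by (simp only: if_False)
        then show "scale V (M $$ (i, q * n + j)) (e i) = 0" by simp
      qed
    qed simp
    also have "\<dots> = (\<Sum>i<n. scale V (M $$ (q * n + i, q * n + j)) (e (q * n + i)))"
      by (subst sum.reindex) (auto simp: inj_on_def)
    finally show ?thesis using entry q by simp
  qed
  have "v (e (q * n + j)) = e (q * n + Suc j)" if "q < k" "Suc j < n" for q j
  proof -
    have "v (e (q * n + j)) = (\<Sum>i<n. if i = Suc j then e (q * n + i) else 0)"
      unfolding col[OF that(1) Suc_lessD[OF that(2)]] using that(2) by (intro sum.cong) (auto simp: comp)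
    then show ?thesis using that(2) by simp
  qed
  moreover have "v (e (q * n + (n - 1))) = (\<Sum>i<n. scale V (- Polynomial.coeff s i) (e (q * n + i)))"
    if "q < k" for q
    using col[OF that, of "n - 1"] n(2) by (simp add: comp)
  ultimately show ?thesis using that me(2) \<open>m = k * n\<close> by blast
qed

text \<open>Meant for k = 1 and k = 2, the block numbers that occur in
  \<open>model_type\<close>.\<close>

definition block_matrix :: "'a::field poly \<Rightarrow> nat \<Rightarrow> 'a mat" where
  "block_matrix s k = (if k = 1 then companion_mat s else diag_block_mat [companion_mat s, companion_mat s])"

lemma companion_mat_carrier: "companion_mat s \<in> carrier_mat (Polynomial.degree s) (Polynomial.degree s)"
  by (simp add: companion_mat_def Let_def)

lemma block_matrix_carrier:
  "k = 1 \<or> k = 2 \<Longrightarrow> block_matrix s k \<in> carrier_mat (k * Polynomial.degree s) (k * Polynomial.degree s)"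
  using companion_mat_carrier[of s] by (auto simp: block_matrix_def Let_def)

lemma block_matrix_entry:
  assumes "k = 1 \<or> k = 2" "q < k" "q' < k" "i < n" "j < n" "Polynomial.degree s = n"
  shows "block_matrix s k $$ (q * n + i, q' * n + j) = (if q = q' then companion_mat s $$ (i, j) else 0)"
proof (cases "k = 1")
  case True
  then show ?thesis using assms by (simp add: block_matrix_def)
next
  case False
  then have "q = 0 \<or> q = 1" "q' = 0 \<or> q' = 1" using assms by auto
  moreover have "dim_row (companion_mat s) = n" "dim_col (companion_mat s) = n"
    using companion_mat_carrier[of s] assms by auto
  ultimately show ?thesis using False assms by (auto simp: block_matrix_def Let_def)
qed

lemma exists_represented_by:
  fixes M :: "'a::field mat"
  assumes M: "M \<in> carrier_mat n n"
  obtains V :: "('a, nat \<Rightarrow> 'a) vspace" and v where "fd_space V" "linear_map V V v" "represented_by V v M"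
proof -
  define sc where "sc = (\<lambda>(c::'a) (f::nat \<Rightarrow> 'a) i. c * f i)"
  interpret scalar_space sc by unfold_locales (auto simp: sc_def fun_eq_iff algebra_simps)
  define U where "U = {f :: nat \<Rightarrow> 'a. \<forall>i\<ge>n. f i = 0}"
  define e where "e = (\<lambda>(j::nat) (i::nat). if i = j then 1 else (0::'a))"
  define v where "v = (\<lambda>(f::nat \<Rightarrow> 'a) i. if i < n then \<Sum>j<n. M $$ (i, j) * f j else 0)"
  let ?V = "\<lparr>vectors = U, scale = sc\<rparr>"
  have sub: "subspace U" unfolding subspace_def by (auto simp: U_def sc_def)
  have fsum: "(\<Sum>i\<in>I. g i) j = (\<Sum>i\<in>I. g i j)" for g :: "nat \<Rightarrow> nat \<Rightarrow> 'a" and I j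
    by (induction I rule: infinite_finite_induct) auto
  have comb: "(\<Sum>i<n. sc (c i) (e i)) j = (if j < n then c j else 0)" for c j
    by (simp add: fsum sc_def e_def if_distrib[of "(*) _"] cong: if_cong)
  have expand: "f = (\<Sum>i<n. sc (f i) (e i))" if "f \<in> U" for f
    using that by (intro ext) (simp add: comb U_def)
  have "\<forall>i\<in>{..<n}. c i = 0" if "(\<Sum>i\<in>{..<n}. sc (c i) (e i)) = 0" for c
  proof
    fix i assume "i \<in> {..<n}"
    then have "c i = (\<Sum>i<n. sc (c i) (e i)) i" by (simp add: comb)
    then show "c i = 0" using that by simp
  qed
  from dim_family(2,3)[of "{..<n}" e, OF _ this] have e: "inj_on e {..<n}" "independent (e ` {..<n})" by simp_all
  have span: "span (e ` {..<n}) = U"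
  proof
    show "span (e ` {..<n}) \<subseteq> U" by (rule span_minimal[OF _ sub]) (auto simp: U_def e_def)
    show "U \<subseteq> span (e ` {..<n})"
    proof
      fix f assume "f \<in> U"
      have "(\<Sum>i<n. sc (f i) (e i)) \<in> span (e ` {..<n})"
        by (intro span_sum span_scale span_base) auto
      then show "f \<in> span (e ` {..<n})" using expand[OF \<open>f \<in> U\<close>] by simp
    qed
  qed
  have basis: "ordered_basis ?V n e" using e span by (simp add: ordered_basis_def)
  have "fd_space ?V" using vector_space_axioms sub span by (auto simp: fd_space_def)
  moreover have "linear_map ?V ?V v"
    by (auto simp: linear_map_def v_def U_def sc_def fun_eq_iff sum.distrib sum_distrib_left algebra_simps)
  moreover have "represented_by ?V v M"
    unfolding represented_by_def
  proof (intro exI conjI allI impI)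
    fix j assume "j < n"
    then have "v (e j) = (\<lambda>i. if i < n then M $$ (i, j) else 0)"
      by (auto simp: v_def e_def fun_eq_iff if_distrib[of "(*) _"] cong: if_cong)
    also have "\<dots> = (\<Sum>i<n. sc (M $$ (i, j)) (e i))" by (intro ext) (simp add: comb)
    finally show "v (e j) = (\<Sum>i<n. scale ?V (M $$ (i, j)) (e i))" by simp
  qed (use M basis in auto)
  ultimately show ?thesis by (rule that)
qed

lemma symplectic_extension_block_frame:
  fixes V :: "('a::field, 'v::ab_group_add) vspace"
  assumes V: "fd_space V" "linear_map V V v" "represented_by V v (block_matrix s k)" and k: "k = 1 \<or> k = 2"
    and s: "Polynomial.lead_coeff s = 1" "Polynomial.degree s > 0"
  defines "S \<equiv> symplectic_extension V v"
  shows "\<exists>z. sympl.frame (scale S) (vectors S) (endo S) (form S) s k z \<and>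
    endo_space.gen (scale S) (endo S) (2 * k) z = vectors S"
proof -
  let ?n = "Polynomial.degree s"
  obtain e where e: "ordered_basis V (k * ?n) e"
    "\<And>q j. q < k \<Longrightarrow> Suc j < ?n \<Longrightarrow> v (e (q * ?n + j)) = e (q * ?n + Suc j)"
    "\<And>q. q < k \<Longrightarrow> v (e (q * ?n + (?n - 1))) = (\<Sum>i<?n. scale V (- Polynomial.coeff s i) (e (q * ?n + i)))"
    by (rule represented_by_blocks[OF V(1,3) block_matrix_carrier[OF k] refl s(2) block_matrix_entry[OF k _ _ _ _ refl]])
      (assumption | rule that)+
  show ?thesis unfolding S_def by (rule symplectic_extension_frame[OF V(1,2) e(1) s(1) refl s(2) e(2,3)])
qed

section \<open>Eigenvalues and the classification\<close>

text \<open>Linear factors of \<open>f\<close> are stripped one at a time: either the cofactor still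
  kills \<open>x\<close>, or it maps \<open>x\<close> to an eigenvector for the root
  removed.\<close>

lemma eigenvalue_of_annihilated:
  assumes "endo_space sc U u" "x \<in> U" "x \<noteq> 0" "(f :: 'a::alg_closed_field poly) \<noteq> 0" "act sc u f x = 0"
  shows "\<exists>l y. y \<in> U \<and> y \<noteq> 0 \<and> u y = sc l y \<and> poly f l = 0"
  using assms(4,5)
proof (induction "Polynomial.degree f" arbitrary: f rule: less_induct)
  case less
  interpret endo_space sc U u by (rule assms(1))
  have "Polynomial.degree f > 0"
  proof (rule ccontr)
    assume "\<not> Polynomial.degree f > 0"
    then obtain c where "f = [:c:]" by (metis degree_eq_zeroE gr0I)
    then show False using less.prems assms(3) by simp
  qed
  then obtain l where l: "poly f l = 0" using alg_closed_imp_poly_has_root by blast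
  then obtain g where g: "f = [:- l, 1:] * g" by (auto simp: poly_eq_0_iff_dvd)
  then have "g \<noteq> 0" using less.prems(1) by auto
  show ?case
  proof (cases "act sc u g x = 0")
    case True
    have "Polynomial.degree g < Polynomial.degree f"
      unfolding g using \<open>g \<noteq> 0\<close> by (simp add: degree_mult_eq del: mult_pCons_left)
    from less.hyps[OF this \<open>g \<noteq> 0\<close> True] show ?thesis unfolding g by (auto simp del: mult_pCons_left)
  next
    case False
    have "act sc u [:- l, 1:] (act sc u g x) = 0" using less.prems(2) act_mult[OF assms(2), of "[:- l, 1:]" g] unfolding g by metis
    then have "u (act sc u g x) = sc l (act sc u g x)" using assms(2) by (simp add: act_lin)
    then show ?thesis using False assms(2) l by (intro exI[of _ l] exI[of _ "act sc u g x"]) simp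
  qed
qed

lemma map_poly_to_ac_pCons:
  "map_poly to_ac (pCons c f) = pCons (to_ac c) (map_poly to_ac f)"
  by (rule Polynomial.map_poly_pCons) simp

text \<open>A left eigenvector of the matrix of \<open>u\<close> is a linear form \<open>\<theta>\<close> with values in the closure and
  \<open>\<theta> \<circ> u = l \<theta>\<close>, so that \<open>\<theta> \<circ> f(u) = f(l) \<theta>\<close>.\<close>

lemma closure_eigenvalue_root:
  fixes P :: "('a::field, 'v::ab_group_add, 'm) vspace_scheme"
  assumes P: "fd_space P" "endo_space (scale P) (vectors P) u"
    and ann: "\<And>x. x \<in> vectors P \<Longrightarrow> act (scale P) u f x = 0"
    and l: "l \<in> closure_eigenvalues P u"
  shows "l \<in> Root f"
proof -
  interpret endo_space "scale P" "vectors P" u by (rule P(2))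
  obtain M where M: "represented_by P u M" "eigenvalue (map_mat to_ac M) l"
    using l unfolding closure_eigenvalues_def by blast
  obtain n e where e: "M \<in> carrier_mat n n" "ordered_basis P n e"
    "\<And>j. j < n \<Longrightarrow> u (e j) = (\<Sum>i<n. scale P (M $$ (i, j)) (e i))"
    using M(1) unfolding represented_by_def by blast
  obtain co where co: "\<And>i. i < n \<Longrightarrow> co i \<in> vectors (dual P)"
    "\<And>i j. i < n \<Longrightarrow> j < n \<Longrightarrow> co i (e j) = (if i = j then 1 else 0)"
    "\<And>x. x \<in> vectors P \<Longrightarrow> x = (\<Sum>i<n. scale P (co i x) (e i))" "\<And>i. i < n \<Longrightarrow> e i \<in> vectors P"
    by (rule fd_space_coordinates[OF P(1) e(2)]) (rule that)
  let ?A = "map_mat to_ac M"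
  have A: "?A \<in> carrier_mat n n" using e(1) by simp
  have "eigenvalue (transpose_mat ?A) l"
    using M(2) A by (simp add: eigenvalue_root_char_poly[of _ n])
  then obtain w where w: "w \<in> carrier_vec n" "w \<noteq> 0\<^sub>v n" "transpose_mat ?A *\<^sub>v w = l \<cdot>\<^sub>v w"
    using A unfolding eigenvalue_def eigenvector_def by auto
  define \<theta> where "\<theta> = (\<lambda>x. \<Sum>i<n. to_ac (co i x) * w $ i)"
  have \<theta>_add: "\<theta> (x + y) = \<theta> x + \<theta> y" if "x \<in> vectors P" "y \<in> vectors P" for x y
  proof -
    have "co i (x + y) = co i x + co i y" if "i < n" for i
      using co(1)[OF that] \<open>x \<in> vectors P\<close> \<open>y \<in> vectors P\<close> by (simp add: dual_def linear_map_def ground_def)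
    then show ?thesis by (simp add: \<theta>_def sum.distrib distrib_right)
  qed
  have \<theta>_scale: "\<theta> (scale P c x) = to_ac c * \<theta> x" if "x \<in> vectors P" for c x
  proof -
    have "co i (scale P c x) = c * co i x" if "i < n" for i
      using co(1)[OF that] \<open>x \<in> vectors P\<close> by (simp add: dual_def linear_map_def ground_def)
    then show ?thesis by (simp add: \<theta>_def sum_distrib_left mult.assoc)
  qed
  have \<theta>_0: "\<theta> 0 = 0" using \<theta>_scale[of 0 0] by simp
  have \<theta>_sum: "\<theta> (\<Sum>i<m. scale P (c i) (e i)) = (\<Sum>i<m. to_ac (c i) * \<theta> (e i))" if "m \<le> n" for c m
    using that by (induction m) (auto simp: \<theta>_add \<theta>_scale \<theta>_0 co(4))
  have \<theta>_e: "\<theta> (e i) = w $ i" if "i < n" for i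
  proof -
    have "\<theta> (e i) = (\<Sum>j<n. if j = i then w $ j else 0)"
      unfolding \<theta>_def using that co(2) by (intro sum.cong) auto
    then show ?thesis using that by simp
  qed
  have \<theta>_u_e: "\<theta> (u (e j)) = l * \<theta> (e j)" if j: "j < n" for j
  proof -
    have "\<theta> (u (e j)) = (\<Sum>i<n. to_ac (M $$ (i, j)) * w $ i)"
      unfolding e(3)[OF j] using \<theta>_sum[OF order_refl] by (simp add: \<theta>_e)
    also have "\<dots> = (transpose_mat ?A *\<^sub>v w) $ j"
      using j e(1) w(1) by (auto simp: scalar_prod_def lessThan_atLeast0 intro!: sum.cong)
    also have "\<dots> = l * \<theta> (e j)" unfolding w(3) using j w(1) \<theta>_e by simp
    finally show ?thesis .
  qed
  have \<theta>_u: "\<theta> (u x) = l * \<theta> x" if x: "x \<in> vectors P" for x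
  proof -
    have partial: "\<theta> (u (\<Sum>i<m. scale P (c i) (e i))) = l * \<theta> (\<Sum>i<m. scale P (c i) (e i))" if "m \<le> n" for c m
      using that
    proof (induction m)
      case (Suc m)
      have "(\<Sum>i<m. scale P (c i) (e i)) \<in> vectors P" using Suc.prems co(4) by simp
      then show ?case using Suc co(4)[of m]
        by (simp add: u_add u_scale \<theta>_add \<theta>_scale \<theta>_u_e algebra_simps)
    qed (simp add: \<theta>_0)
    show ?thesis using partial[OF order_refl, of "\<lambda>i. co i x"] co(3)[OF x] by simp
  qed
  have \<theta>_act: "\<theta> (act (scale P) u g x) = poly (map_poly to_ac g) l * \<theta> x" if "x \<in> vectors P" for g x
  proof (induction g)
    case (pCons c g)
    then show ?case using that
      by (simp add: act_pCons \<theta>_add \<theta>_scale \<theta>_u map_poly_to_ac_pCons algebra_simps del: map_poly_pCons)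
  qed (simp add: \<theta>_0)
  obtain j where j: "j < n" "w $ j \<noteq> 0" using w(1,2) by (metis carrier_vecD eq_vecI index_zero_vec(1) index_zero_vec(2))
  have "0 = poly (map_poly to_ac f) l * \<theta> (e j)" using \<theta>_act[OF co(4)[OF j(1)], of f] ann[OF co(4)[OF j(1)]] \<theta>_0 by simp
  then show ?thesis using j \<theta>_e by (simp add: Root_def)
qed

text \<open>Extension of scalars by coordinates: the matrix of \<open>u\<close> acts on sequences
  over the closure, and \<open>f\<close> in this action still kills the coordinate vector of
  \<open>x\<close>. So some root of \<open>f\<close> is an eigenvalue of the matrix.\<close>

lemma exists_closure_eigenvalue:
  fixes P :: "('a::field, 'v::ab_group_add, 'm) vspace_scheme"
  assumes P: "fd_space P" "endo_space (scale P) (vectors P) u"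
    and f: "f \<noteq> 0" "x \<in> vectors P" "x \<noteq> 0" "act (scale P) u f x = 0"
  shows "\<exists>l \<in> closure_eigenvalues P u. l \<in> Root f"
proof -
  interpret endo_space "scale P" "vectors P" u by (rule P(2))
  obtain n e where e: "ordered_basis P n e" using exists_ordered_basis[OF P(1)] .
  obtain co where co: "\<And>i. i < n \<Longrightarrow> co i \<in> vectors (dual P)"
    "\<And>i j. i < n \<Longrightarrow> j < n \<Longrightarrow> co i (e j) = (if i = j then 1 else 0)"
    "\<And>x. x \<in> vectors P \<Longrightarrow> x = (\<Sum>i<n. scale P (co i x) (e i))" "\<And>i. i < n \<Longrightarrow> e i \<in> vectors P"
    by (rule fd_space_coordinates[OF P(1) e]) (rule that)
  define M where "M = mat n n (\<lambda>(i, j). co i (u (e j)))"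
  have rep: "represented_by P u M"
    unfolding represented_by_def
  proof (intro exI conjI allI impI)
    show "M \<in> carrier_mat n n" by (simp add: M_def)
    fix j assume "j < n"
    then show "u (e j) = (\<Sum>i<n. scale P (M $$ (i, j)) (e i))"
      using co(3)[of "u (e j)"] co(4) by (simp add: M_def)
  qed (rule e)
  define sc where "sc = (\<lambda>(c::'a alg_closure) (w::nat \<Rightarrow> 'a alg_closure) i. c * w i)"
  define U where "U = {w :: nat \<Rightarrow> 'a alg_closure. \<forall>i\<ge>n. w i = 0}"
  define v where "v = (\<lambda>(w::nat \<Rightarrow> 'a alg_closure) i. if i < n then \<Sum>j<n. to_ac (M $$ (i, j)) * w j else 0)"
  have vs: "vector_space sc" by unfold_locales (auto simp: sc_def fun_eq_iff algebra_simps)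
  interpret C: scalar_space sc using vs by (simp add: scalar_space_def)
  have endoU: "endo_space sc U v"
  proof
    show "C.subspace U" by (rule C.subspaceI) (auto simp: U_def sc_def)
  qed (auto simp: U_def v_def sc_def fun_eq_iff sum.distrib sum_distrib_left algebra_simps)
  define \<iota> where "\<iota> = (\<lambda>x i. if i < n then to_ac (co i x) else 0)"
  have co_lin: "co i (y + z) = co i y + co i z" "co i (scale P c y) = c * co i y"
    if "i < n" "y \<in> vectors P" "z \<in> vectors P" for i y z c
    using co(1)[OF that(1)] that(2,3) by (simp_all add: dual_def linear_map_def ground_def)
  have \<iota>_add: "\<iota> (y + z) = \<iota> y + \<iota> z" if "y \<in> vectors P" "z \<in> vectors P" for y z
    using co_lin that by (auto simp: \<iota>_def fun_eq_iff)
  have \<iota>_scale: "\<iota> (scale P c y) = sc (to_ac c) (\<iota> y)" if "y \<in> vectors P" for c y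
    using co_lin(2)[OF _ that that] by (auto simp: \<iota>_def sc_def fun_eq_iff)
  have \<iota>_u: "\<iota> (u y) = v (\<iota> y)" if y: "y \<in> vectors P" for y
  proof
    fix i
    have partial: "co i (u (\<Sum>j<m. scale P (c j) (e j))) = (\<Sum>j<m. c j * co i (u (e j)))"
      if "i < n" "m \<le> n" for c m
      using that(2)
    proof (induction m)
      case 0
      have "co i (scale P 0 0) = 0 * co i 0" by (rule co_lin(2)[OF \<open>i < n\<close> V_0 V_0])
      then show ?case by simp
    next
      case (Suc m)
      have "(\<Sum>j<m. scale P (c j) (e j)) \<in> vectors P" using Suc.prems co(4) by simp
      then show ?case using Suc co(4)[of m] co_lin[OF \<open>i < n\<close>] by (simp add: u_add u_scale)
    qed
    show "\<iota> (u y) i = v (\<iota> y) i"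
    proof (cases "i < n")
      case True
      have "co i (u y) = (\<Sum>j<n. co j y * co i (u (e j)))"
        using partial[OF True order_refl, of "\<lambda>j. co j y"] co(3)[OF y] by simp
      then show ?thesis using True by (simp add: \<iota>_def v_def M_def to_ac_sum mult.commute)
    qed (simp add: \<iota>_def v_def)
  qed
  have \<iota>_0: "\<iota> 0 = 0" using \<iota>_add[of 0 0] by simp
  have \<iota>_act: "\<iota> (act (scale P) u g y) = act sc v (map_poly to_ac g) (\<iota> y)" if y: "y \<in> vectors P" for g y
  proof (induction g)
    case 0
    then show ?case by (simp add: act_def \<iota>_0 C.scale_zero_left)
  next
    case (pCons c g)
    have "\<iota> y \<in> U" by (simp add: \<iota>_def U_def)
    then show ?case using y pCons
      by (simp add: act_pCons endo_space.act_pCons[OF endoU] \<iota>_add \<iota>_scale \<iota>_u map_poly_to_ac_pCons del: map_poly_pCons)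
  qed
  have "\<iota> x \<noteq> 0"
  proof
    assume "\<iota> x = 0"
    then have "co i x = 0" if "i < n" for i using that by (auto simp: \<iota>_def fun_eq_iff dest: spec[of _ i])
    then have "(\<Sum>i<n. scale P (co i x) (e i)) = 0" by simp
    then show False using co(3)[OF f(2)] f(3) by simp
  qed
  moreover have "\<iota> x \<in> U" by (simp add: \<iota>_def U_def)
  moreover have "map_poly to_ac f \<noteq> 0" using f(1) by (simp add: map_poly_eq_0_iff)
  moreover have "act sc v (map_poly to_ac f) (\<iota> x) = 0" using \<iota>_act[OF f(2), of f] f(4) \<iota>_0 by simp
  ultimately obtain l w where w: "w \<in> U" "w \<noteq> 0" "v w = sc l w" "poly (map_poly to_ac f) l = 0"
    using eigenvalue_of_annihilated[OF endoU] by metis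
  have "eigenvector (map_mat to_ac M) (vec n w) l"
    unfolding eigenvector_def
  proof (intro conjI)
    show "vec n w \<in> carrier_vec (dim_row (map_mat to_ac M))" by (simp add: M_def)
    show "vec n w \<noteq> 0\<^sub>v (dim_row (map_mat to_ac M))"
    proof
      assume "vec n w = 0\<^sub>v (dim_row (map_mat to_ac M))"
      then have "vec n w $ i = 0" if "i < n" for i using that by (simp add: M_def)
      then have "w i = 0" for i using w(1) by (cases "i < n") (auto simp: U_def)
      then show False using w(2) by auto
    qed
    show "map_mat to_ac M *\<^sub>v vec n w = l \<cdot>\<^sub>v vec n w"
    proof (rule eq_vecI)
      fix i assume "i < dim_vec (l \<cdot>\<^sub>v vec n w)"
      then have i: "i < n" by simp
      have "(map_mat to_ac M *\<^sub>v vec n w) $ i = v w i"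
        using i by (auto simp: v_def M_def scalar_prod_def lessThan_atLeast0 intro!: sum.cong)
      also have "\<dots> = (l \<cdot>\<^sub>v vec n w) $ i" using i w(3) by (simp add: sc_def)
      finally show "(map_mat to_ac M *\<^sub>v vec n w) $ i = (l \<cdot>\<^sub>v vec n w) $ i" .
    qed (simp add: M_def)
  qed
  then have "l \<in> closure_eigenvalues P u"
    using rep unfolding closure_eigenvalues_def eigenvalue_def by blast
  then show ?thesis using w(4) by (auto simp: Root_def)
qed

lemma Root_mult: "Root (f * g) = Root f \<union> Root (g :: 'a::field poly)"
proof -
  interpret h: map_poly_comm_semiring_hom "to_ac :: 'a \<Rightarrow> 'a alg_closure" by unfold_locales auto
  show ?thesis by (auto simp: Root_def h.hom_mult)
qed

lemma Root_power: "Root (f ^ n) \<subseteq> Root (f :: 'a::field poly)"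
  by (induction n) (auto simp: Root_mult, auto simp: Root_def)

lemma Root_linear: "Root [:- d, 1:] = {to_ac d}"
  by (auto simp: Root_def map_poly_to_ac_pCons simp del: map_poly_pCons)

text \<open>The common divisor given by Bezout has the root \<open>x\<close>, hence is not a unit
  and is associated to \<open>f\<close>.\<close>

lemma irreducible_dvd_of_common_root:
  fixes f g :: "'a::field poly"
  assumes f: "Factorial_Ring.irreducible f" and x: "x \<in> Root f" "x \<in> Root g"
  shows "f dvd g"
proof -
  have "f \<noteq> 0" using f by auto
  then obtain a c d where d: "d = a * f + c * g" "d dvd f" "d dvd g" by (metis poly_bezout)
  interpret h: map_poly_comm_semiring_hom "to_ac :: 'a \<Rightarrow> 'a alg_closure" by unfold_locales auto
  have "x \<in> Root d" using x unfolding d(1) by (simp add: Root_def h.hom_add h.hom_mult)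
  have "\<not> d dvd 1"
  proof
    assume "d dvd 1"
    then obtain e where "1 = d * e" by (rule dvdE)
    then have "x \<in> Root (1 :: 'a poly)" using \<open>x \<in> Root d\<close> Root_mult[of d e] by simp
    then show False by (simp add: Root_def)
  qed
  then have "f dvd d" using d(2) f by (metis irreducible_altdef)
  then show ?thesis using d(3) dvd_trans by blast
qed

theorem mainTheorem11:
  fixes p q :: "'a::field poly" and L :: "'a alg_closure set"
  assumes "Polynomial.lead_coeff p = 1" "Polynomial.degree p = 2" "Factorial_Ring.irreducible p"
    and "Polynomial.lead_coeff q = 1" "Polynomial.degree q = 2" "Factorial_Ring.irreducible q"
    and "splitting_field p = L" "splitting_field q = L"
  shows
    "(\<forall>(V :: ('a, 'v::ab_group_add) vspace) v M.
        fd_space V \<and> linear_map V V v \<and> M \<in> model_matrices p q L \<and> represented_by V v M \<longrightarrow>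
        indecomposable_difference p q (symplectic_extension V v) \<and>
        pq_exceptional p q (symplectic_extension V v)) \<and>
     (\<forall>P :: ('a, 'w::ab_group_add) form_space.
        indecomposable_difference p q P \<and> pq_exceptional p q P \<longrightarrow>
        (\<exists>(V :: ('a, nat \<Rightarrow> 'a) vspace) v M.
           fd_space V \<and> linear_map V V v \<and> M \<in> model_matrices p q L \<and> represented_by V v M \<and>
           isometric P (symplectic_extension V v)))"
proof -
  define \<alpha> \<kappa> \<beta> \<mu> where "\<alpha> = Polynomial.coeff p 0" and "\<kappa> = poly_trace p"
    and "\<beta> = Polynomial.coeff q 0" and "\<mu> = poly_trace q"
  have quad: "r = [:Polynomial.coeff r 0, - poly_trace r, 1:]"
    if "Polynomial.lead_coeff r = 1" "Polynomial.degree r = 2" for r :: "'a poly"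
  proof (rule poly_eqI)
    fix i :: nat
    consider "i = 0" | "i = 1" | "i = 2" | "i > 2" by linarith
    then show "Polynomial.coeff r i = Polynomial.coeff [:Polynomial.coeff r 0, - poly_trace r, 1:] i"
      using that by cases (auto simp: poly_trace_def coeff_pCons coeff_eq_0 numeral_2_eq_2 split: nat.splits)
  qed
  have p: "p = [:\<alpha>, - \<kappa>, 1:]" and q: "q = [:\<beta>, - \<mu>, 1:]"
    using quad assms unfolding \<alpha>_def \<kappa>_def \<beta>_def \<mu>_def by blast+
  have rootp: "quadratic_root \<alpha> \<kappa> x" if "x \<in> Root p" for x
    using that irreducible_quadratic_no_root[OF assms(3,2)] by unfold_locales (auto simp flip: p)
  have L_eq: "quadratic_root.L x = L" if "x \<in> Root p" for x
    using quadratic_root.splitting_field_eq[OF rootp[OF that]] assms(7) rootp[OF that]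
    by (simp add: quadratic_root.L_def p)
  have rooty: "y \<in> L" "y \<in> Root [:\<beta>, - \<mu>, 1:]" "y \<notin> range to_ac" if "y \<in> Root q" for y
    using that assms(8) irreducible_quadratic_no_root[OF assms(6,5)] q
    by (auto simp: splitting_field_def intro: generate_field.incl)
  have norm: "\<exists>c. quadratic_norm L (x - y) = to_ac c \<and> (x - y) * (to_ac (\<kappa> - \<mu>) - (x - y)) = to_ac c"
    if "x \<in> Root p" "y \<in> Root q" for x y
    using quadratic_root.difference_norm[OF rootp[OF that(1)], of y \<beta> \<mu>] rooty[OF that(2)]
    unfolding L_eq[OF that(1)] by metis
  define C where "C = {c. \<exists>x y. x \<in> Root p \<and> y \<in> Root q \<and> x - y \<notin> range to_ac \<and> to_ac c = quadratic_norm L (x - y)}"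
  define D where "D = {d. \<exists>x y. x \<in> Root p \<and> y \<in> Root q \<and> to_ac d = x - y}"
  have C_root: "\<exists>x y. x \<in> Root p \<and> y \<in> Root q \<and> x - y \<notin> range to_ac \<and> x - y \<in> Root [:c, - (\<kappa> - \<mu>), 1:]"
    if c: "c \<in> C" for c
  proof -
    obtain x y where xy: "x \<in> Root p" "y \<in> Root q" "x - y \<notin> range to_ac" "to_ac c = quadratic_norm L (x - y)"
      using c unfolding C_def by blast
    then have "(x - y) * (to_ac (\<kappa> - \<mu>) - (x - y)) = to_ac c" using norm by metis
    then have "x - y \<in> Root [:c, - (\<kappa> - \<mu>), 1:]" unfolding Root_quadratic by (simp add: algebra_simps)
    then show ?thesis using xy by blast
  qed
  interpret difference_data \<alpha> \<kappa> \<beta> \<mu> C D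
  proof
    show "Factorial_Ring.irreducible [:\<alpha>, - \<kappa>, 1:]" using assms(3) p by simp
    show "Factorial_Ring.irreducible [:c, - (\<kappa> - \<mu>), 1:]" if "c \<in> C" for c
      using C_root[OF that] irreducible_quadratic by blast
    fix d assume "d \<in> D"
    then obtain x y where xy: "x \<in> Root p" "y \<in> Root q" "to_ac d = x - y" unfolding D_def by blast
    show "\<mu> = \<kappa> - (d + d)" "\<beta> = \<alpha> - d * \<kappa> + d * d"
      using quadratic_root.difference_in_base[OF rootp[OF xy(1)], of y \<beta> \<mu> d] rooty[OF xy(2)] xy(3)[symmetric]
      unfolding L_eq[OF xy(1)] by blast+
  qed
  have model_sets:
      "{companion_mat ([:c, - (\<kappa> - \<mu>), 1:] ^ n) |c n x y. n \<ge> 1 \<and> x \<in> Root p \<and> y \<in> Root q \<and>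
          x - y \<notin> range to_ac \<and> to_ac c = quadratic_norm L (x - y)} =
       {companion_mat ([:c, - (\<kappa> - \<mu>), 1:] ^ n) |c n. n \<ge> 1 \<and> c \<in> C}"
      "{diag_block_mat [companion_mat ([:- d, 1:] ^ n), companion_mat ([:- d, 1:] ^ n)] |d n x y.
          odd n \<and> x \<in> Root p \<and> y \<in> Root q \<and> to_ac d = x - y} =
       {diag_block_mat [companion_mat ([:- d, 1:] ^ n), companion_mat ([:- d, 1:] ^ n)] |d n. odd n \<and> d \<in> D}"
      "{companion_mat ([:- d, 1:] ^ n) |d n x y.
          n \<ge> 1 \<and> even n \<and> x \<in> Root p \<and> y \<in> Root q \<and> to_ac d = x - y} =
       {companion_mat ([:- d, 1:] ^ n) |d n. n \<ge> 1 \<and> even n \<and> d \<in> D}"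
    unfolding C_def D_def mem_Collect_eq by (rule Collect_cong, iprover)+
  have block1: "block_matrix s 1 = companion_mat s" for s :: "'a poly" by (simp add: block_matrix_def)
  have block2: "block_matrix s 2 = diag_block_mat [companion_mat s, companion_mat s]" for s :: "'a poly"
    by (simp add: block_matrix_def)
  have model: "M \<in> model_matrices p q L \<longleftrightarrow> (\<exists>s k. model_type s k \<and> M = block_matrix s k)" for M
  proof -
    have "M \<in> model_matrices p q L \<longleftrightarrow>
        (\<exists>c n. M = companion_mat ([:c, - (\<kappa> - \<mu>), 1:] ^ n) \<and> n \<ge> 1 \<and> c \<in> C) \<or>
        (\<exists>d n. M = diag_block_mat [companion_mat ([:- d, 1:] ^ n), companion_mat ([:- d, 1:] ^ n)] \<and> odd n \<and> d \<in> D) \<or>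
        (\<exists>d n. M = companion_mat ([:- d, 1:] ^ n) \<and> n \<ge> 1 \<and> even n \<and> d \<in> D)"
      unfolding model_matrices_def \<kappa>_def[symmetric] \<mu>_def[symmetric] model_sets Un_iff mem_Collect_eq disj_assoc ..
    also have "\<dots> \<longleftrightarrow> (\<exists>s. (\<exists>c\<in>C. \<exists>n>0. s = [:c, - (\<kappa> - \<mu>), 1:] ^ n) \<and> M = block_matrix s 1) \<or>
        (\<exists>s. (\<exists>d\<in>D. \<exists>n. odd n \<and> s = [:- d, 1:] ^ n) \<and> M = block_matrix s 2) \<or>
        (\<exists>s. (\<exists>d\<in>D. \<exists>n>0. even n \<and> s = [:- d, 1:] ^ n) \<and> M = block_matrix s 1)"
      unfolding block1 block2 unfolding One_nat_def Suc_le_eq Bex_def by (intro arg_cong2[where f = "(\<or>)"]; iprover)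
    also have "\<dots> \<longleftrightarrow> (\<exists>s k. model_type s k \<and> M = block_matrix s k)"
      unfolding model_type_def by iprover
    finally show ?thesis .
  qed
  have ty: "Polynomial.lead_coeff s = 1" "Polynomial.degree s > 0" "k = 1 \<or> k = 2" if "model_type s k" for s k
  proof -
    have "\<exists>f n. s = f ^ n \<and> n > 0 \<and> Polynomial.lead_coeff f = 1 \<and> Polynomial.degree f > 0"
      using that unfolding model_type_def
    proof (elim disjE conjE bexE exE)
      fix c n assume "n > 0" "s = [:c, - (\<kappa> - \<mu>), 1:] ^ n"
      then show ?thesis by (intro exI[of _ "[:c, - (\<kappa> - \<mu>), 1:]"] exI[of _ n]) simp
    next
      fix d n assume "odd n" "s = [:- d, 1:] ^ n"
      then show ?thesis by (intro exI[of _ "[:- d, 1:]"] exI[of _ n]) (auto intro: odd_pos)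
    next
      fix d n assume "n > 0" "s = [:- d, 1:] ^ n"
      then show ?thesis by (intro exI[of _ "[:- d, 1:]"] exI[of _ n]) simp
    qed
    then show "Polynomial.lead_coeff s = 1" "Polynomial.degree s > 0" using monic_degree_power by fastforce+
    show "k = 1 \<or> k = 2" using that by (auto simp: model_type_def)
  qed
  have ty_root: "Root s \<subseteq> {x - y |x y. x \<in> Root p \<and> y \<in> Root q}" if "model_type s k" for s k
    using that unfolding model_type_def
  proof (elim disjE conjE bexE exE)
    fix c n assume c: "c \<in> C" "s = [:c, - (\<kappa> - \<mu>), 1:] ^ n"
    show ?thesis
    proof
      fix l assume "l \<in> Root s"
      then have l: "l \<in> Root [:c, - (\<kappa> - \<mu>), 1:]" using c(2) Root_power by blast
      obtain x y where xy: "x \<in> Root p" "y \<in> Root q" "x - y \<in> Root [:c, - (\<kappa> - \<mu>), 1:]"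
        using C_root[OF c(1)] by blast
      \<comment> \<open>The second root of the quadratic is \<delta> - (x - y), the difference of
        the other roots of p and q.\<close>
      have "l = x - y \<or> l = (to_ac \<kappa> - x) - (to_ac \<mu> - y)"
        using quadratic_other_root[OF xy(3) l] by (simp add: algebra_simps)
      moreover have "to_ac \<kappa> - x \<in> Root p" "to_ac \<mu> - y \<in> Root q" using xy(1,2) root_conj unfolding p q by blast+
      ultimately show "l \<in> {x - y |x y. x \<in> Root p \<and> y \<in> Root q}" using xy by blast
    qed
  qed (use Root_power in \<open>force simp: D_def Root_linear\<close>)+
  have exc: "exceptional_on (scale P) (vectors P) (endo P)"
    if P: "symplectic_pair P" "pq_exceptional p q P" for P :: "('a, 'w) form_space"
    unfolding exceptional_on_def
  proof (intro allI ballI impI)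
    fix \<pi> z assume \<pi>: "Factorial_Ring.irreducible \<pi>" and z: "z \<in> vectors P" "z \<noteq> 0" "act (scale P) (endo P) \<pi> z = 0"
    have fd: "fd_space P" using P(1) by (simp add: symplectic_pair_def)
    have endo: "endo_space (scale P) (vectors P) (endo P)"
      using P(1) by (simp add: symplectic_pair_iff sympl.axioms(1))
    have "\<pi> \<noteq> 0" using \<pi> by auto
    then obtain l where l: "l \<in> closure_eigenvalues P (endo P)" "l \<in> Root \<pi>"
      using exists_closure_eigenvalue[OF fd endo _ z] by blast
    then obtain x y where xy: "x \<in> Root p" "y \<in> Root q" "l = x - y" using P(2) unfolding pq_exceptional_def by blast
    \<comment> \<open>The polynomial \<pi> has the eigenvalue x - y as a root. It is thus divisible
      by t - (x - y) if this difference lies in F, and otherwise by the irreducible quadratic built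
      from its norm.\<close>
    show "(\<exists>c\<in>C. [:c, - (\<kappa> - \<mu>), 1:] dvd \<pi>) \<or> (\<exists>d\<in>D. [:- d, 1:] dvd \<pi>)"
    proof (cases "l \<in> range to_ac")
      case True
      then obtain d where d: "l = to_ac d" by blast
      then have "to_ac d = x - y" using xy(3) by simp
      then have "d \<in> D" unfolding D_def using xy(1,2) by blast
      moreover have "[:- d, 1:] dvd \<pi>" using l(2) d by (simp add: Root_to_ac_iff poly_eq_0_iff_dvd)
      ultimately show ?thesis by blast
    next
      case False
      obtain c where c: "quadratic_norm L (x - y) = to_ac c" "(x - y) * (to_ac (\<kappa> - \<mu>) - (x - y)) = to_ac c"
        using norm[OF xy(1,2)] by blast
      have "x - y \<notin> range to_ac" using False xy(3) by simp
      then have "c \<in> C" unfolding C_def using xy(1,2) c(1)[symmetric] by blast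
      have "l \<in> Root [:c, - (\<kappa> - \<mu>), 1:]"
        using c(2) unfolding Root_quadratic xy(3) by (simp add: algebra_simps)
      then have "[:c, - (\<kappa> - \<mu>), 1:] dvd \<pi>"
        using irreducible_dvd_of_common_root C_irr[OF \<open>c \<in> C\<close>] l(2) by blast
      then show ?thesis using \<open>c \<in> C\<close> by blast
    qed
  qed
  have pair_eta: "\<lparr>vectors = vectors P, scale = scale P, form = form P, endo = endo P\<rparr> = P"
    for P :: "('a, 'x::ab_group_add) form_space" by simp
  show ?thesis
  proof (intro conjI allI impI; elim conjE)
    fix V :: "('a, 'v) vspace" and v M
    assume V: "fd_space V" "linear_map V V v" and "M \<in> model_matrices p q L" and M: "represented_by V v M"
    then obtain s k where s: "model_type s k" "M = block_matrix s k" using model by blast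
    let ?S = "symplectic_extension V v"
    interpret S: sympl "scale ?S" "vectors ?S" "endo ?S" "form ?S" by (rule symplectic_extension_sympl[OF V])
    obtain z where z: "S.frame s k z" "S.gen (2 * k) z = vectors ?S"
      using symplectic_extension_block_frame[OF V M[unfolded s(2)] ty(3,1,2)[OF s(1)]] by (elim exE conjE)
    show "indecomposable_difference p q ?S"
      using model_frame_indecomposable[OF S.sympl_axioms z s(1)] unfolding pair_eta p[symmetric] q[symmetric] .
    have "fd_space ?S"
      using symplectic_pair_iff[of ?S] S.sympl_axioms by (simp add: symplectic_pair_def)
    moreover have "act (scale ?S) (endo ?S) s x = 0" if "x \<in> vectors ?S" for x
      by (rule S.frame_gen_ann[OF z(1) _ dvd_refl]) (simp only: z(2) that)
    ultimately have "closure_eigenvalues ?S (endo ?S) \<subseteq> Root s"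
      by (intro subsetI) (rule closure_eigenvalue_root[OF _ S.endo_space_axioms])
    then show "pq_exceptional p q ?S" unfolding pq_exceptional_def using ty_root[OF s(1)] by (rule subset_trans)
  next
    fix P :: "('a, 'w) form_space"
    assume ind: "indecomposable_difference p q P" and pqe: "pq_exceptional p q P"
    have diff: "symplectic_difference p q P" and nontriv: "vectors P \<noteq> {0}"
      using ind by (simp_all add: indecomposable_difference_def trivial_pair_def)
    have sp: "symplectic_pair P" using diff by (simp add: symplectic_difference_def)
    interpret P: sympl "scale P" "vectors P" "endo P" "form P" using sp by (simp add: symplectic_pair_iff)
    have ranks: "even_ranks (scale P) (vectors P) (endo P)"
      using even_ranks_of_difference[OF P.sympl_axioms] diff unfolding pair_eta p[symmetric] q[symmetric] .
    note exc = exc[OF sp pqe]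
    obtain s k z where z: "P.frame s k z" and s: "model_type s k"
      using exists_model_frame[OF P.sympl_axioms ranks exc nontriv] by (elim exE conjE)
    let ?W = "P.gen (2 * k) z" and ?R = "P.perp (P.gen (2 * k) z)"
    note W = even_ranks_perp[OF P.sympl_axioms ranks z s]
    have "?R \<subseteq> vectors P" by (auto simp: P.perp_def)
    \<comment> \<open>The complement is exceptional with ranks divisible by 4, hence a difference;
      indecomposability then forces it to be zero.\<close>
    then have R: "symplectic_difference pol_p pol_q (P.pair ?R)"
      by (intro difference_of_exceptional[OF P.sympl_frame_perp[OF z] W(2)] exceptional_on_subset[OF exc])
    have "indecomposable_difference pol_p pol_q (P.pair (vectors P))"
      using ind unfolding pair_eta p[symmetric] q[symmetric] .
    then have "?W = {0} \<or> ?R = {0}"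
      using P.indecomposableD[OF _ P.frame_orthogonal_decomposition[OF z] W(1) R] by iprover
    moreover have "?W \<noteq> {0}"
    proof
      assume "?W = {0}"
      then have "P.dim ?W = 0"
        using P.dim_eq_0_iff[OF P.finitely_spanned_subset[OF P.fin_V P.frame_gen_subset[OF z]] P.subspace_frame_gen[OF z]]
        by (rule iffD2[rotated])
      then show False using P.dim_image_frame_gen[OF z, of 1] ty[OF s] by auto
    qed
    ultimately have "?R = {0}" by blast
    have full: "?W = vectors P"
    proof
      show "vectors P \<subseteq> ?W"
      proof
        fix x assume "x \<in> vectors P"
        then obtain w r where "w \<in> ?W" "r \<in> ?R" "x = w + r" by (rule P.frame_decomposition[OF z])
        then show "x \<in> ?W" using \<open>?R = {0}\<close> by simp
      qed
    qed (rule P.frame_gen_subset[OF z])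
    \<comment> \<open>A model with the same \<open>s\<close> and \<open>k\<close>: both sides are
      generated by frames of the same type and are therefore isometric.\<close>
    obtain V :: "('a, nat \<Rightarrow> 'a) vspace" and v where
      V: "fd_space V" "linear_map V V v" "represented_by V v (block_matrix s k)"
      using exists_represented_by[OF block_matrix_carrier[OF ty(3)[OF s]]] .
    let ?S = "symplectic_extension V v"
    interpret S: sympl "scale ?S" "vectors ?S" "endo ?S" "form ?S" by (rule symplectic_extension_sympl[OF V(1,2)])
    obtain z' where z': "S.frame s k z'" "S.gen (2 * k) z' = vectors ?S"
      using symplectic_extension_block_frame[OF V ty(3,1,2)[OF s]] by (elim exE conjE)
    have "isometric P ?S"
      using frames_isometric[OF P.sympl_axioms z full S.sympl_axioms z'] unfolding pair_eta .
    then show "\<exists>(V :: ('a, nat \<Rightarrow> 'a) vspace) v M.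
        fd_space V \<and> linear_map V V v \<and> M \<in> model_matrices p q L \<and> represented_by V v M \<and>
        isometric P (symplectic_extension V v)" using V model[of "block_matrix s k"] s by iprover
  qed
qed

end
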